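(* Let $\mathcal A$ be an indexing collection of finite dimension on $\mathcal T$, with compatible metric $d_{\mathcal A}$ and reference measure $m$, let $X$ be an $L^2$ set-indexed Lévy process with cancelled drift, $f:\mathcal T\to\mathbb R$ a locally $X$-integrable function and $Y=\{Y_A:A\in\mathcal A\}$, $Y_A=\int_A f\,dX$, all as in the context. Let $A\in\mathcal A$. Suppose that $\sigma^2=0$ and that $f$ is bounded in the victiny of $A$, i.e. $\sup_{s\in\mathcal V(A,\rho_0)}|f(s)|<\infty$ for some $\rho_0>0$. Then, with probability one, $$\sup_{(\alpha,q,q')\in\underline R_f(A)}\min\left\{\frac q\beta,\ \frac{q'}\beta+\alpha\right\}\ \le\ \alpha_Y(A)\ \le\ \inf_{(\alpha,q)\in\overline R_f(A)}\left\{\frac q\beta+\alpha\right\},$$ with the conventions $\inf\varnothing=1/0=+\infty$.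
   Context: Indexing collection. $\mathcal T$ is a non-empty set. $\mathcal A\subseteq\mathcal P(\mathcal T)$ is an indexing collection on $\mathcal T$ if: (1) $\varnothing\in\mathcal A$, and $\mathcal A$ and $\mathcal A\setminus\{\varnothing\}$ are closed under countable intersections; (2) there is an increasing sequence of finite subcollections $\mathcal A_n\subseteq\mathcal A$ ($n\in\mathbb N$), each closed under intersections, such that with $g_n(A)=\bigcap\{A'\in\mathcal A_n\cup\{\mathcal T\}:A\subseteq A'\}$ one has $A=\bigcap_n g_n(A)$ for all $A\in\mathcal A$; (3) (SHAPE) if $A,A_1,\dots,A_n\in\mathcal A$ and $A\subseteq\bigcup_{i\le n}A_i$ then $A\subseteq A_j$ for some $j$; (4) (TIP) the map $t\mapsto A(t)=\bigcap_nA_n(t)$, with $A_n(t)=\bigcap\{A\in\mathcal A_n\cup\{\mathcal T\}:t\in A\}$, is a bijection from $\mathcal T$ onto $\mathcal A\setminus\{\varnothing\}$. The sequence $(\mathcal A_n)$ is fixed, and $\varnothing$ and $\varnothing'=\bigcap_{A\in\mathcal A,A\ne\varnothing}A$ are assumed to belong to every $\mathcal A_n$. $\mathcal B=\sigma(\mathcal A)$. $\mathcal C_k=\{A_0\setminus\bigcup_{i=1}^{k+1}A_i:A_0,\dots,A_{k+1}\in\mathcal A\}$. $\mathcal C^\ell(\mathcal A_n)$ is the collection of sets $A\setminus\bigcup_{A'\in\mathcal A_n,A'\subsetneq A}A'$, $A\in\mathcal A_n$; $\mathcal C^\ell=\bigcup_n\mathcal C^\ell(\mathcal A_n)$. Finite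 dimension. There is $p\in\mathbb N^*$ such that every $(\mathcal A_n,\subseteq)$ admits an order embedding into $\mathbb N^p$ with the componentwise order, and $\mathcal C^\ell\subseteq\mathcal C_{p-1}$; the least such $p$ is $\dim\mathcal A$. Compatible metric. A pseudo-metric $d_{\mathcal A}$ on $\mathcal A$ ("metric" for short), transported to $\mathcal T$ by $d_{\mathcal T}(s,t)=d_{\mathcal A}(A(s),A(t))$, is (set-indexed) compatible if: (i) $d_{\mathcal A}(A\cap A'',A'\cap A'')\le d_{\mathcal A}(A,A')$; (ii) $d_{\mathcal A}(A_n,\bigcap_kA_k)\to0$ for every non-increasing sequence $(A_n)$ in $\mathcal A$; (iii) $\max_{C\in\mathcal C^\ell(\mathcal A_n)}\mathrm{diam}(C)\to0$ as $n\to\infty$, where $\mathrm{diam}(C)=\sup_{s,s'\in C}d_{\mathcal T}(s,s')$; (iv) for $A\subseteq A'$ in $\mathcal A$ there is $A''\in\mathcal A$ with $A\subseteq A''\subseteq A'$ and $d_{\mathcal A}(A,A'')=d_{\mathcal A}(A'',A')=d_{\mathcal A}(A,A')/2$. Open balls are denoted $B_{\mathcal A}(A,\rho)$. A compatible metric $d_{\mathcal A}$ is fixed. $m$ is a measure on $(\mathcal T,\mathcal B)$, finite on $\mathcal A$, such that $d_m(A,A')=m(A\triangle A')$ is also compatible. Victiny and divergence. $\mathcal V(A,\rho)=\bigcup_{A'\in B_{\mathcal A}(A,\rho)}(A\triangle A')$ for $\rho>0$ and $\mathfrak d(t,A)=\inf\{\rho>0:t\in\mathcal V(A,\rho)\}$.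 The processes. $(\Omega,\mathcal F,\mathbf P)$ is a complete probability space. $\sigma\ge0$, $\nu$ is a Borel measure on $\mathbb R$ with $\nu(\{0\})=0$ and $\int x^2\,\nu(dx)<\infty$. $B=\{B_A\}$ is a centered Gaussian process with $\mathbf E[B_{A_1}B_{A_2}]=m(A_1\cap A_2)$, and $\widetilde\Pi$ is an independent Poisson random set on $\mathcal T\times\mathbb R$ with intensity $m\otimes\nu$. For measurable $g:\mathcal T\to\mathbb R$ and $\varepsilon>0$, $$\int_Ag\,d\widetilde N^\varepsilon=\sum_{(t,J)\in\widetilde\Pi,\ t\in A,\ |J|\ge\varepsilon}g(t)J,\qquad \int_Ag\,dN^\varepsilon=\int_Ag\,d\widetilde N^\varepsilon-\int_Ag\,dm\int_{\varepsilon\le|x|\le1}x\,\nu(dx),$$ and $\int_Ag\,dN$ (resp. $\int_Ag\,d\widetilde N$ when $\int_{|x|\le1}|x|\nu(dx)<\infty$) is the limit as $\varepsilon\to0^+$, which holds almost surely uniformly over $\{A'\in\mathcal A:A'\subseteq A\}$ for each $A\in\mathcal A$. $\int_Ag\,dB$ is the Wiener integral. Drifts are cancelled: $X$ is the set-indexed Lévy process $X_A=\sigma B_A+\int_A1\,dN$, and $Y_A=\sigma\int_Af\,dB+\int_Af\,dN$, if $\int_{|x|\le1}|x|\nu(dx)=\infty$; the same with $\widetilde N$ in place of $N$ if $\int_{|x|\le1}|x|\nu(dx)<\infty$. Thus $X$ has Lévy–Khintchine triplet $(b,\sigma^2,\nu)$ (truncation $\mathbf 1_{|x|\le1}$) with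 $b=0$, resp. $b=\int_{|x|\le1}x\,\nu(dx)$. $f$ is locally $X$-integrable: it is $\mathcal B$-measurable and for every $A\in\mathcal A$, $g=f\mathbf 1_A$ satisfies $(b+\int_{|x|>1}x\,\nu(dx))^2\|g\|_{L^1(m)}^2+(\sigma^2+\int x^2\nu(dx))\|g\|_{L^2(m)}^2<\infty$ (with $0\times\infty=0$). Hölder exponent: $\alpha_Y(A)=\sup\{\alpha\ge0:\limsup_{\rho\to0^+}\sup_{A'\in B_{\mathcal A}(A,\rho)}|Y_A-Y_{A'}|\rho^{-\alpha}<\infty\}$ (convention $\sup\varnothing=0$). Blumenthal–Getoor exponent: $\beta=\inf\{\delta>0:\int_{|x|\le1}|x|^\delta\nu(dx)<\infty\}\in[0,2]$. For $\alpha\ge0$, $\rho>0$: $L_{f,\alpha}(A)=\{s\in\mathcal T:|f(s)|>\mathfrak d(s,A)^\alpha\}$, $L_{f,\alpha}(A,\rho)=\mathcal V(A,\rho)\cap L_{f,\alpha}(A)$, $L^\complement_{f,\alpha}(A,\rho)=\mathcal V(A,\rho)\setminus L_{f,\alpha}(A)$, $$\overline R_f(A)=\Big\{(\alpha,q)\in\mathbb R_+^2:\liminf_{\rho\to0^+}\frac{m(L_{f,\alpha}(A,\rho))}{\rho^q}>0\Big\},$$ $$\underline R_f(A)=\Big\{(\alpha,q,q')\in\mathbb R_+^3:\limsup_{\rho\to0^+}\Big[\frac{m(L_{f,\alpha}(A,\rho))}{\rho^q}+\frac{m(L^\complement_{f,\alpha}(A,\rho))}{\rho^{q'}}\Big]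<\infty\Big\}.$$
   Formalization: The statement leaves 0/0 (q or q' equal to 0 with β = 0) undefined, and no single value makes both bounds true (e.g. for a zero pseudo-metric); it is read as 0 in the lower bound and as +∞ in the upper bound. *)

theory Defs
  imports "HOL-Probability.Probability"
begin

section \<open>Indexing collections\<close>

definition hull_in :: "'t set \<Rightarrow> 't set set \<Rightarrow> 't set \<Rightarrow> 't set" where
  "hull_in T \<D> A = \<Inter>{A' \<in> \<D> \<union> {T}. A \<subseteq> A'}"

text \<open>The set \<open>A(t)\<close> attached to a point \<open>t\<close> of \<open>T\<close>.\<close>

definition point_set :: "'t set \<Rightarrow> (nat \<Rightarrow> 't set set) \<Rightarrow> 't \<Rightarrow> 't set" where
  "point_set T An t = (\<Inter>n. \<Inter>{A \<in> An n \<union> {T}. t \<in> A})"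

text \<open>
  The approximating sequence \<open>An\<close> is part of the data. Intersections of empty subfamilies are
  not considered (\<open>T\<close> need not belong to \<open>\<A>\<close>), and the covering family in SHAPE is
  non-empty (otherwise the empty set would violate SHAPE).
\<close>

definition indexing_collection :: "'t set \<Rightarrow> 't set set \<Rightarrow> (nat \<Rightarrow> 't set set) \<Rightarrow> bool" where
  "indexing_collection T \<A> An \<longleftrightarrow>
     T \<noteq> {} \<and> \<A> \<subseteq> Pow T \<and>
     {} \<in> \<A> \<and>
     (\<forall>\<D>. \<D> \<subseteq> \<A> \<and> \<D> \<noteq> {} \<and> countable \<D> \<longrightarrow> \<Inter>\<D> \<in> \<A>) \<and>
     (\<forall>\<D>. \<D> \<subseteq> \<A> - {{}} \<and> \<D> \<noteq> {} \<and> countable \<D> \<longrightarrow> \<Inter>\<D> \<in> \<A> - {{}}) \<and>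
     incseq An \<and>
     (\<forall>n. finite (An n) \<and> An n \<subseteq> \<A> \<and> (\<forall>A\<in>An n. \<forall>A'\<in>An n. A \<inter> A' \<in> An n)) \<and>
     (\<forall>A\<in>\<A>. A = (\<Inter>n. hull_in T (An n) A)) \<and>
     (\<forall>A\<in>\<A>. \<forall>\<D>. finite \<D> \<and> \<D> \<noteq> {} \<and> \<D> \<subseteq> \<A> \<and> A \<subseteq> \<Union>\<D> \<longrightarrow> (\<exists>D\<in>\<D>. A \<subseteq> D)) \<and>
     bij_betw (point_set T An) T (\<A> - {{}}) \<and>
     (\<forall>n. {} \<in> An n \<and> \<Inter>(\<A> - {{}}) \<in> An n)"

definition increment_sets :: "'t set set \<Rightarrow> nat \<Rightarrow> 't set set" where
  "increment_sets \<A> k =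
     {A - (\<Union>i\<in>{1..k+1}. S i) | A S. A \<in> \<A> \<and> (\<forall>i\<in>{1..k+1}. S i \<in> \<A>)}"

definition left_nbhds :: "'t set set \<Rightarrow> 't set set" where
  "left_nbhds \<D> = {A - \<Union>{A' \<in> \<D>. A' \<subset> A} | A. A \<in> \<D>}"

text \<open>A vector of \<open>\<nat>\<^sup>p\<close> is a function on \<open>nat\<close> whose values below \<open>p\<close> are inspected.\<close>

definition finite_dimensional :: "'t set set \<Rightarrow> (nat \<Rightarrow> 't set set) \<Rightarrow> bool" where
  "finite_dimensional \<A> An \<longleftrightarrow>
     (\<exists>p\<ge>1.
        (\<forall>n. \<exists>\<phi> :: 't set \<Rightarrow> nat \<Rightarrow> nat.
            \<forall>A\<in>An n. \<forall>A'\<in>An n. A \<subseteq> A' \<longleftrightarrow> (\<forall>i<p. \<phi> A i \<le> \<phi> A' i)) \<and>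
        (\<Union>n. left_nbhds (An n)) \<subseteq> increment_sets \<A> (p - 1))"

section \<open>Compatible metrics, victiny and divergence\<close>

definition pseudo_metric_on :: "'a set \<Rightarrow> ('a \<Rightarrow> 'a \<Rightarrow> real) \<Rightarrow> bool" where
  "pseudo_metric_on S d \<longleftrightarrow>
     (\<forall>x\<in>S. d x x = 0) \<and>
     (\<forall>x\<in>S. \<forall>y\<in>S. 0 \<le> d x y \<and> d x y = d y x) \<and>
     (\<forall>x\<in>S. \<forall>y\<in>S. \<forall>z\<in>S. d x z \<le> d x y + d y z)"

definition point_diam ::
  "'t set \<Rightarrow> (nat \<Rightarrow> 't set set) \<Rightarrow> ('t set \<Rightarrow> 't set \<Rightarrow> real) \<Rightarrow> 't set \<Rightarrow> ennreal" where
  "point_diam T An d C =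
     (SUP (s, s')\<in>C \<times> C. ennreal (d (point_set T An s) (point_set T An s')))"

definition compatible_metric ::
  "'t set \<Rightarrow> 't set set \<Rightarrow> (nat \<Rightarrow> 't set set) \<Rightarrow> ('t set \<Rightarrow> 't set \<Rightarrow> real) \<Rightarrow> bool" where
  "compatible_metric T \<A> An d \<longleftrightarrow>
     pseudo_metric_on \<A> d \<and>
     (\<forall>A\<in>\<A>. \<forall>A'\<in>\<A>. \<forall>A''\<in>\<A>. d (A \<inter> A'') (A' \<inter> A'') \<le> d A A') \<and>
     (\<forall>S. decseq S \<and> range S \<subseteq> \<A> \<longrightarrow> (\<lambda>n. d (S n) (\<Inter>k. S k)) \<longlonglongrightarrow> 0) \<and>
     (\<lambda>n. Max (point_diam T An d ` left_nbhds (An n))) \<longlonglongrightarrow> 0 \<and>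
     (\<forall>A\<in>\<A>. \<forall>A'\<in>\<A>. A \<subseteq> A' \<longrightarrow>
        (\<exists>A''\<in>\<A>. A \<subseteq> A'' \<and> A'' \<subseteq> A' \<and> d A A'' = d A A' / 2 \<and> d A'' A' = d A A' / 2))"

definition measure_metric :: "'t measure \<Rightarrow> 't set \<Rightarrow> 't set \<Rightarrow> real" where
  "measure_metric m A A' = measure m (sym_diff A A')"

definition index_ball ::
  "'t set set \<Rightarrow> ('t set \<Rightarrow> 't set \<Rightarrow> real) \<Rightarrow> 't set \<Rightarrow> real \<Rightarrow> 't set set" where
  "index_ball \<A> d A \<rho> = {A' \<in> \<A>. d A A' < \<rho>}"

definition victiny ::
  "'t set set \<Rightarrow> ('t set \<Rightarrow> 't set \<Rightarrow> real) \<Rightarrow> 't set \<Rightarrow> real \<Rightarrow> 't set" where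
  "victiny \<A> d A \<rho> = (\<Union>A'\<in>index_ball \<A> d A \<rho>. sym_diff A A')"

text \<open>The divergence is infinite at points lying in no victiny of \<open>A\<close>.\<close>

definition divergence ::
  "'t set set \<Rightarrow> ('t set \<Rightarrow> 't set \<Rightarrow> real) \<Rightarrow> 't \<Rightarrow> 't set \<Rightarrow> ennreal" where
  "divergence \<A> d t A = Inf {ennreal \<rho> | \<rho>. \<rho> > 0 \<and> t \<in> victiny \<A> d A \<rho>}"

section \<open>The noises\<close>

definition point_count :: "('w \<Rightarrow> 'x set) \<Rightarrow> 'x set \<Rightarrow> 'w \<Rightarrow> ennreal" where
  "point_count \<Xi> E \<omega> = emeasure (count_space UNIV) (\<Xi> \<omega> \<inter> E)"

definition poisson_random_set :: "'w measure \<Rightarrow> 'x measure \<Rightarrow> ('w \<Rightarrow> 'x set) \<Rightarrow> bool" where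
  "poisson_random_set P \<mu> \<Xi> \<longleftrightarrow>
     (\<forall>\<omega>\<in>space P. countable (\<Xi> \<omega>) \<and> \<Xi> \<omega> \<subseteq> space \<mu>) \<and>
     (\<forall>E\<in>sets \<mu>. point_count \<Xi> E \<in> borel_measurable P) \<and>
     (\<forall>E\<in>sets \<mu>. emeasure \<mu> E < \<infinity> \<longrightarrow>
        (\<forall>k. measure P {\<omega> \<in> space P. point_count \<Xi> E \<omega> = of_nat k} =
             exp (- measure \<mu> E) * measure \<mu> E ^ k / fact k)) \<and>
     (\<forall>E\<in>sets \<mu>. emeasure \<mu> E = \<infinity> \<longrightarrow> (AE \<omega> in P. point_count \<Xi> E \<omega> = \<infinity>)) \<and>
     (\<forall>(n::nat) E. (\<forall>i<n. E i \<in> sets \<mu>) \<and> disjoint_family_on E {..<n} \<longrightarrow>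
        prob_space.indep_vars P (\<lambda>_. borel) (\<lambda>i. point_count \<Xi> (E i)) {..<n})"

text \<open>Constants count as Gaussian, so the variance may vanish.\<close>

definition centered_normal :: "'w measure \<Rightarrow> ('w \<Rightarrow> real) \<Rightarrow> bool" where
  "centered_normal P Z \<longleftrightarrow> Z \<in> borel_measurable P \<and>
     ((AE \<omega> in P. Z \<omega> = 0) \<or> (\<exists>s>0. distributed P lborel Z (\<lambda>x. ennreal (normal_density 0 s x))))"

definition set_indexed_brownian ::
  "'w measure \<Rightarrow> 't set set \<Rightarrow> 't measure \<Rightarrow> ('t set \<Rightarrow> 'w \<Rightarrow> real) \<Rightarrow> bool" where
  "set_indexed_brownian P \<A> m B \<longleftrightarrow>
     (\<forall>F c. finite F \<and> F \<subseteq> \<A> \<longrightarrow> centered_normal P (\<lambda>\<omega>. \<Sum>A\<in>F. c A * B A \<omega>)) \<and>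
     (\<forall>A1\<in>\<A>. \<forall>A2\<in>\<A>. (\<integral>\<omega>. B A1 \<omega> * B A2 \<omega> \<partial>P) = measure m (A1 \<inter> A2))"

definition indep_noises ::
  "'w measure \<Rightarrow> 't set set \<Rightarrow> 'x measure \<Rightarrow> ('t set \<Rightarrow> 'w \<Rightarrow> real) \<Rightarrow> ('w \<Rightarrow> 'x set) \<Rightarrow> bool" where
  "indep_noises P \<A> \<mu> B \<Xi> \<longleftrightarrow>
     prob_space.indep_set P
       (sigma_sets (space P) {B A -` U \<inter> space P | A U. A \<in> \<A> \<and> U \<in> sets borel})
       (sigma_sets (space P) {point_count \<Xi> E -` U \<inter> space P | E U. E \<in> sets \<mu> \<and> U \<in> sets borel})"

section \<open>Integrals with respect to the Levy process\<close>

text \<open>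
  The Wiener integral of \<open>g\<close>, as the \<open>L\<^sup>2\<close> limit of integrals of linear combinations of
  indicators of sets of \<open>\<A>\<close>; it is determined up to a null set, and a version is chosen.
\<close>

definition is_wiener_integral ::
  "'w measure \<Rightarrow> 't set set \<Rightarrow> 't measure \<Rightarrow> ('t set \<Rightarrow> 'w \<Rightarrow> real) \<Rightarrow> ('t \<Rightarrow> real) \<Rightarrow> ('w \<Rightarrow> real) \<Rightarrow> bool"
where
  "is_wiener_integral P \<A> m B g W \<longleftrightarrow> W \<in> borel_measurable P \<and>
     (\<exists>(F :: nat \<Rightarrow> 't set set) (c :: nat \<Rightarrow> 't set \<Rightarrow> real).
        (\<forall>n. finite (F n) \<and> F n \<subseteq> \<A>) \<and>
        (\<lambda>n. \<integral>\<^sup>+s. ennreal ((g s - (\<Sum>A\<in>F n. c n A * indicator A s))\<^sup>2) \<partial>m) \<longlonglongrightarrow> 0 \<and>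
        (\<lambda>n. \<integral>\<^sup>+\<omega>. ennreal ((W \<omega> - (\<Sum>A\<in>F n. c n A * B A \<omega>))\<^sup>2) \<partial>P) \<longlonglongrightarrow> 0)"

definition wiener_integral ::
  "'w measure \<Rightarrow> 't set set \<Rightarrow> 't measure \<Rightarrow> ('t set \<Rightarrow> 'w \<Rightarrow> real) \<Rightarrow> ('t \<Rightarrow> real) \<Rightarrow> 'w \<Rightarrow> real"
where
  "wiener_integral P \<A> m B g = (SOME W. is_wiener_integral P \<A> m B g W)"

definition jump_sum ::
  "('w \<Rightarrow> ('t \<times> real) set) \<Rightarrow> ('t \<Rightarrow> real) \<Rightarrow> real \<Rightarrow> 't set \<Rightarrow> 'w \<Rightarrow> real" where
  "jump_sum \<Xi> g \<epsilon> A \<omega> = (\<Sum>(t, J)\<in>{(t, J) \<in> \<Xi> \<omega>. t \<in> A \<and> \<epsilon> \<le> \<bar>J\<bar>}. g t * J)"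

definition compensated_jump_sum ::
  "'t measure \<Rightarrow> real measure \<Rightarrow> ('w \<Rightarrow> ('t \<times> real) set) \<Rightarrow> ('t \<Rightarrow> real) \<Rightarrow> real \<Rightarrow> 't set \<Rightarrow> 'w \<Rightarrow> real"
where
  "compensated_jump_sum m \<nu> \<Xi> g \<epsilon> A \<omega> =
     jump_sum \<Xi> g \<epsilon> A \<omega> - (LINT s:A|m. g s) * (LINT x:{x. \<epsilon> \<le> \<bar>x\<bar> \<and> \<bar>x\<bar> \<le> 1}|\<nu>. x)"

definition small_jumps_summable :: "real measure \<Rightarrow> bool" where
  "small_jumps_summable \<nu> \<longleftrightarrow> (\<integral>\<^sup>+x\<in>{x. \<bar>x\<bar> \<le> 1}. ennreal \<bar>x\<bar> \<partial>\<nu>) < \<infinity>"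

text \<open>
  The limit exists almost surely, simultaneously for all \<open>A\<close> of the indexing collection;
  \<open>Lim\<close> is unspecified on the exceptional null set.
\<close>

definition jump_integral ::
  "'t measure \<Rightarrow> real measure \<Rightarrow> ('w \<Rightarrow> ('t \<times> real) set) \<Rightarrow> ('t \<Rightarrow> real) \<Rightarrow> 't set \<Rightarrow> 'w \<Rightarrow> real"
where
  "jump_integral m \<nu> \<Xi> g A \<omega> =
     (if small_jumps_summable \<nu>
      then Lim (at_right 0) (\<lambda>\<epsilon>. jump_sum \<Xi> g \<epsilon> A \<omega>)
      else Lim (at_right 0) (\<lambda>\<epsilon>. compensated_jump_sum m \<nu> \<Xi> g \<epsilon> A \<omega>))"

text \<open>
  The process \<open>Y\<^sub>A = \<integral>\<^sub>A f dX\<close>, where \<open>X\<close> is the Levy process with cancelled drift built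
  from \<open>B\<close> and \<open>\<Xi>\<close>; the process \<open>X\<close> itself is the case \<open>f = 1\<close>.
\<close>

definition levy_integral ::
  "'w measure \<Rightarrow> 't set set \<Rightarrow> 't measure \<Rightarrow> ('t set \<Rightarrow> 'w \<Rightarrow> real) \<Rightarrow> ('w \<Rightarrow> ('t \<times> real) set) \<Rightarrow>
   real \<Rightarrow> real measure \<Rightarrow> ('t \<Rightarrow> real) \<Rightarrow> 't set \<Rightarrow> 'w \<Rightarrow> real" where
  "levy_integral P \<A> m B \<Xi> \<sigma> \<nu> f A \<omega> =
     \<sigma> * wiener_integral P \<A> m B (\<lambda>s. f s * indicator A s) \<omega> + jump_integral m \<nu> \<Xi> f A \<omega>"

text \<open>The drift in the Levy-Khintchine triplet of \<open>X\<close>, for the truncation at \<open>1\<close>.\<close>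

definition levy_drift :: "real measure \<Rightarrow> real" where
  "levy_drift \<nu> = (if small_jumps_summable \<nu> then (LINT x:{x. \<bar>x\<bar> \<le> 1}|\<nu>. x) else 0)"

definition locally_levy_integrable ::
  "'t set set \<Rightarrow> 't measure \<Rightarrow> real \<Rightarrow> real measure \<Rightarrow> ('t \<Rightarrow> real) \<Rightarrow> bool" where
  "locally_levy_integrable \<A> m \<sigma> \<nu> f \<longleftrightarrow> f \<in> borel_measurable m \<and>
     (\<forall>A\<in>\<A>.
        ennreal ((levy_drift \<nu> + (LINT x:{x. \<bar>x\<bar> > 1}|\<nu>. x))\<^sup>2) * (\<integral>\<^sup>+s\<in>A. ennreal \<bar>f s\<bar> \<partial>m)\<^sup>2
        + (ennreal (\<sigma>\<^sup>2) + (\<integral>\<^sup>+x. ennreal (x\<^sup>2) \<partial>\<nu>)) * (\<integral>\<^sup>+s\<in>A. ennreal ((f s)\<^sup>2) \<partial>m) < \<infinity>)"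

section \<open>Exponents\<close>

definition holder_exponent ::
  "'t set set \<Rightarrow> ('t set \<Rightarrow> 't set \<Rightarrow> real) \<Rightarrow> ('t set \<Rightarrow> real) \<Rightarrow> 't set \<Rightarrow> ennreal" where
  "holder_exponent \<A> d y A =
     Sup {ennreal \<alpha> | \<alpha>. \<alpha> \<ge> 0 \<and>
       Limsup (at_right 0)
         (\<lambda>\<rho>. SUP A'\<in>index_ball \<A> d A \<rho>. ennreal (\<bar>y A - y A'\<bar> * \<rho> powr (- \<alpha>))) < \<infinity>}"

definition blumenthal_getoor :: "real measure \<Rightarrow> real" where
  "blumenthal_getoor \<nu> =
     Inf {\<delta>. \<delta> > 0 \<and> (\<integral>\<^sup>+x\<in>{x. \<bar>x\<bar> \<le> 1}. ennreal (\<bar>x\<bar> powr \<delta>) \<partial>\<nu>) < \<infinity>}"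

text \<open>Here \<open>x\<^sup>0 = 1\<close> also for \<open>x = 0\<close>, unlike for \<open>powr\<close>.\<close>

definition ennpow :: "ennreal \<Rightarrow> real \<Rightarrow> ennreal" where
  "ennpow x \<alpha> = (if \<alpha> = 0 then 1 else if x = \<infinity> then \<infinity> else ennreal (enn2real x powr \<alpha>))"

definition large_set ::
  "'t set \<Rightarrow> 't set set \<Rightarrow> ('t set \<Rightarrow> 't set \<Rightarrow> real) \<Rightarrow> ('t \<Rightarrow> real) \<Rightarrow> real \<Rightarrow> 't set \<Rightarrow> 't set" where
  "large_set T \<A> d f \<alpha> A = {s \<in> T. ennreal \<bar>f s\<bar> > ennpow (divergence \<A> d s A) \<alpha>}"

definition upper_region ::
  "'t set \<Rightarrow> 't set set \<Rightarrow> ('t set \<Rightarrow> 't set \<Rightarrow> real) \<Rightarrow> 't measure \<Rightarrow> ('t \<Rightarrow> real) \<Rightarrow> 't set \<Rightarrow>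
   (real \<times> real) set" where
  "upper_region T \<A> d m f A = {(\<alpha>, q). \<alpha> \<ge> 0 \<and> q \<ge> 0 \<and>
     Liminf (at_right 0) (\<lambda>\<rho>.
       emeasure m (victiny \<A> d A \<rho> \<inter> large_set T \<A> d f \<alpha> A) / ennreal (\<rho> powr q)) > 0}"

definition lower_region ::
  "'t set \<Rightarrow> 't set set \<Rightarrow> ('t set \<Rightarrow> 't set \<Rightarrow> real) \<Rightarrow> 't measure \<Rightarrow> ('t \<Rightarrow> real) \<Rightarrow> 't set \<Rightarrow>
   (real \<times> real \<times> real) set" where
  "lower_region T \<A> d m f A = {(\<alpha>, q, q'). \<alpha> \<ge> 0 \<and> q \<ge> 0 \<and> q' \<ge> 0 \<and>
     Limsup (at_right 0) (\<lambda>\<rho>.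
       emeasure m (victiny \<A> d A \<rho> \<inter> large_set T \<A> d f \<alpha> A) / ennreal (\<rho> powr q) +
       emeasure m (victiny \<A> d A \<rho> - large_set T \<A> d f \<alpha> A) / ennreal (\<rho> powr q')) < \<infinity>}"

text \<open>
  Both quotients satisfy \<open>q/0 = \<infinity>\<close> for \<open>q > 0\<close> and differ only in the indeterminate case
  \<open>0/0\<close>, where each bound is read so that the term gives no information: \<open>0/0 = 0\<close> in the
  lower bound (as for \<open>ennreal\<close>) and \<open>0/0 = \<infinity>\<close> in the upper bound. For \<open>\<beta> = 0\<close> no
  common value works: a compatible pseudo-metric may vanish identically, and then, for
  \<open>T = [0,1]\<close> with the intervals \<open>[0,t]\<close>, Lebesgue measure, \<open>\<nu>\<close> the Dirac mass at \<open>1\<close>,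
  \<open>f = 2\<close> and \<open>A = T\<close>, the point \<open>(0,0)\<close>, resp. \<open>(0,0,0)\<close>, lies in the upper, resp.
  lower, region, whereas the exponent is \<open>0\<close> or \<open>\<infinity>\<close>, each with positive probability.
\<close>

definition quot_lower :: "real \<Rightarrow> real \<Rightarrow> ennreal" where
  "quot_lower q \<beta> = ennreal q / ennreal \<beta>"

definition quot_upper :: "real \<Rightarrow> real \<Rightarrow> ennreal" where
  "quot_upper q \<beta> = (if \<beta> = 0 then \<infinity> else ennreal q / ennreal \<beta>)"

end

theory Submission
  imports Defs
begin

text \<open>
  Since \<open>\<sigma> = 0\<close>, \<open>Y\<close> is a sum of jumps, compensated when the small jumps are not summable.

  Lower bound. The victiny of radius \<open>\<rho>\<close> splits into the part where \<open>f\<close> is only bounded and the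
  part where \<open>\<bar>f\<bar> \<le> \<rho>\<^sup>\<alpha>\<close>. On each part the oscillation of \<open>Y\<close> is controlled by moments of order
  \<open>b\<close> slightly above \<open>\<beta>\<close>: if the small jumps are summable, through
  \<open>(\<Sum>\<bar>f J\<bar>)\<^sup>b \<le> \<Sum>\<bar>f J\<bar>\<^sup>b\<close>; otherwise through first moments of the large jumps and a maximal
  inequality for the compensated small ones. The order embedding into \<open>\<nat>\<^sup>p\<close> turns suprema over
  \<open>\<A>\<close> into suprema of orthant sums of independent variables, to which Ottaviani's
  inequality applies once per coordinate. Borel-Cantelli along \<open>\<rho> = s 2\<^sup>-\<^sup>n\<close> concludes.

  Upper bound. Along suitable \<open>\<rho>\<close> there almost surely is a jump of size at least
  \<open>\<rho>\<^bsup>q/\<delta>\<^esup>\<close>, \<open>\<delta> < \<beta>\<close>, at a point of the victiny where \<open>f\<close> is large. A jump in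
  \<open>A \<triangle> D\<close> is seen by sets close to \<open>A\<close>: midpoints for \<open>d\<^sub>m\<close> give chains from \<open>A \<inter> D\<close> to \<open>A\<close>
  and to \<open>D\<close> with increments of equal small measure, and some increment contains
  that jump and no other large one.
\<close>

section \<open>A maximal inequality for orthant sums of independent variables\<close>

text \<open>Two obstacles shape the proof. \<open>\<A>\<close> is uncountable and only partially
  ordered, so no martingale inequality along a line bounds a supremum over it. Finite subfamilies
  carry coordinates, however: a point is replaced by its hull, and membership in a set becomes a
  finite list of upper bounds. The constants depend only on the number of coordinates and thus
  survive the limit over the subfamilies. The other obstacle is that the compensator need not stay
  bounded as the truncation level tends to \<open>0\<close>. In the lower bound the threshold
  between large and small jumps is capped at the compensation level \<open>1\<close>, and a
  compensator that is too large makes the claimed probability bound trivial. In the upper bound the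
  truncation is fixed before the chain is refined: equal measures of the increments shrink both the
  compensator of one increment and the probability of two jumps in it. Two metrics are in play.
  Balls and victinies refer to \<open>d\<close>, chains to \<open>measure_metric m\<close>; only the
  contraction of \<open>d\<close> under intersections places the members of the chains near
  \<open>A\<close>.\<close>

definition orthants :: "('i \<Rightarrow> nat \<Rightarrow> nat) \<Rightarrow> nat \<Rightarrow> 'i set \<Rightarrow> 'i set set" where
  "orthants \<psi> p I = range (\<lambda>k. {i\<in>I. \<forall>j<p. \<psi> i j \<le> k j})"

lemma orthants_subset: "Q \<in> orthants \<psi> p I \<Longrightarrow> Q \<subseteq> I"
  by (auto simp: orthants_def)

lemma finite_orthants: "finite I \<Longrightarrow> finite (orthants \<psi> p I)"
  by (rule finite_subset[of _ "Pow I"]) (auto simp: orthants_def)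

lemma orthants_0: "orthants \<psi> 0 I = {I}"
  by (auto simp: orthants_def)

text \<open>Fixing the bound \<open>y\<close> on the last coordinate leaves orthants in
  \<open>p\<close> coordinates over a smaller index set. This is the recursion behind the maximal
  inequality.\<close>

lemma orthants_Suc: "orthants \<psi> (Suc p) I = (\<Union>y. orthants \<psi> p {i\<in>I. \<psi> i p \<le> y})"
proof -
  have 1: "{i\<in>I. \<forall>j<Suc p. \<psi> i j \<le> k j} = {i\<in>{i\<in>I. \<psi> i p \<le> k p}. \<forall>j<p. \<psi> i j \<le> k j}" for k
    by (auto simp: less_Suc_eq)
  have 2: "{i\<in>{i\<in>I. \<psi> i p \<le> y}. \<forall>j<p. \<psi> i j \<le> k j} = {i\<in>I. \<forall>j<Suc p. \<psi> i j \<le> (k(p:=y)) j}" for k y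
    by (auto simp: less_Suc_eq)
  show ?thesis
  proof
    show "orthants \<psi> (Suc p) I \<subseteq> (\<Union>y. orthants \<psi> p {i\<in>I. \<psi> i p \<le> y})"
      unfolding orthants_def image_subset_iff 1 by blast
    show "(\<Union>y. orthants \<psi> p {i\<in>I. \<psi> i p \<le> y}) \<subseteq> orthants \<psi> (Suc p) I"
      unfolding orthants_def UN_subset_iff image_subset_iff 2 by blast
  qed
qed

text \<open>\<open>D\<close> is the lim inf of the \<open>B n\<close>, an increasing union of
  intersections each contained in a single \<open>B m\<close>; its probability stays below
  \<open>b\<close> although nothing is summed. Outside it good indices recur for ever, which is
  enough to pass a closed inequality to a limit.\<close>

lemma (in prob_space) liminf_bound:
  assumes "\<And>n::nat. B n \<in> sets M" "\<And>n. prob (B n) \<le> b"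
  obtains D where "D \<in> sets M" "prob D \<le> b" "\<And>\<omega> m. \<omega> \<in> space M - D \<Longrightarrow> \<exists>n\<ge>m. \<omega> \<notin> B n"
proof -
  define D where "D m = (\<Inter>i\<in>{m..}. B i)" for m
  have D: "D m \<in> sets M" for m unfolding D_def using assms(1) by (intro sets.countable_INT') auto
  have "incseq D" by (auto simp: incseq_def D_def)
  then have "(\<lambda>m. prob (D m)) \<longlonglongrightarrow> prob (\<Union>m. D m)"
    using D by (intro finite_Lim_measure_incseq) auto
  moreover have "prob (D m) \<le> b" for m
  proof -
    have "D m \<subseteq> B m" by (auto simp: D_def)
    from finite_measure_mono[OF this assms(1)] assms(2)[of m] show ?thesis by linarith
  qed
  ultimately have "prob (\<Union>m. D m) \<le> b" by (auto intro: LIMSEQ_le_const2)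
  moreover have "\<exists>n\<ge>m. \<omega> \<notin> B n" if "\<omega> \<in> space M - (\<Union>m. D m)" for \<omega> m
    using that by (auto simp: D_def)
  ultimately show ?thesis using that[of "\<Union>m. D m"] D by blast
qed

context prob_space
begin

text \<open>Independence and centring kill the cross terms. Integrability is carried through the
  same induction because the product rule for expectations asks for it.\<close>

lemma indep_sum_second_moment:
  fixes X :: "'i \<Rightarrow> 'a \<Rightarrow> real"
  assumes "finite I" "indep_vars (\<lambda>_. borel) X I"
    and "\<And>i. i \<in> I \<Longrightarrow> integrable M (\<lambda>\<omega>. (X i \<omega>)\<^sup>2)"
    and "\<And>i. i \<in> I \<Longrightarrow> expectation (X i) = 0"
  shows "integrable M (\<lambda>\<omega>. (\<Sum>i\<in>I. X i \<omega>)\<^sup>2) \<and> integrable M (\<lambda>\<omega>. \<Sum>i\<in>I. X i \<omega>)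
    \<and> expectation (\<lambda>\<omega>. (\<Sum>i\<in>I. X i \<omega>)\<^sup>2) = (\<Sum>i\<in>I. expectation (\<lambda>\<omega>. (X i \<omega>)\<^sup>2))"
  using assms
proof (induction I rule: finite_induct)
  case (insert i I)
  have rv: "\<And>j. j \<in> insert i I \<Longrightarrow> X j \<in> borel_measurable M"
    using insert.prems(1) unfolding indep_vars_def by auto
  have IH: "integrable M (\<lambda>\<omega>. (\<Sum>i\<in>I. X i \<omega>)\<^sup>2)" "integrable M (\<lambda>\<omega>. \<Sum>i\<in>I. X i \<omega>)"
    "expectation (\<lambda>\<omega>. (\<Sum>i\<in>I. X i \<omega>)\<^sup>2) = (\<Sum>i\<in>I. expectation (\<lambda>\<omega>. (X i \<omega>)\<^sup>2))"
    using insert.IH[OF indep_vars_subset[OF insert.prems(1)]] insert.prems by auto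
  have Xi: "integrable M (X i)"
    by (rule square_integrable_imp_integrable) (use rv insert.prems(2) in auto)
  have ind: "indep_var borel (X i) borel (\<lambda>\<omega>. \<Sum>i\<in>I. X i \<omega>)"
    by (rule indep_vars_sum) (use insert in auto)
  have prod: "expectation (\<lambda>\<omega>. X i \<omega> * (\<Sum>i\<in>I. X i \<omega>)) = expectation (X i) * expectation (\<lambda>\<omega>. \<Sum>i\<in>I. X i \<omega>)"
    by (rule indep_var_lebesgue_integral[OF ind Xi IH(2)])
  have pint: "integrable M (\<lambda>\<omega>. X i \<omega> * (\<Sum>i\<in>I. X i \<omega>))"
    by (rule indep_var_integrable[OF ind Xi IH(2)])
  have eq: "(\<Sum>j\<in>insert i I. X j \<omega>)\<^sup>2 = (X i \<omega>)\<^sup>2 + (\<Sum>i\<in>I. X i \<omega>)\<^sup>2 + 2 * (X i \<omega> * (\<Sum>i\<in>I. X i \<omega>))" for \<omega>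
    using insert by (simp add: power2_sum)
  show ?case
    unfolding eq using IH Xi pint prod insert by (simp add: insert.hyps)
qed simp

lemma indep_sum_Chebyshev:
  fixes X :: "'i \<Rightarrow> 'a \<Rightarrow> real"
  assumes "finite I" "indep_vars (\<lambda>_. borel) X I"
    and "\<And>i. i \<in> I \<Longrightarrow> integrable M (\<lambda>\<omega>. (X i \<omega>)\<^sup>2)"
    and "\<And>i. i \<in> I \<Longrightarrow> expectation (X i) = 0" and "l > 0"
  shows "prob {\<omega>\<in>space M. l < \<bar>\<Sum>i\<in>I. X i \<omega>\<bar>} \<le> (\<Sum>i\<in>I. expectation (\<lambda>\<omega>. (X i \<omega>)\<^sup>2)) / l\<^sup>2"
proof -
  note S = indep_sum_second_moment[OF assms(1-4)]
  have [measurable]: "(\<lambda>\<omega>. \<Sum>i\<in>I. X i \<omega>) \<in> borel_measurable M"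
    using S by auto
  have "prob {\<omega>\<in>space M. l < \<bar>\<Sum>i\<in>I. X i \<omega>\<bar>} \<le> prob {\<omega>\<in>space M. l\<^sup>2 \<le> (\<Sum>i\<in>I. X i \<omega>)\<^sup>2}"
  proof (rule finite_measure_mono)
    have "l\<^sup>2 \<le> x\<^sup>2" if "l < \<bar>x\<bar>" for x
      using that assms(5) by (metis abs_le_square_iff abs_of_pos less_eq_real_def)
    then show "{\<omega>\<in>space M. l < \<bar>\<Sum>i\<in>I. X i \<omega>\<bar>} \<subseteq> {\<omega>\<in>space M. l\<^sup>2 \<le> (\<Sum>i\<in>I. X i \<omega>)\<^sup>2}" by auto
  qed simp
  also have "\<dots> \<le> expectation (\<lambda>\<omega>. (\<Sum>i\<in>I. X i \<omega>)\<^sup>2) / l\<^sup>2"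
    using S assms(5) by (intro integral_Markov_inequality_measure[where A="{}"]) auto
  finally show ?thesis using S by simp
qed

text \<open>
  Stop at the first value of the last coordinate at which the maximum over the others exceeds
  the level (Ottaviani): the later increments are independent of this event and, by induction,
  small with probability at least \<open>1/2\<close>.
\<close>

lemma indep_orthant_maximal:
  fixes X :: "'i \<Rightarrow> 'a \<Rightarrow> real"
  assumes "finite I" "indep_vars (\<lambda>_. borel) X I"
    and "\<And>i. i \<in> I \<Longrightarrow> integrable M (\<lambda>\<omega>. (X i \<omega>)\<^sup>2)"
    and "\<And>i. i \<in> I \<Longrightarrow> expectation (X i) = 0" and "l > 0"
  shows "prob {\<omega>\<in>space M. \<exists>Q\<in>orthants \<psi> p I. 2^p * l < \<bar>\<Sum>i\<in>Q. X i \<omega>\<bar>}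
    \<le> 2^p * (\<Sum>i\<in>I. expectation (\<lambda>\<omega>. (X i \<omega>)\<^sup>2)) / l\<^sup>2"
  using assms
proof (induction p arbitrary: I)
  case 0
  show ?case using indep_sum_Chebyshev[OF 0] by (simp add: orthants_0)
next
  case (Suc p I)
  note I = Suc.prems(1) and ind = Suc.prems(2)
  have rv[measurable]: "\<And>j. j \<in> I \<Longrightarrow> X j \<in> borel_measurable M"
    using ind unfolding indep_vars_def by auto
  define V where "V = (\<Sum>i\<in>I. expectation (\<lambda>\<omega>. (X i \<omega>)\<^sup>2)) / l\<^sup>2"
  define a :: real where "a = 2^p"
  have a: "a > 0" by (simp add: a_def)
  define ev where "ev J c = {\<omega>\<in>space M. \<exists>Q\<in>orthants \<psi> p J. c < \<bar>\<Sum>i\<in>Q. X i \<omega>\<bar>}" for J c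
  \<comment> \<open>Each event is rewritten as the preimage of a set in a product space under the
    restriction to an index block \<open>K\<close>: independence of blocks is available in that
    form.\<close>
  have ev_pre: "ev J c = (\<lambda>\<omega>. restrict (\<lambda>i. X i \<omega>) K) -`
      {x\<in>space (Pi\<^sub>M K (\<lambda>_. borel)). \<exists>Q\<in>orthants \<psi> p J. c < \<bar>\<Sum>i\<in>Q. x i\<bar>} \<inter> space M"
    if "J \<subseteq> K" for J K c
  proof -
    have "(\<Sum>i\<in>Q. X i \<omega>) = (\<Sum>i\<in>Q. restrict (\<lambda>i. X i \<omega>) K i)" if "Q \<in> orthants \<psi> p J" for Q \<omega>
      using orthants_subset[OF that] \<open>J \<subseteq> K\<close> by (intro sum.cong) auto
    then show ?thesis unfolding ev_def by (auto simp: space_PiM)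
  qed
  have evK: "{x\<in>space (Pi\<^sub>M K (\<lambda>_. borel)). \<exists>Q\<in>orthants \<psi> p J. c < \<bar>\<Sum>i\<in>Q. x i\<bar>} \<in> sets (Pi\<^sub>M K (\<lambda>_. borel :: real measure))"
    if "J \<subseteq> K" "K \<subseteq> I" for J K c
  proof -
    have fin: "finite J" using that I by (meson finite_subset)
    have [measurable]: "(\<lambda>x. \<Sum>i\<in>Q. x i) \<in> borel_measurable (Pi\<^sub>M K (\<lambda>_. borel :: real measure))"
      if "Q \<in> orthants \<psi> p J" for Q
      using orthants_subset[OF that] \<open>J \<subseteq> K\<close> by (intro borel_measurable_sum) auto
    have "{x\<in>space (Pi\<^sub>M K (\<lambda>_. borel)). \<exists>Q\<in>orthants \<psi> p J. c < \<bar>\<Sum>i\<in>Q. x i\<bar>}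
      = (\<Union>Q\<in>orthants \<psi> p J. {x\<in>space (Pi\<^sub>M K (\<lambda>_. borel)). c < \<bar>\<Sum>i\<in>Q. x i\<bar>})" by auto
    also have "\<dots> \<in> sets (Pi\<^sub>M K (\<lambda>_. borel :: real measure))"
      using fin by (intro sets.finite_UN finite_orthants) measurable
    finally show ?thesis .
  qed
  have rvK: "(\<lambda>\<omega>. restrict (\<lambda>i. X i \<omega>) K) \<in> measurable M (Pi\<^sub>M K (\<lambda>_. borel))" if "K \<subseteq> I" for K
    using that by (intro measurable_restrict) auto
  have ev_sets[measurable]: "ev J c \<in> sets M" if "J \<subseteq> I" for J c
    unfolding ev_pre[OF that] by (rule measurable_sets[OF rvK evK]) (use that in auto)
  have IH: "prob (ev J (a * l)) \<le> a * V" if "J \<subseteq> I" for J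
  proof -
    have "prob (ev J (a * l)) \<le> a * (\<Sum>i\<in>J. expectation (\<lambda>\<omega>. (X i \<omega>)\<^sup>2)) / l\<^sup>2"
      unfolding ev_def a_def
      by (rule Suc.IH) (use that I ind Suc.prems indep_vars_subset finite_subset in auto)
    also have "\<dots> \<le> a * V"
      unfolding V_def using a that I
      by (auto intro!: mult_left_mono divide_right_mono sum_mono2)
    finally show ?thesis .
  qed
  define lo where "lo y = {i\<in>I. \<psi> i p \<le> y}" for y
  define hi where "hi y = {i\<in>I. y < \<psi> i p}" for y
  have sub: "lo y \<subseteq> I" "hi y \<subseteq> I" "lo y \<inter> hi y = {}" for y by (auto simp: lo_def hi_def)
  have lo_mono: "y \<le> z \<Longrightarrow> lo y \<subseteq> lo z" for y z by (auto simp: lo_def)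
  \<comment> \<open>Level \<open>2 * a * l\<close> for the past against \<open>a * l\<close> for the
    future: outside \<open>G y\<close> the difference still exceeds \<open>a * l\<close>, so each
    coordinate doubles the level.\<close>
  define F where "F y = ev (lo y) (2 * a * l)" for y
  define G where "G y = ev (hi y) (a * l)" for y
  define \<tau> where "\<tau> y = F y - (\<Union>z<y. F z)" for y
  have [measurable]: "F y \<in> sets M" "G y \<in> sets M" "\<tau> y \<in> sets M" for y
    using sub unfolding F_def G_def \<tau>_def by auto
  have goal_eq: "{\<omega>\<in>space M. \<exists>Q\<in>orthants \<psi> (Suc p) I. 2^(Suc p) * l < \<bar>\<Sum>i\<in>Q. X i \<omega>\<bar>} = (\<Union>y. F y)"
    unfolding F_def ev_def orthants_Suc lo_def a_def by auto
  \<comment> \<open>From \<open>Y0\<close> on nothing is cut off, so the union over all bounds is a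
    finite one.\<close>
  define Y0 where "Y0 = Max (insert 0 ((\<lambda>i. \<psi> i p) ` I))"
  have Y0: "lo y = I" if "y \<ge> Y0" for y
    using that I unfolding lo_def Y0_def by auto
  have UF: "(\<Union>y. F y) = (\<Union>y\<le>Y0. F y)"
  proof -
    have "F y \<subseteq> (\<Union>y\<le>Y0. F y)" for y
      by (cases "y \<le> Y0") (auto simp: F_def Y0)
    then show ?thesis by auto
  qed
  have Ft: "(\<Union>y\<le>Y0. F y) = (\<Union>y\<le>Y0. \<tau> y)"
  proof -
    have "\<omega> \<in> (\<Union>y\<le>Y0. \<tau> y)" if "\<omega> \<in> F y" "y \<le> Y0" for \<omega> y
    proof -
      define z where "z = (LEAST z. \<omega> \<in> F z)"
      have "\<omega> \<in> F z" "z \<le> y" "\<And>x. x < z \<Longrightarrow> \<omega> \<notin> F x"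
        unfolding z_def using that by (auto intro: LeastI Least_le dest: not_less_Least)
      then show ?thesis using that unfolding \<tau>_def by auto
    qed
    then show ?thesis unfolding \<tau>_def by auto
  qed
  have disj: "disjoint_family \<tau>"
  proof -
    have "\<tau> m \<inter> \<tau> n = {}" if "m < n" for m n
      using that by (auto simp: \<tau>_def)
    then show ?thesis unfolding disjoint_family_on_def by (metis Int_commute nat_neq_iff)
  qed
  show ?case
  \<comment> \<open>If \<open>a * V\<close> exceeds \<open>1/2\<close>, the asserted bound is
    already at least \<open>1\<close>. Otherwise the later increments stay below
    \<open>a * l\<close> with probability at least \<open>1/2\<close>.\<close>
  proof (cases "a * V \<le> 1/2")
    case False
    have "1 \<le> 2 * (a * V)" using False by simp
    also have "\<dots> = 2^(Suc p) * (\<Sum>i\<in>I. expectation (\<lambda>\<omega>. (X i \<omega>)\<^sup>2)) / l\<^sup>2"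
      unfolding V_def a_def by simp
    finally show ?thesis
      by (rule order_trans[OF prob_le_1])
  next
    case True
    \<comment> \<open>\<open>\<tau> y\<close> involves only variables with index in
      \<open>lo y\<close>, since the earlier events \<open>F z\<close> do so too, and
      \<open>G y\<close> only those with index in \<open>hi y\<close>.\<close>
    have indep: "prob (\<tau> y - G y) = prob (\<tau> y) * prob (space M - G y)" for y
    proof -
      let ?A = "\<lambda>\<omega>. restrict (\<lambda>i. X i \<omega>) (lo y)" and ?B = "\<lambda>\<omega>. restrict (\<lambda>i. X i \<omega>) (hi y)"
      let ?E = "\<lambda>J K c. {x\<in>space (Pi\<^sub>M K (\<lambda>_. borel :: real measure)). \<exists>Q\<in>orthants \<psi> p J. c < \<bar>\<Sum>i\<in>Q. x i\<bar>}"
      define Sa where "Sa = ?E (lo y) (lo y) (2*a*l) - (\<Union>z<y. ?E (lo z) (lo y) (2*a*l))"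
      define Sb where "Sb = space (Pi\<^sub>M (hi y) (\<lambda>_. borel :: real measure)) - ?E (hi y) (hi y) (a*l)"
      have Sa: "Sa \<in> sets (Pi\<^sub>M (lo y) (\<lambda>_. borel))"
        unfolding Sa_def using sub lo_mono
        by (intro sets.Diff evK sets.finite_UN) auto
      have Sb: "Sb \<in> sets (Pi\<^sub>M (hi y) (\<lambda>_. borel))"
        unfolding Sb_def using sub by (intro sets.Diff evK) auto
      have "indep_var (Pi\<^sub>M (lo y) (\<lambda>_. borel)) ?A (Pi\<^sub>M (hi y) (\<lambda>_. borel)) ?B"
        by (rule indep_var_restrict[OF ind]) (use sub in auto)
      from indep_varD[OF this Sa Sb]
      have *: "prob ((\<lambda>x. (?A x, ?B x)) -` (Sa \<times> Sb) \<inter> space M) =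
        prob (?A -` Sa \<inter> space M) * prob (?B -` Sb \<inter> space M)" .
      have t: "?A -` Sa \<inter> space M = \<tau> y"
      proof -
        have "F z = ?A -` ?E (lo z) (lo y) (2*a*l) \<inter> space M" if "z \<le> y" for z
          unfolding F_def using ev_pre[OF lo_mono[OF that]] by simp
        then show ?thesis unfolding \<tau>_def Sa_def by auto
      qed
      have g: "?B -` Sb \<inter> space M = space M - G y"
        unfolding G_def ev_pre[OF order_refl] Sb_def by (auto simp: space_PiM)
      have "(\<lambda>x. (?A x, ?B x)) -` (Sa \<times> Sb) \<inter> space M = (?A -` Sa \<inter> space M) \<inter> (?B -` Sb \<inter> space M)"
        by auto
      also have "\<dots> = \<tau> y - G y" unfolding t g using sets.sets_into_space[of "\<tau> y" M] by auto
      finally show ?thesis using * unfolding t g by simp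
    qed
    have half: "prob (\<tau> y) \<le> 2 * prob (\<tau> y - G y)" for y
    proof -
      have "prob (G y) \<le> 1/2" using IH[OF sub(2)] True unfolding G_def by (meson order_trans)
      then have "1/2 \<le> prob (space M - G y)" by (subst prob_compl) auto
      then have "prob (\<tau> y) * (1/2) \<le> prob (\<tau> y) * prob (space M - G y)"
        by (intro mult_left_mono) auto
      then show ?thesis unfolding indep by simp
    qed
    have incl: "\<tau> y - G y \<subseteq> ev I (a * l)" for y
    proof
      fix \<omega> assume "\<omega> \<in> \<tau> y - G y"
      then have "\<omega> \<in> F y" "\<omega> \<notin> G y" by (auto simp: \<tau>_def)
      then have w: "\<omega> \<in> space M" unfolding F_def ev_def by auto
      from \<open>\<omega> \<in> F y\<close> obtain k where k: "2*a*l < \<bar>\<Sum>i\<in>{i\<in>lo y. \<forall>j<p. \<psi> i j \<le> k j}. X i \<omega>\<bar>"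
        unfolding F_def ev_def orthants_def by auto
      have k': "\<bar>\<Sum>i\<in>{i\<in>hi y. \<forall>j<p. \<psi> i j \<le> k j}. X i \<omega>\<bar> \<le> a*l"
        using \<open>\<omega> \<notin> G y\<close> w unfolding G_def ev_def orthants_def by (auto simp: not_less)
      \<comment> \<open>The same bounds \<open>k\<close> on the first \<open>p\<close> coordinates
        serve past and future: an orthant of \<open>I\<close> is split by the last coordinate
        alone.\<close>
      have "{i\<in>I. \<forall>j<p. \<psi> i j \<le> k j} = {i\<in>lo y. \<forall>j<p. \<psi> i j \<le> k j} \<union> {i\<in>hi y. \<forall>j<p. \<psi> i j \<le> k j}"
        by (auto simp: lo_def hi_def)
      moreover have "(\<Sum>i\<in>{i\<in>lo y. \<forall>j<p. \<psi> i j \<le> k j} \<union> {i\<in>hi y. \<forall>j<p. \<psi> i j \<le> k j}. X i \<omega>)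
        = (\<Sum>i\<in>{i\<in>lo y. \<forall>j<p. \<psi> i j \<le> k j}. X i \<omega>) + (\<Sum>i\<in>{i\<in>hi y. \<forall>j<p. \<psi> i j \<le> k j}. X i \<omega>)"
        using I by (intro sum.union_disjoint) (auto simp: lo_def hi_def)
      ultimately have "a*l < \<bar>\<Sum>i\<in>{i\<in>I. \<forall>j<p. \<psi> i j \<le> k j}. X i \<omega>\<bar>"
        using k k' by (simp only: mult.assoc)
      then show "\<omega> \<in> ev I (a * l)" using w unfolding ev_def orthants_def by auto
    qed
    have "prob (\<Union>y. F y) = (\<Sum>y\<le>Y0. prob (\<tau> y))"
      unfolding UF Ft
      by (rule finite_measure_finite_Union) (use disj in \<open>auto simp: disjoint_family_on_def\<close>)
    also have "\<dots> \<le> (\<Sum>y\<le>Y0. 2 * prob (\<tau> y - G y))" by (intro sum_mono half)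
    also have "\<dots> = 2 * prob (\<Union>y\<le>Y0. \<tau> y - G y)"
    proof -
      have "prob (\<Union>y\<le>Y0. \<tau> y - G y) = (\<Sum>y\<le>Y0. prob (\<tau> y - G y))"
        by (rule finite_measure_finite_Union) (use disj in \<open>auto simp: disjoint_family_on_def\<close>)
      then show ?thesis by (simp only: sum_distrib_left)
    qed
    also have "\<dots> \<le> 2 * prob (ev I (a * l))"
    proof (intro mult_left_mono finite_measure_mono)
      show "(\<Union>y\<le>Y0. \<tau> y - G y) \<subseteq> ev I (a * l)" using incl by blast
    qed simp_all
    also have "\<dots> \<le> 2 * (a * V)" using IH[of I] by simp
    also have "\<dots> = 2^(Suc p) * (\<Sum>i\<in>I. expectation (\<lambda>\<omega>. (X i \<omega>)\<^sup>2)) / l\<^sup>2"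
      unfolding V_def a_def by simp
    finally show ?thesis unfolding goal_eq .
  qed
qed

end

section \<open>Poisson random sets\<close>

lemma poisson_mass_sums: "(\<lambda>k. exp (- r) * r ^ k / fact k) sums (1::real)"
proof -
  have "(\<lambda>k. exp (-r) * (r ^ k /\<^sub>R fact k)) sums (exp (-r) * exp r)"
    by (intro sums_mult exp_converges)
  then show ?thesis by (simp add: exp_minus field_simps)
qed

lemma poisson_mean_sums: "(\<lambda>k. real k * (exp (- r) * r ^ k / fact k)) sums (r::real)"
proof -
  have "real (Suc k) * (exp (- r) * r ^ (Suc k) / fact (Suc k)) = r * (exp (- r) * r ^ k / fact k)" for k
    by (simp add: fact_Suc field_simps del: of_nat_Suc)
  then have "(\<lambda>k. real (Suc k) * (exp (- r) * r ^ (Suc k) / fact (Suc k))) sums (r * 1)"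
    using sums_mult[OF poisson_mass_sums, of r r] by (simp only: mult_1_right)
  then show ?thesis by (subst (asm) sums_Suc_iff) simp
qed

lemma poisson_second_moment_sums: "(\<lambda>k. (real k)\<^sup>2 * (exp (- r) * r ^ k / fact k)) sums (r + r\<^sup>2 :: real)"
proof -
  have "(real (Suc k))\<^sup>2 * (exp (- r) * r ^ (Suc k) / fact (Suc k))
      = r * (exp (- r) * r ^ k / fact k) + r * (real k * (exp (- r) * r ^ k / fact k))" for k
    by (simp add: fact_Suc field_simps power2_eq_square del: of_nat_Suc) (simp add: algebra_simps)
  then have "(\<lambda>k. (real (Suc k))\<^sup>2 * (exp (- r) * r ^ (Suc k) / fact (Suc k))) sums (r * 1 + r * r)"
    using sums_add[OF sums_mult[OF poisson_mass_sums, of r r] sums_mult[OF poisson_mean_sums, of r r]] by (simp only:)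
  then show ?thesis by (subst (asm) sums_Suc_iff) (simp add: power2_eq_square)
qed

locale poisson_set = prob_space P for P :: "'w measure" +
  fixes \<mu> :: "'x measure" and \<Xi> :: "'w \<Rightarrow> 'x set"
  assumes poisson: "poisson_random_set P \<mu> \<Xi>"
begin

text \<open>\<open>enn2real\<close> sends an infinite count to \<open>0\<close>; for sets of finite
  intensity this affects only a null set.\<close>

definition N :: "'x set \<Rightarrow> 'w \<Rightarrow> real" where "N E \<omega> = enn2real (point_count \<Xi> E \<omega>)"

lemma points_space: "\<omega> \<in> space P \<Longrightarrow> \<Xi> \<omega> \<subseteq> space \<mu>"
  using poisson unfolding poisson_random_set_def by auto

lemma point_count_measurable[measurable]: "E \<in> sets \<mu> \<Longrightarrow> point_count \<Xi> E \<in> borel_measurable P"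
  using poisson unfolding poisson_random_set_def by auto

lemma N_measurable[measurable]: "E \<in> sets \<mu> \<Longrightarrow> N E \<in> borel_measurable P"
  unfolding N_def by measurable

lemma poisson_prob:
  "E \<in> sets \<mu> \<Longrightarrow> emeasure \<mu> E < \<infinity> \<Longrightarrow>
    prob {\<omega> \<in> space P. point_count \<Xi> E \<omega> = of_nat k} = exp (- measure \<mu> E) * measure \<mu> E ^ k / fact k"
  using poisson unfolding poisson_random_set_def by auto

lemma point_count_finite: "finite (\<Xi> \<omega> \<inter> E) \<Longrightarrow> point_count \<Xi> E \<omega> = of_nat (card (\<Xi> \<omega> \<inter> E))"
  unfolding point_count_def by (simp add: emeasure_count_space_finite)

lemma point_count_infinite: "infinite (\<Xi> \<omega> \<inter> E) \<Longrightarrow> point_count \<Xi> E \<omega> = \<infinity>"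
  unfolding point_count_def by (simp add: emeasure_count_space_infinite)

text \<open>The Poisson weights add up to \<open>1\<close>, so the finite values of the count
  exhaust the probability.\<close>

lemma AE_finite_points:
  assumes E: "E \<in> sets \<mu>" "emeasure \<mu> E < \<infinity>"
  shows "AE \<omega> in P. finite (\<Xi> \<omega> \<inter> E)"
proof -
  define A where "A k = {\<omega> \<in> space P. point_count \<Xi> E \<omega> = of_nat k}" for k
  have [measurable]: "A k \<in> sets P" for k using E unfolding A_def by measurable
  have "(\<lambda>k. prob (A k)) sums prob (\<Union>k. A k)"
    by (rule finite_measure_UNION) (auto simp: disjoint_family_on_def, auto simp: A_def)
  moreover have "(\<lambda>k. prob (A k)) sums 1"
    using poisson_mass_sums unfolding A_def poisson_prob[OF E] by simp
  ultimately have "prob (\<Union>k. A k) = 1" by (metis sums_unique2)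
  then have "AE \<omega> in P. \<omega> \<in> (\<Union>k. A k)" by (subst prob_eq_1[symmetric]) auto
  then show ?thesis
  proof eventually_elim
    case (elim \<omega>)
    then obtain k where "point_count \<Xi> E \<omega> = of_nat k" by (auto simp: A_def)
    then show ?case using point_count_infinite[of \<omega> E] by (metis ennreal_of_nat_neq_top infinity_ennreal_def)
  qed
qed

text \<open>Splitting by the value of the count reduces an expectation to a series with Poisson
  weights; it serves for the moments of order one and two.\<close>

lemma nn_integral_N:
  assumes E: "E \<in> sets \<mu>" "emeasure \<mu> E < \<infinity>" and g: "\<And>x. 0 \<le> g x"
    and s: "(\<lambda>k. g (real k) * (exp (- measure \<mu> E) * measure \<mu> E ^ k / fact k)) sums s"
    and [measurable]: "g \<in> borel_measurable borel"
  shows "(\<integral>\<^sup>+\<omega>. ennreal (g (N E \<omega>)) \<partial>P) = ennreal s"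
proof -
  define A where "A k = {\<omega> \<in> space P. point_count \<Xi> E \<omega> = of_nat k}" for k
  have [measurable]: "A k \<in> sets P" for k using E unfolding A_def by measurable
  have "(\<integral>\<^sup>+\<omega>. ennreal (g (N E \<omega>)) \<partial>P) = (\<integral>\<^sup>+\<omega>. (\<Sum>k. ennreal (g (real k)) * indicator (A k) \<omega>) \<partial>P)"
  proof (rule nn_integral_cong_AE)
    show "AE \<omega> in P. ennreal (g (N E \<omega>)) = (\<Sum>k. ennreal (g (real k)) * indicator (A k) \<omega>)"
      using AE_finite_points[OF E] AE_space
    proof eventually_elim
      case (elim \<omega>)
      have "ennreal (g (real k)) * indicator (A k) \<omega> = (if k = card (\<Xi> \<omega> \<inter> E) then ennreal (g (real k)) else 0)" for k
        using elim by (auto simp: A_def point_count_finite)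
      then have "(\<Sum>k. ennreal (g (real k)) * indicator (A k) \<omega>) = ennreal (g (real (card (\<Xi> \<omega> \<inter> E))))"
        using sums_single[of "card (\<Xi> \<omega> \<inter> E)" "\<lambda>k. ennreal (g (real k))"] by (simp add: sums_iff)
      then show ?case using elim by (simp add: N_def point_count_finite ennreal_of_nat_eq_real_of_nat)
    qed
  qed
  also have "\<dots> = (\<Sum>k. \<integral>\<^sup>+\<omega>. ennreal (g (real k)) * indicator (A k) \<omega> \<partial>P)"
    by (rule nn_integral_suminf) measurable
  also have "\<dots> = (\<Sum>k. ennreal (g (real k) * (exp (- measure \<mu> E) * measure \<mu> E ^ k / fact k)))"
  proof (rule suminf_cong)
    fix k
    have "emeasure P (A k) = ennreal (exp (- measure \<mu> E) * measure \<mu> E ^ k / fact k)"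
      using poisson_prob[OF E] unfolding A_def emeasure_eq_measure by simp
    then show "(\<integral>\<^sup>+\<omega>. ennreal (g (real k)) * indicator (A k) \<omega> \<partial>P) =
      ennreal (g (real k) * (exp (- measure \<mu> E) * measure \<mu> E ^ k / fact k))"
      by (simp add: nn_integral_cmult_indicator ennreal_mult[symmetric] g)
  qed
  also have "\<dots> = ennreal s"
    using s g by (subst suminf_ennreal2) (auto simp: sums_iff)
  finally show ?thesis .
qed

lemma N_moments:
  assumes E: "E \<in> sets \<mu>" "emeasure \<mu> E < \<infinity>"
  shows "integrable P (\<lambda>\<omega>. (N E \<omega> - measure \<mu> E)\<^sup>2)"
    "expectation (\<lambda>\<omega>. (N E \<omega> - measure \<mu> E)\<^sup>2) = measure \<mu> E"
    "integrable P (N E)" "expectation (N E) = measure \<mu> E"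
proof -
  let ?r = "measure \<mu> E"
  note [measurable] = E(1)
  have "(\<integral>\<^sup>+\<omega>. ennreal (max 0 (N E \<omega>)) \<partial>P) = ennreal ?r"
    by (rule nn_integral_N[OF E]) (use poisson_mean_sums in \<open>auto simp: max_def\<close>)
  moreover have N0: "N E \<omega> \<ge> 0" for \<omega> by (simp add: N_def)
  ultimately have *: "has_bochner_integral P (N E) ?r"
    by (intro has_bochner_integral_nn_integral) (auto simp: max_def)
  show 1: "integrable P (N E)" and 2: "expectation (N E) = ?r"
    using * by (auto simp: has_bochner_integral_iff)
  have "(\<integral>\<^sup>+\<omega>. ennreal ((N E \<omega>)\<^sup>2) \<partial>P) = ennreal (?r + ?r\<^sup>2)"
    by (rule nn_integral_N[OF E]) (use poisson_second_moment_sums in auto)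
  then have *: "has_bochner_integral P (\<lambda>\<omega>. (N E \<omega>)\<^sup>2) (?r + ?r\<^sup>2)"
    by (intro has_bochner_integral_nn_integral) auto
  have eq: "(N E \<omega> - ?r)\<^sup>2 = (N E \<omega>)\<^sup>2 + ?r\<^sup>2 - 2 * ?r * N E \<omega>" for \<omega>
    by (simp add: power2_diff)
  show "integrable P (\<lambda>\<omega>. (N E \<omega> - ?r)\<^sup>2)" "expectation (\<lambda>\<omega>. (N E \<omega> - ?r)\<^sup>2) = ?r"
    unfolding eq using * 1 2 by (auto simp: has_bochner_integral_iff prob_space power2_eq_square)
qed

text \<open>From \<open>exp (- r) \<ge> 1 - r\<close>. The quadratic order is the point: over
  \<open>2^k\<close> cells of intensity \<open>c / 2^k\<close> the union bound still tends to
  \<open>0\<close>.\<close>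

lemma prob_two_points:
  assumes E: "E \<in> sets \<mu>" "emeasure \<mu> E < \<infinity>"
  shows "prob {\<omega>\<in>space P. 2 \<le> point_count \<Xi> E \<omega>} \<le> (measure \<mu> E)\<^sup>2"
proof -
  let ?r = "measure \<mu> E"
  note [measurable] = E(1)
  let ?A = "\<lambda>k::nat. {\<omega> \<in> space P. point_count \<Xi> E \<omega> = of_nat k}"
  have "{\<omega>\<in>space P. 2 \<le> point_count \<Xi> E \<omega>} \<subseteq> space P - (?A 0 \<union> ?A 1)" by auto
  then have "prob {\<omega>\<in>space P. 2 \<le> point_count \<Xi> E \<omega>} \<le> prob (space P - (?A 0 \<union> ?A 1))"
    by (intro finite_measure_mono) auto
  also have "\<dots> = 1 - prob (?A 0 \<union> ?A 1)" by (subst prob_compl) auto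
  also have "prob (?A 0 \<union> ?A 1) = prob (?A 0) + prob (?A 1)"
    by (rule finite_measure_Union) auto
  also have "1 - \<dots> = 1 - exp (-?r) * (1 + ?r)"
    unfolding poisson_prob[OF E] by (simp add: algebra_simps)
  also have "\<dots> \<le> 1 - (1 - ?r) * (1 + ?r)"
    using exp_ge_add_one_self[of "-?r"] by (simp add: mult_right_mono)
  finally show ?thesis by (simp add: power2_eq_square algebra_simps)
qed

text \<open>Stated through a lower bound on the intensity, so as to include sets of infinite
  intensity, which almost surely contain points.\<close>

lemma prob_no_points:
  assumes E: "E \<in> sets \<mu>" "ennreal r \<le> emeasure \<mu> E"
  shows "prob {\<omega>\<in>space P. point_count \<Xi> E \<omega> = 0} \<le> exp (- r)"
proof (cases "emeasure \<mu> E < \<infinity>")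
  case True
  then have "r \<le> measure \<mu> E"
    using E(2) by (cases "r \<ge> 0") (auto simp: emeasure_eq_ennreal_measure ennreal_le_iff2 intro: order_trans[OF _ measure_nonneg])
  then show ?thesis using poisson_prob[OF E(1) True, of 0] by simp
next
  case False
  then have "AE \<omega> in P. point_count \<Xi> E \<omega> = \<infinity>"
    using poisson E(1) unfolding poisson_random_set_def by (auto simp: not_less top_unique)
  then have "AE \<omega> in P. \<not> (point_count \<Xi> E \<omega> = 0)" by eventually_elim auto
  then have "prob {\<omega>\<in>space P. point_count \<Xi> E \<omega> = 0} = 0"
    using E(1) by (subst prob_eq_0) auto
  then show ?thesis by simp
qed

text \<open>Sums over the points are written as integrals over the counting measure on
  \<open>\<Xi> \<omega>\<close>, so that monotone convergence applies for each
  \<open>\<omega>\<close>. Measurability is proved in the same induction because exchanging the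
  expectation with sums and suprema requires it.\<close>

lemma Campbell:
  assumes "h \<in> borel_measurable \<mu>"
  shows "(\<lambda>\<omega>. \<integral>\<^sup>+x. h x \<partial>count_space (\<Xi> \<omega>)) \<in> borel_measurable P \<and>
    (\<integral>\<^sup>+\<omega>. (\<integral>\<^sup>+x. h x \<partial>count_space (\<Xi> \<omega>)) \<partial>P) = (\<integral>\<^sup>+x. h x \<partial>\<mu>)"
  using assms
proof (induction h rule: borel_measurable_induct)
  case (cong f g)
  have "(\<integral>\<^sup>+x. f x \<partial>count_space (\<Xi> \<omega>)) = (\<integral>\<^sup>+x. g x \<partial>count_space (\<Xi> \<omega>))" if "\<omega> \<in> space P" for \<omega>
    using points_space[OF that] cong(3) by (intro nn_integral_cong) auto
  moreover have "(\<integral>\<^sup>+x. f x \<partial>\<mu>) = (\<integral>\<^sup>+x. g x \<partial>\<mu>)" by (intro nn_integral_cong cong(3))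
  ultimately show ?case using cong(4)
    by (auto cong: measurable_cong nn_integral_cong)
next
  case (set E)
  have eq: "(\<integral>\<^sup>+x. indicator E x \<partial>count_space (\<Xi> \<omega>)) = point_count \<Xi> E \<omega>" for \<omega>
  proof -
    have "(\<integral>\<^sup>+x. indicator E x \<partial>count_space (\<Xi> \<omega>)) = (\<integral>\<^sup>+x. indicator (\<Xi> \<omega> \<inter> E) x \<partial>count_space (\<Xi> \<omega>))"
      by (intro nn_integral_cong) (auto simp: indicator_def)
    also have "\<dots> = emeasure (count_space (\<Xi> \<omega>)) (\<Xi> \<omega> \<inter> E)"
      by (rule nn_integral_indicator) auto
    also have "\<dots> = emeasure (count_space UNIV) (\<Xi> \<omega> \<inter> E)"
      by (simp add: emeasure_count_space)
    finally show ?thesis by (simp add: point_count_def)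
  qed
  have "(\<integral>\<^sup>+\<omega>. point_count \<Xi> E \<omega> \<partial>P) = emeasure \<mu> E"
  proof (cases "emeasure \<mu> E < \<infinity>")
    case True
    have "(\<integral>\<^sup>+\<omega>. point_count \<Xi> E \<omega> \<partial>P) = (\<integral>\<^sup>+\<omega>. ennreal (N E \<omega>) \<partial>P)"
      using AE_finite_points[OF set True]
      by (intro nn_integral_cong_AE) (auto simp: N_def point_count_finite ennreal_of_nat_eq_real_of_nat elim: eventually_mono)
    also have "\<dots> = emeasure \<mu> E"
      using N_moments[OF set True] True
      by (subst nn_integral_eq_integral) (auto simp: N_def emeasure_eq_ennreal_measure)
    finally show ?thesis .
  next
    case False
    then have top: "emeasure \<mu> E = \<infinity>" by (simp add: not_less top_unique)
    have "AE \<omega> in P. point_count \<Xi> E \<omega> = \<infinity>"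
      using poisson set top unfolding poisson_random_set_def by auto
    then have "(\<integral>\<^sup>+\<omega>. point_count \<Xi> E \<omega> \<partial>P) = (\<integral>\<^sup>+\<omega>. \<infinity> \<partial>P)"
      by (rule nn_integral_cong_AE)
    then show ?thesis using top by (simp add: emeasure_space_1)
  qed
  then show ?case unfolding eq using set by simp
next
  case (mult u c)
  then have [measurable]: "(\<lambda>\<omega>. \<integral>\<^sup>+x. u x \<partial>count_space (\<Xi> \<omega>)) \<in> borel_measurable P" by simp
  show ?case using mult by (simp add: nn_integral_cmult)
next
  case (add u v)
  then have [measurable]: "(\<lambda>\<omega>. \<integral>\<^sup>+x. u x \<partial>count_space (\<Xi> \<omega>)) \<in> borel_measurable P"
    "(\<lambda>\<omega>. \<integral>\<^sup>+x. v x \<partial>count_space (\<Xi> \<omega>)) \<in> borel_measurable P" by simp_all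
  show ?case using add by (simp add: nn_integral_add)
next
  case (seq U)
  have "(\<integral>\<^sup>+x. Sup (range U) x \<partial>count_space (\<Xi> \<omega>)) = (SUP i. \<integral>\<^sup>+x. U i x \<partial>count_space (\<Xi> \<omega>))" for \<omega>
    unfolding Sup_apply image_comp o_def using seq(3) by (intro nn_integral_monotone_convergence_SUP) auto
  moreover have "(\<integral>\<^sup>+x. Sup (range U) x \<partial>\<mu>) = (SUP i. \<integral>\<^sup>+x. U i x \<partial>\<mu>)"
    unfolding Sup_apply image_comp o_def using seq(1,3) by (intro nn_integral_monotone_convergence_SUP) auto
  moreover have "(\<integral>\<^sup>+\<omega>. (SUP i. \<integral>\<^sup>+x. U i x \<partial>count_space (\<Xi> \<omega>)) \<partial>P) = (SUP i. \<integral>\<^sup>+\<omega>. (\<integral>\<^sup>+x. U i x \<partial>count_space (\<Xi> \<omega>)) \<partial>P)"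
    using seq by (intro nn_integral_monotone_convergence_SUP)
      (auto simp: incseq_def le_fun_def intro!: nn_integral_mono)
  moreover have "(\<lambda>\<omega>. SUP i. \<integral>\<^sup>+x. U i x \<partial>count_space (\<Xi> \<omega>)) \<in> borel_measurable P"
    using seq(5) by (intro borel_measurable_SUP) auto
  ultimately show ?case using seq by simp
qed

section \<open>Maximal inequalities over finite families of sets\<close>

lemma cell_maximal:
  fixes E :: "nat \<Rightarrow> 'x set" and c :: "nat \<Rightarrow> real"
  assumes E: "\<And>i. i < n \<Longrightarrow> E i \<in> sets \<mu>" "\<And>i. i < n \<Longrightarrow> emeasure \<mu> (E i) < \<infinity>"
    and disj: "disjoint_family_on E {..<n}" and "l > 0"
  shows "prob {\<omega>\<in>space P. \<exists>Q\<in>orthants \<psi> p {..<n}. 2^p * l < \<bar>\<Sum>i\<in>Q. c i * (N (E i) \<omega> - measure \<mu> (E i))\<bar>}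
    \<le> 2^p * (\<Sum>i<n. (c i)\<^sup>2 * measure \<mu> (E i)) / l\<^sup>2"
proof -
  have "indep_vars (\<lambda>_. borel) (\<lambda>i. point_count \<Xi> (E i)) {..<n}"
    using poisson E disj unfolding poisson_random_set_def by blast
  then have ind: "indep_vars (\<lambda>_. borel) (\<lambda>i \<omega>. c i * (enn2real (point_count \<Xi> (E i) \<omega>) - measure \<mu> (E i))) {..<n}"
    by (rule indep_vars_compose2) measurable
  have sq: "(c i * (N (E i) \<omega> - measure \<mu> (E i)))\<^sup>2 = (c i)\<^sup>2 * (N (E i) \<omega> - measure \<mu> (E i))\<^sup>2" for i \<omega>
    by (simp add: power_mult_distrib)
  have "prob {\<omega>\<in>space P. \<exists>Q\<in>orthants \<psi> p {..<n}. 2^p * l < \<bar>\<Sum>i\<in>Q. c i * (N (E i) \<omega> - measure \<mu> (E i))\<bar>}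
    \<le> 2^p * (\<Sum>i<n. expectation (\<lambda>\<omega>. (c i * (N (E i) \<omega> - measure \<mu> (E i)))\<^sup>2)) / l\<^sup>2"
  proof (rule indep_orthant_maximal)
    show "indep_vars (\<lambda>_. borel) (\<lambda>i \<omega>. c i * (N (E i) \<omega> - measure \<mu> (E i))) {..<n}"
      using ind unfolding N_def .
    show "integrable P (\<lambda>\<omega>. (c i * (N (E i) \<omega> - measure \<mu> (E i)))\<^sup>2)" if "i \<in> {..<n}" for i
      unfolding sq using N_moments[OF E] that by auto
    show "expectation (\<lambda>\<omega>. c i * (N (E i) \<omega> - measure \<mu> (E i))) = 0" if "i \<in> {..<n}" for i
      using N_moments(3,4)[OF E] that by (simp add: prob_space)
  qed (use \<open>l > 0\<close> in auto)
  also have "(\<Sum>i<n. expectation (\<lambda>\<omega>. (c i * (N (E i) \<omega> - measure \<mu> (E i)))\<^sup>2))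
      = (\<Sum>i<n. (c i)\<^sup>2 * measure \<mu> (E i))"
    unfolding sq by (intro sum.cong) (use N_moments(1,2)[OF E] in auto)
  finally show ?thesis .
qed

text \<open>The integral is not restricted to \<open>E\<close>: in the maximal inequalities
  \<open>h\<close> vanishes off \<open>E\<close>, a set of finite intensity that makes the sum
  finite.\<close>

definition compensated :: "'x set \<Rightarrow> ('x \<Rightarrow> real) \<Rightarrow> 'x set \<Rightarrow> 'w \<Rightarrow> real" where
  "compensated E h G \<omega> = (\<Sum>x\<in>\<Xi> \<omega> \<inter> E \<inter> G. h x) - (LINT x:G|\<mu>. h x)"

text \<open>Cells are indexed by a value of \<open>h\<close> and a subfamily of \<open>\<G>\<close>,
  namely the sets containing the point. By \<open>dim\<close> the cells inside a given
  \<open>G\<close> form an orthant for the coordinates of their representatives, so a maximum over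
  \<open>\<G>\<close> is one over orthants of independent counts.\<close>

lemma simple_maximal:
  fixes h :: "'x \<Rightarrow> real" and \<psi> :: "'x \<Rightarrow> nat \<Rightarrow> nat" and \<phi> :: "'x set \<Rightarrow> nat \<Rightarrow> nat"
  assumes E0: "E0 \<in> sets \<mu>" "emeasure \<mu> E0 < \<infinity>"
    and h: "simple_function \<mu> h" "\<And>x. x \<in> space \<mu> - E0 \<Longrightarrow> h x = 0"
    and \<G>: "finite \<G>" "\<G> \<subseteq> sets \<mu>"
    and dim: "\<And>G x. G \<in> \<G> \<Longrightarrow> x \<in> space \<mu> \<Longrightarrow> x \<in> G \<longleftrightarrow> (\<forall>j<p. \<psi> x j \<le> \<phi> G j)"
    and l: "l > 0"
  shows "\<exists>B\<in>sets P. prob B \<le> 2^p * (\<integral>x. (h x)\<^sup>2 \<partial>\<mu>) / l\<^sup>2 \<and>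
    (\<forall>\<omega>\<in>space P - B. finite (\<Xi> \<omega> \<inter> E0) \<longrightarrow> (\<forall>G\<in>\<G>. \<bar>compensated E0 h G \<omega>\<bar> \<le> 2^p * l))"
proof -
  define C where "C = (\<lambda>(c, S). {x\<in>E0. h x = c \<and> (\<forall>G\<in>\<G>. x \<in> G \<longleftrightarrow> G \<in> S)})"
  define I where "I = {i \<in> (h ` space \<mu>) \<times> Pow \<G>. C i \<noteq> {}}"
  have E0s: "x \<in> E0 \<Longrightarrow> x \<in> space \<mu>" for x using E0(1) sets.sets_into_space by blast
  have [measurable]: "h \<in> borel_measurable \<mu>" using h(1) by (rule borel_measurable_simple_function)
  have "finite I" unfolding I_def using h(1) \<G>(1) by (auto simp: simple_function_def)
  then obtain n and e :: "nat \<Rightarrow> real \<times> 'x set set" where e: "bij_betw e {..<n} I"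
    by (metis bij_betw_from_nat_into_finite)
  have eI: "e i \<in> I" if "i < n" for i using e that by (auto simp: bij_betw_def)
  define E where "E i = C (e i)" for i
  have E_sets[measurable]: "E i \<in> sets \<mu>" for i
  proof -
    have "E i = E0 \<inter> {x\<in>space \<mu>. h x = fst (e i)} \<inter> {x\<in>space \<mu>. \<forall>G\<in>\<G>. x \<in> G \<longleftrightarrow> G \<in> snd (e i)}"
      unfolding E_def C_def using E0s by (auto split: prod.splits)
    also have "\<dots> \<in> sets \<mu>"
    proof (intro sets.Int E0 sets.sets_Collect_finite_All)
      show "{x\<in>space \<mu>. x \<in> G \<longleftrightarrow> G \<in> snd (e i)} \<in> sets \<mu>" if "G \<in> \<G>" for G
      proof -
        have [measurable]: "G \<in> sets \<mu>" using that \<G>(2) by auto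
        show ?thesis by measurable
      qed
    qed (use \<G> in auto)
    finally show ?thesis .
  qed
  have E_sub: "E i \<subseteq> E0" for i unfolding E_def C_def by (auto split: prod.splits)
  have E_fin: "emeasure \<mu> (E i) < \<infinity>" for i
    using emeasure_mono[OF E_sub E0(1), of i] E0(2) by (auto simp: less_top intro: le_less_trans)
  have disj: "disjoint_family_on E {..<n}"
    unfolding disjoint_family_on_def
  proof (intro ballI impI)
    fix i j assume ij: "i \<in> {..<n}" "j \<in> {..<n}" "i \<noteq> j"
    then have "e i \<noteq> e j" using e by (auto simp: bij_betw_def inj_on_def)
    moreover have "snd (e i) \<subseteq> \<G>" "snd (e j) \<subseteq> \<G>" using eI[of i] eI[of j] ij by (simp_all add: I_def mem_Times_iff)
    ultimately show "E i \<inter> E j = {}" unfolding E_def C_def by (auto simp: prod_eq_iff split: prod.splits)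
  qed
  define c where "c i = fst (e i)" for i
  \<comment> \<open>Membership in the sets of \<open>\<G>\<close> is constant on a cell, so any of
    its points may supply the coordinates.\<close>
  define rep where "rep i = (SOME x. x \<in> E i)" for i
  have rep: "rep i \<in> E i" if "i < n" for i
    using eI[OF that] unfolding rep_def I_def E_def by (auto intro: someI)
  have rep_G: "rep i \<in> G \<longleftrightarrow> G \<in> snd (e i)" if "i < n" "G \<in> \<G>" for i G
    using rep[OF that(1)] that(2) unfolding E_def C_def by (auto split: prod.splits)
  define Q where "Q G = {i. i < n \<and> G \<in> snd (e i)}" for G
  have Q: "Q G \<in> orthants (\<lambda>i. \<psi> (rep i)) p {..<n}" if "G \<in> \<G>" for G
  proof -
    have "G \<in> snd (e i) \<longleftrightarrow> (\<forall>j<p. \<psi> (rep i) j \<le> \<phi> G j)" if "i < n" for i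
    proof -
      have "rep i \<in> space \<mu>" using rep[OF that] E_sub E0s by blast
      then show ?thesis using rep_G[OF that \<open>G \<in> \<G>\<close>] dim[OF \<open>G \<in> \<G>\<close>] by blast
    qed
    then have "Q G = {i\<in>{..<n}. \<forall>j<p. \<psi> (rep i) j \<le> \<phi> G j}"
      unfolding Q_def by auto
    then show ?thesis unfolding orthants_def by auto
  qed
  have unique: "\<exists>i<n. x \<in> E i \<and> c i = h x \<and> (\<forall>G\<in>\<G>. x \<in> G \<longleftrightarrow> i \<in> Q G)" if "x \<in> E0" for x
  proof -
    have "(h x, {G\<in>\<G>. x \<in> G}) \<in> I" using that E0s by (auto simp: I_def C_def)
    then obtain i where "i < n" "e i = (h x, {G\<in>\<G>. x \<in> G})"
      using e unfolding bij_betw_def by (metis (lifting) imageE lessThan_iff)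
    then show ?thesis using that unfolding E_def C_def c_def Q_def by (intro exI[of _ i]) auto
  qed
  have ind_E: "indicator (E j) x = (if j = i then 1 else 0 :: real)" if "i < n" "j < n" "x \<in> E i" for i j x
  proof (cases "j = i")
    case False
    then have "E j \<inter> E i = {}" using disj that by (intro disjoint_family_onD[OF disj]) auto
    then show ?thesis using that False by (auto simp: indicator_def)
  qed (use that in simp)
  have dec: "g (h x) * indicator G x = (\<Sum>i\<in>Q G. g (c i) * indicator (E i) x)"
    if "G \<in> \<G>" "x \<in> space \<mu>" "g 0 = 0" for G x and g :: "real \<Rightarrow> real"
  proof (cases "x \<in> E0")
    case True
    obtain i where i: "i < n" "x \<in> E i" "c i = h x" "\<forall>G\<in>\<G>. x \<in> G \<longleftrightarrow> i \<in> Q G" using unique[OF True] by auto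
    have "indicator (E j) x = (if j = i then 1 else 0 :: real)" if "j < n" for j
      using ind_E i that by blast
    then have "(\<Sum>i\<in>Q G. g (c i) * indicator (E i) x) = (\<Sum>j\<in>Q G. if j = i then g (c i) else 0)"
      by (intro sum.cong) (auto simp: Q_def)
    also have "\<dots> = g (h x) * indicator G x" using i that by (simp add: Q_def indicator_def)
    finally show ?thesis ..
  next
    case False
    then have "h x = 0" "indicator (E i) x = (0::real)" for i
      using h(2)[of x] that E_sub[of i] by (auto simp: indicator_def)
    then show ?thesis using that by simp
  qed
  have dec2: "(h x)\<^sup>2 = (\<Sum>i<n. (c i)\<^sup>2 * indicator (E i) x)" if "x \<in> space \<mu>" for x
  proof (cases "x \<in> E0")
    case True
    obtain i where i: "i < n" "x \<in> E i" "c i = h x" using unique[OF True] by auto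
    have "indicator (E j) x = (if j = i then 1 else 0 :: real)" if "j < n" for j
      using ind_E i that by blast
    then have "(\<Sum>i<n. (c i)\<^sup>2 * indicator (E i) x) = (\<Sum>j<n. if j = i then (c i)\<^sup>2 else 0)"
      by (intro sum.cong) auto
    also have "\<dots> = (h x)\<^sup>2" using i that by simp
    finally show ?thesis ..
  next
    case False
    then have "h x = 0" "indicator (E i) x = (0::real)" for i
      using h(2)[of x] that E_sub[of i] by (auto simp: indicator_def)
    then show ?thesis using that by simp
  qed
  have int_E: "integrable \<mu> (\<lambda>x. a * indicator (E i) x :: real)" "(\<integral>x. a * indicator (E i) x \<partial>\<mu>) = a * measure \<mu> (E i)" for i a
    using E_fin E_sets by (auto simp: less_top[symmetric] Int_absorb2 sets.sets_into_space)
  have comp: "compensated E0 h G \<omega> = (\<Sum>i\<in>Q G. c i * (N (E i) \<omega> - measure \<mu> (E i)))"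
    if G: "G \<in> \<G>" and w: "\<omega> \<in> space P" and fin: "finite (\<Xi> \<omega> \<inter> E0)" for G \<omega>
  proof -
    have "(\<Sum>x\<in>\<Xi> \<omega> \<inter> E0 \<inter> G. h x) = (\<Sum>x\<in>\<Xi> \<omega> \<inter> E0. h x * indicator G x)"
      using fin by (intro sum.mono_neutral_cong_left) auto
    also have "\<dots> = (\<Sum>x\<in>\<Xi> \<omega> \<inter> E0. \<Sum>i\<in>Q G. c i * indicator (E i) x)"
      using dec[OF G, of _ "\<lambda>x. x"] E0s by (intro sum.cong) auto
    also have "\<dots> = (\<Sum>i\<in>Q G. c i * (\<Sum>x\<in>\<Xi> \<omega> \<inter> E0. indicator (E i) x))"
      by (subst sum.swap) (simp add: sum_distrib_left)
    also have "\<dots> = (\<Sum>i\<in>Q G. c i * N (E i) \<omega>)"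
    proof (intro sum.cong refl)
      fix i
      have "\<Xi> \<omega> \<inter> E0 \<inter> E i = \<Xi> \<omega> \<inter> E i" using E_sub by auto
      moreover have "finite (\<Xi> \<omega> \<inter> E i)" using fin E_sub by (meson Int_mono finite_subset order_refl)
      moreover have "(\<Sum>x\<in>\<Xi> \<omega> \<inter> E0. indicator (E i) x) = (\<Sum>x\<in>\<Xi> \<omega> \<inter> E0 \<inter> E i. 1 :: real)"
        by (subst sum.inter_restrict[OF fin]) (auto intro!: sum.cong simp: indicator_def)
      ultimately show "c i * (\<Sum>x\<in>\<Xi> \<omega> \<inter> E0. indicator (E i) x) = c i * N (E i) \<omega>"
        using fin by (simp add: N_def point_count_finite ennreal_of_nat_eq_real_of_nat)
    qed
    finally have 1: "(\<Sum>x\<in>\<Xi> \<omega> \<inter> E0 \<inter> G. h x) = (\<Sum>i\<in>Q G. c i * N (E i) \<omega>)" .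
    have "(LINT x:G|\<mu>. h x) = (\<integral>x. (\<Sum>i\<in>Q G. c i * indicator (E i) x) \<partial>\<mu>)"
      unfolding set_lebesgue_integral_def using dec[OF G, of _ "\<lambda>x. x"]
      by (intro Bochner_Integration.integral_cong) (auto simp: mult.commute)
    also have "\<dots> = (\<Sum>i\<in>Q G. c i * measure \<mu> (E i))"
      using int_E by (subst Bochner_Integration.integral_sum) auto
    finally show ?thesis unfolding compensated_def 1 by (simp add: sum_subtractf right_diff_distrib)
  qed
  have var: "(\<integral>x. (h x)\<^sup>2 \<partial>\<mu>) = (\<Sum>i<n. (c i)\<^sup>2 * measure \<mu> (E i))"
  proof -
    have "(\<integral>x. (h x)\<^sup>2 \<partial>\<mu>) = (\<integral>x. (\<Sum>i<n. (c i)\<^sup>2 * indicator (E i) x) \<partial>\<mu>)"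
      using dec2 by (intro Bochner_Integration.integral_cong) auto
    also have "\<dots> = (\<Sum>i<n. (c i)\<^sup>2 * measure \<mu> (E i))"
      using int_E by (subst Bochner_Integration.integral_sum) auto
    finally show ?thesis .
  qed
  let ?B = "{\<omega>\<in>space P. \<exists>Q\<in>orthants (\<lambda>i. \<psi> (rep i)) p {..<n}. 2^p * l < \<bar>\<Sum>i\<in>Q. c i * (N (E i) \<omega> - measure \<mu> (E i))\<bar>}"
  have "?B = (\<Union>Q\<in>orthants (\<lambda>i. \<psi> (rep i)) p {..<n}. {\<omega>\<in>space P. 2^p * l < \<bar>\<Sum>i\<in>Q. c i * (N (E i) \<omega> - measure \<mu> (E i))\<bar>})"
    by auto
  also have "\<dots> \<in> sets P"
    by (intro sets.finite_UN finite_orthants) (auto intro!: borel_measurable_sum)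
  finally have "?B \<in> sets P" .
  moreover have "prob ?B \<le> 2^p * (\<integral>x. (h x)\<^sup>2 \<partial>\<mu>) / l\<^sup>2"
    unfolding var by (rule cell_maximal) (use E_sets E_fin disj l in auto)
  moreover have "\<bar>compensated E0 h G \<omega>\<bar> \<le> 2^p * l"
    if "\<omega> \<in> space P - ?B" "finite (\<Xi> \<omega> \<inter> E0)" "G \<in> \<G>" for \<omega> G
    using that Q[OF that(3)] comp[OF that(3)] by (auto simp: not_less)
  ultimately show ?thesis by blast
qed

text \<open>The simple approximations satisfy \<open>|F i| \<le> 2 |h|\<close>, whence the factor
  \<open>4\<close>. Their exceptional sets vary with \<open>i\<close>; a lim inf set replaces them
  all, since a bound valid for infinitely many \<open>i\<close> passes to the limit.\<close>

lemma finite_maximal: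
  fixes h :: "'x \<Rightarrow> real" and \<psi> :: "'x \<Rightarrow> nat \<Rightarrow> nat" and \<phi> :: "'x set \<Rightarrow> nat \<Rightarrow> nat"
  assumes E0: "E0 \<in> sets \<mu>" "emeasure \<mu> E0 < \<infinity>"
    and h: "integrable \<mu> h" "integrable \<mu> (\<lambda>x. (h x)\<^sup>2)" "\<And>x. x \<in> space \<mu> - E0 \<Longrightarrow> h x = 0"
    and \<G>: "finite \<G>" "\<G> \<subseteq> sets \<mu>"
    and dim: "\<And>G x. G \<in> \<G> \<Longrightarrow> x \<in> space \<mu> \<Longrightarrow> x \<in> G \<longleftrightarrow> (\<forall>j<p. \<psi> x j \<le> \<phi> G j)"
    and l: "l > 0"
  shows "\<exists>B\<in>sets P. prob B \<le> 2^p * (4 * (\<integral>x. (h x)\<^sup>2 \<partial>\<mu>)) / l\<^sup>2 \<and>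
    (\<forall>\<omega>\<in>space P - B. finite (\<Xi> \<omega> \<inter> E0) \<longrightarrow> (\<forall>G\<in>\<G>. \<bar>compensated E0 h G \<omega>\<bar> \<le> 2^p * l))"
proof -
  have hm: "h \<in> borel_measurable \<mu>" using h by auto
  obtain F where F: "\<And>i. simple_function \<mu> (F i)" "\<And>x. x \<in> space \<mu> \<Longrightarrow> (\<lambda>i. F i x) \<longlonglongrightarrow> h x"
    "\<And>i x. x \<in> space \<mu> \<Longrightarrow> dist (F i x) 0 \<le> 2 * dist (h x) 0"
    using borel_measurable_implies_sequence_metric[OF hm, of 0] by blast
  have Fm[measurable]: "F i \<in> borel_measurable \<mu>" for i using F(1) by (rule borel_measurable_simple_function)
  define b where "b = 2^p * (4 * (\<integral>x. (h x)\<^sup>2 \<partial>\<mu>)) / l\<^sup>2"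
  have sq: "(F i x)\<^sup>2 \<le> 4 * (h x)\<^sup>2" if "x \<in> space \<mu>" for i x
  proof -
    have "\<bar>F i x\<bar>\<^sup>2 \<le> (2 * \<bar>h x\<bar>)\<^sup>2" using F(3)[OF that, of i] by (intro power_mono) auto
    then show ?thesis by (simp add: power_mult_distrib)
  qed
  have "\<exists>B\<in>sets P. prob B \<le> b \<and>
    (\<forall>\<omega>\<in>space P - B. finite (\<Xi> \<omega> \<inter> E0) \<longrightarrow> (\<forall>G\<in>\<G>. \<bar>compensated E0 (F i) G \<omega>\<bar> \<le> 2^p * l))" for i
  proof -
    have "F i x = 0" if "x \<in> space \<mu> - E0" for x using F(3)[of x i] h(3)[OF that] that by auto
    from simple_maximal[OF E0 F(1) this \<G> dim l]
    obtain B where B: "B \<in> sets P" "prob B \<le> 2^p * (\<integral>x. (F i x)\<^sup>2 \<partial>\<mu>) / l\<^sup>2"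
      "\<forall>\<omega>\<in>space P - B. finite (\<Xi> \<omega> \<inter> E0) \<longrightarrow> (\<forall>G\<in>\<G>. \<bar>compensated E0 (F i) G \<omega>\<bar> \<le> 2^p * l)" by blast
    have 4: "integrable \<mu> (\<lambda>x. 4 * (h x)\<^sup>2)" using h(2) by simp
    have "(\<integral>x. (F i x)\<^sup>2 \<partial>\<mu>) \<le> (\<integral>x. 4 * (h x)\<^sup>2 \<partial>\<mu>)"
      by (intro integral_mono 4 Bochner_Integration.integrable_bound[OF 4]) (use sq in \<open>auto\<close>)
    then have "2^p * (\<integral>x. (F i x)\<^sup>2 \<partial>\<mu>) / l\<^sup>2 \<le> b"
      unfolding b_def by (intro divide_right_mono mult_left_mono) auto
    with B show ?thesis by (meson order_trans)
  qed
  then obtain B where B: "\<And>i. B i \<in> sets P" "\<And>i. prob (B i) \<le> b"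
    "\<And>i \<omega> G. \<omega> \<in> space P - B i \<Longrightarrow> finite (\<Xi> \<omega> \<inter> E0) \<Longrightarrow> G \<in> \<G> \<Longrightarrow> \<bar>compensated E0 (F i) G \<omega>\<bar> \<le> 2^p * l"
    by metis
  obtain D where D: "D \<in> sets P" "prob D \<le> b" "\<And>\<omega> m. \<omega> \<in> space P - D \<Longrightarrow> \<exists>n\<ge>m. \<omega> \<notin> B n"
    using liminf_bound[of B b] B by metis
  have "\<bar>compensated E0 h G \<omega>\<bar> \<le> 2^p * l"
    if w: "\<omega> \<in> space P - D" and fin: "finite (\<Xi> \<omega> \<inter> E0)" and G: "G \<in> \<G>" for \<omega> G
  proof -
    have "(\<lambda>i. compensated E0 (F i) G \<omega>) \<longlonglongrightarrow> compensated E0 h G \<omega>"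
      unfolding compensated_def
    proof (intro tendsto_diff tendsto_sum)
      fix x assume "x \<in> \<Xi> \<omega> \<inter> E0 \<inter> G"
      then show "(\<lambda>i. F i x) \<longlonglongrightarrow> h x" using points_space[of \<omega>] w F(2) by auto
    next
      have h2: "integrable \<mu> (\<lambda>x. 2 * \<bar>h x\<bar>)" using h(1) by auto
      show "(\<lambda>i. LINT x:G|\<mu>. F i x) \<longlonglongrightarrow> (LINT x:G|\<mu>. h x)"
        unfolding set_lebesgue_integral_def
      proof (rule integral_dominated_convergence[OF _ _ h2])
        show "(\<lambda>x. indicator G x *\<^sub>R h x) \<in> borel_measurable \<mu>"
          "(\<lambda>x. indicator G x *\<^sub>R F i x) \<in> borel_measurable \<mu>" for i
          using G \<G> hm by auto
        show "AE x in \<mu>. (\<lambda>i. indicator G x *\<^sub>R F i x) \<longlonglongrightarrow> indicator G x *\<^sub>R h x"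
          using F(2) by (auto intro!: tendsto_intros)
        show "AE x in \<mu>. norm (indicator G x *\<^sub>R F i x) \<le> 2 * \<bar>h x\<bar>" for i
          using F(3) by (auto simp: indicator_def)
      qed
    qed
    then have lim: "(\<lambda>i. \<bar>compensated E0 (F i) G \<omega>\<bar>) \<longlonglongrightarrow> \<bar>compensated E0 h G \<omega>\<bar>"
      by (rule tendsto_rabs)
    show ?thesis
    proof (rule ccontr)
      assume "\<not> ?thesis"
      then have "eventually (\<lambda>i. 2^p * l < \<bar>compensated E0 (F i) G \<omega>\<bar>) sequentially"
        using order_tendstoD(1)[OF lim] by auto
      then obtain m where "\<And>i. i \<ge> m \<Longrightarrow> 2^p * l < \<bar>compensated E0 (F i) G \<omega>\<bar>"
        by (auto simp: eventually_sequentially)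
      moreover obtain n where "n \<ge> m" "\<omega> \<notin> B n" using D(3)[OF w] by blast
      ultimately show False using w B(3)[of \<omega> n G] fin G by force
    qed
  qed
  then show ?thesis
    unfolding b_def[symmetric] using D(1,2) by (intro bexI[of _ D] conjI ballI impI) auto
qed

end

section \<open>Indexing collections\<close>

locale indexing =
  fixes T :: "'t set" and \<A> :: "'t set set" and An :: "nat \<Rightarrow> 't set set"
  assumes indexing: "indexing_collection T \<A> An"
begin

abbreviation ghull :: "nat \<Rightarrow> 't set \<Rightarrow> 't set" where "ghull n \<equiv> hull_in T (An n)"

lemma subset_T: "A \<in> \<A> \<Longrightarrow> A \<subseteq> T"
  using indexing unfolding indexing_collection_def by auto

lemma Int_mem: "A \<in> \<A> \<Longrightarrow> A' \<in> \<A> \<Longrightarrow> A \<inter> A' \<in> \<A>"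
proof -
  assume A: "A \<in> \<A>" "A' \<in> \<A>"
  have "\<forall>\<D>. \<D> \<subseteq> \<A> \<and> \<D> \<noteq> {} \<and> countable \<D> \<longrightarrow> \<Inter>\<D> \<in> \<A>"
    using indexing unfolding indexing_collection_def by (elim conjE)
  from this[rule_format, of "{A, A'}"] show ?thesis using A by auto
qed

lemma An_props: "finite (An n)" "An n \<subseteq> \<A>" "D \<in> An n \<Longrightarrow> D' \<in> An n \<Longrightarrow> D \<inter> D' \<in> An n" "incseq An"
proof -
  have "incseq An"
    using indexing unfolding indexing_collection_def by (elim conjE)
  moreover have "\<forall>n. finite (An n) \<and> An n \<subseteq> \<A> \<and> (\<forall>A\<in>An n. \<forall>A'\<in>An n. A \<inter> A' \<in> An n)"
    using indexing unfolding indexing_collection_def by (elim conjE)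
  ultimately show "incseq An" "finite (An n)" "An n \<subseteq> \<A>" "D \<in> An n \<Longrightarrow> D' \<in> An n \<Longrightarrow> D \<inter> D' \<in> An n"
    by simp_all
qed

lemma hull_Inter: "A \<in> \<A> \<Longrightarrow> (\<Inter>n. ghull n A) = A"
proof -
  have "\<forall>A\<in>\<A>. A = (\<Inter>n. ghull n A)"
    using indexing unfolding indexing_collection_def by (elim conjE)
  then show "A \<in> \<A> \<Longrightarrow> ?thesis" by simp
qed

lemma An_Int: "D \<in> An n \<union> {T} \<Longrightarrow> D' \<in> An n \<union> {T} \<Longrightarrow> D \<inter> D' \<in> An n \<union> {T}"
  using An_props(3)[where n=n] subset_T An_props(2)[of n] by (auto simp: subset_iff Int_absorb1 Int_absorb2)

lemma hull_mem:
  assumes "A \<subseteq> T"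
  shows "ghull n A \<in> An n \<union> {T}"
proof -
  have "\<Inter>\<D> \<in> An n \<union> {T}" if "finite \<D>" "\<D> \<noteq> {}" "\<D> \<subseteq> An n \<union> {T}" for \<D>
    using that
  proof (induction \<D> rule: finite_ne_induct)
    case (insert D \<D>)
    then show ?case using An_Int[of D n "\<Inter>\<D>"] by (metis Inter_insert insert_subset)
  qed auto
  from this[of "{A' \<in> An n \<union> {T}. A \<subseteq> A'}"] show ?thesis
    unfolding hull_in_def using An_props(1)[of n] assms by (auto simp del: Inter_iff)
qed

lemma hull_superset: "A \<subseteq> ghull n A"
  unfolding hull_in_def by auto

lemma hull_least: "D \<in> An n \<union> {T} \<Longrightarrow> A \<subseteq> D \<Longrightarrow> ghull n A \<subseteq> D"
  unfolding hull_in_def by auto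

lemma hull_subset_T: "A \<subseteq> T \<Longrightarrow> ghull n A \<subseteq> T"
  by (rule hull_least) auto

lemma hull_antimono: "m \<le> n \<Longrightarrow> ghull n A \<subseteq> ghull m A"
  using An_props(4) unfolding hull_in_def incseq_def by blast

text \<open>Turns membership of a point into an inclusion between members of
  \<open>An n \<union> {T}\<close>, to which an order embedding can be applied.\<close>

lemma hull_iff: "t \<in> T \<Longrightarrow> D \<in> An n \<union> {T} \<Longrightarrow> t \<in> D \<longleftrightarrow> ghull n {t} \<subseteq> D"
  using hull_least[of D n "{t}"] hull_superset[of "{t}" n] by blast

text \<open>A countable stand-in for \<open>\<A>\<close>. The hull of a set may be \<open>T\<close>
  without \<open>T\<close> being in \<open>\<A>\<close>, hence the intersection.\<close>

definition skeleton :: "'t set set" where "skeleton = (\<Union>n. An n \<union> {T}) \<inter> \<A>"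

lemma countable_skeleton: "countable skeleton"
proof -
  have "countable (\<Union>n. An n \<union> {T})" using An_props(1) by (intro countable_UN) (auto intro: countable_finite)
  then show ?thesis unfolding skeleton_def by (rule countable_Int1)
qed

lemma skeleton_subset: "skeleton \<subseteq> \<A>"
  by (simp add: skeleton_def)

text \<open>If \<open>T\<close> is not in \<open>\<A>\<close>, then \<open>A \<noteq> T\<close>; the
  hulls decrease to \<open>A\<close> and therefore differ from \<open>T\<close> from some index
  on.\<close>

lemma eventually_hull_mem:
  assumes "A \<in> \<A>"
  shows "\<exists>n0. \<forall>n\<ge>n0. ghull n A \<in> skeleton"
proof (cases "T \<in> \<A>")
  case True
  then have "ghull n A \<in> skeleton" for n
    using hull_mem[OF subset_T[OF assms], of n] An_props(2)[of n] unfolding skeleton_def by auto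
  then show ?thesis by blast
next
  case False
  then have "A \<noteq> T" using assms by auto
  have "\<exists>n0. ghull n0 A \<noteq> T"
  proof (rule ccontr)
    assume "\<not> ?thesis"
    then have "(\<Inter>n. ghull n A) = T" by simp
    then show False using hull_Inter[OF assms] \<open>A \<noteq> T\<close> by simp
  qed
  then obtain n0 where n0: "ghull n0 A \<noteq> T" by blast
  have "ghull n A \<in> skeleton" if "n \<ge> n0" for n
  proof -
    have "ghull n A \<noteq> T"
      using hull_antimono[OF that, of A] hull_subset_T[OF subset_T[OF assms], of n0] n0 by auto
    then show ?thesis using hull_mem[OF subset_T[OF assms], of n] An_props(2)[of n] unfolding skeleton_def by blast
  qed
  then show ?thesis by blast
qed

text \<open>The set attached to \<open>t\<close> contains \<open>t\<close> and belongs to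
  \<open>\<A>\<close>, so one of its hulls is a member of the skeleton around \<open>t\<close>. The
  covering makes \<open>m\<close> sigma-finite.\<close>

lemma T_covered: "T = \<Union>skeleton"
proof
  show "\<Union>skeleton \<subseteq> T" using subset_T skeleton_subset by blast
  show "T \<subseteq> \<Union>skeleton"
  proof
    fix t assume t: "t \<in> T"
    have "bij_betw (point_set T An) T (\<A> - {{}})"
      using indexing unfolding indexing_collection_def by (elim conjE)
    then have "point_set T An t \<in> \<A>" using t by (auto simp: bij_betw_def)
    then obtain n where n: "ghull n (point_set T An t) \<in> skeleton" using eventually_hull_mem[of "point_set T An t"] by blast
    have "t \<in> point_set T An t" unfolding point_set_def by auto
    then show "t \<in> \<Union>skeleton" using n hull_superset by blast
  qed
qed

text \<open>A point takes the coordinates of its hull in \<open>An n \<union> {T}\<close>, and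
  membership is then an inclusion between two members of the family. The number \<open>p\<close> of
  coordinates is the same for all \<open>n\<close>.\<close>

lemma embedding:
  assumes "finite_dimensional \<A> An"
  obtains p :: nat where "\<And>n. \<exists>\<psi> \<phi>. \<forall>t\<in>T. \<forall>D\<in>An n \<union> {T}. t \<in> D \<longleftrightarrow> (\<forall>j<p. \<psi> t j \<le> (\<phi> D j :: nat))"
proof -
  obtain p where p: "p \<ge> 1" and "\<forall>n. \<exists>\<phi> :: 't set \<Rightarrow> nat \<Rightarrow> nat.
            \<forall>A\<in>An n. \<forall>A'\<in>An n. A \<subseteq> A' \<longleftrightarrow> (\<forall>i<p. \<phi> A i \<le> \<phi> A' i)"
    using assms unfolding finite_dimensional_def by blast
  have emb: "\<exists>\<psi> \<phi>. \<forall>t\<in>T. \<forall>D\<in>An n \<union> {T}. t \<in> D \<longleftrightarrow> (\<forall>j<p. \<psi> t j \<le> (\<phi> D j :: nat))" for n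
  proof -
    obtain \<phi> :: "'t set \<Rightarrow> nat \<Rightarrow> nat" where \<phi>: "\<forall>A\<in>An n. \<forall>A'\<in>An n. A \<subseteq> A' \<longleftrightarrow> (\<forall>i<p. \<phi> A i \<le> \<phi> A' i)"
      using \<open>\<forall>n. _ n\<close> by blast
    \<comment> \<open>\<open>T\<close> receives \<open>M\<close> in every coordinate when it is not
      in \<open>An n\<close>. Strictness keeps it from lying below a member; this is read off at
      coordinate \<open>0\<close>, which exists since \<open>p \<ge> 1\<close>.\<close>
    define M where "M = Suc (Max (insert 0 ((\<lambda>(D, j). \<phi> D j) ` (An n \<times> {..<p}))))"
    have M: "\<phi> D j < M" if "D \<in> An n" "j < p" for D j
      unfolding M_def less_Suc_eq_le using that An_props(1)[of n] by (intro Max_ge) auto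
    define \<phi>' where "\<phi>' D j = (if D \<in> An n then \<phi> D j else M)" for D j
    have le_M: "\<phi>' D j \<le> M" if "j < p" for D j using M[of D j] that by (auto simp: \<phi>'_def)
    have "t \<in> D \<longleftrightarrow> (\<forall>j<p. \<phi>' (ghull n {t}) j \<le> \<phi>' D j)" if t: "t \<in> T" and D: "D \<in> An n \<union> {T}" for t D
    proof (cases "D \<in> An n")
      case True
      show ?thesis
      proof (cases "ghull n {t} \<in> An n")
        case h: True
        then have "ghull n {t} \<subseteq> D \<longleftrightarrow> (\<forall>j<p. \<phi> (ghull n {t}) j \<le> \<phi> D j)" using \<phi> True by blast
        then show ?thesis using hull_iff[OF t D] h True by (simp add: \<phi>'_def)
      next
        case h: False
        then have "ghull n {t} = T" using hull_mem[of "{t}" n] t by auto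
        then have "\<not> ghull n {t} \<subseteq> D" using subset_T[of D] An_props(2)[of n] True h by (metis equalityI subsetD)
        moreover have "\<not> \<phi>' (ghull n {t}) 0 \<le> \<phi>' D 0" using M[OF True, of 0] p True h by (simp add: \<phi>'_def)
        ultimately show ?thesis using hull_iff[OF t D] p by (metis less_le_trans zero_less_one)
      qed
    next
      case False
      then show ?thesis using D t le_M by (auto simp: \<phi>'_def)
    qed
    then show ?thesis by (intro exI[of _ "\<lambda>t. \<phi>' (ghull n {t})"] exI[of _ \<phi>']) blast
  qed
  show ?thesis by (rule that[of p]) (rule emb)
qed

end

section \<open>Consequences of a compatible metric: limits of hulls, victinies, divergence\<close>

locale metric_indexing = indexing T \<A> An for T :: "'t set" and \<A> An +
  fixes d :: "'t set \<Rightarrow> 't set \<Rightarrow> real"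
  assumes compatible: "compatible_metric T \<A> An d"
begin

lemma d_props:
  "x \<in> \<A> \<Longrightarrow> d x x = 0" "x \<in> \<A> \<Longrightarrow> y \<in> \<A> \<Longrightarrow> 0 \<le> d x y" "x \<in> \<A> \<Longrightarrow> y \<in> \<A> \<Longrightarrow> d x y = d y x"
  "x \<in> \<A> \<Longrightarrow> y \<in> \<A> \<Longrightarrow> z \<in> \<A> \<Longrightarrow> d x z \<le> d x y + d y z"
  "x \<in> \<A> \<Longrightarrow> y \<in> \<A> \<Longrightarrow> z \<in> \<A> \<Longrightarrow> d (x \<inter> z) (y \<inter> z) \<le> d x y"
proof -
  have pm: "pseudo_metric_on \<A> d" and "\<forall>A\<in>\<A>. \<forall>A'\<in>\<A>. \<forall>A''\<in>\<A>. d (A \<inter> A'') (A' \<inter> A'') \<le> d A A'"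
    using compatible unfolding compatible_metric_def by simp_all
  then show "x \<in> \<A> \<Longrightarrow> y \<in> \<A> \<Longrightarrow> z \<in> \<A> \<Longrightarrow> d (x \<inter> z) (y \<inter> z) \<le> d x y" by simp
  show "x \<in> \<A> \<Longrightarrow> d x x = 0" "x \<in> \<A> \<Longrightarrow> y \<in> \<A> \<Longrightarrow> 0 \<le> d x y"
    "x \<in> \<A> \<Longrightarrow> y \<in> \<A> \<Longrightarrow> d x y = d y x"
    "x \<in> \<A> \<Longrightarrow> y \<in> \<A> \<Longrightarrow> z \<in> \<A> \<Longrightarrow> d x z \<le> d x y + d y z"
    using pm unfolding pseudo_metric_on_def by simp_all
qed

lemma midpoint:
  "A \<in> \<A> \<Longrightarrow> A' \<in> \<A> \<Longrightarrow> A \<subseteq> A' \<Longrightarrow>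
    \<exists>A''\<in>\<A>. A \<subseteq> A'' \<and> A'' \<subseteq> A' \<and> d A A'' = d A A' / 2 \<and> d A'' A' = d A A' / 2"
proof -
  have "\<forall>A\<in>\<A>. \<forall>A'\<in>\<A>. A \<subseteq> A' \<longrightarrow>
        (\<exists>A''\<in>\<A>. A \<subseteq> A'' \<and> A'' \<subseteq> A' \<and> d A A'' = d A A' / 2 \<and> d A'' A' = d A A' / 2)"
    using compatible unfolding compatible_metric_def by (elim conjE)
  then show "A \<in> \<A> \<Longrightarrow> A' \<in> \<A> \<Longrightarrow> A \<subseteq> A' \<Longrightarrow> ?thesis" by simp
qed

lemma decseq_tendsto: "decseq S \<Longrightarrow> range S \<subseteq> \<A> \<Longrightarrow> (\<lambda>n. d (S n) (\<Inter>k. S k)) \<longlonglongrightarrow> 0"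
proof -
  have "\<forall>S. decseq S \<and> range S \<subseteq> \<A> \<longrightarrow> (\<lambda>n. d (S n) (\<Inter>k. S k)) \<longlonglongrightarrow> 0"
    using compatible unfolding compatible_metric_def by (elim conjE)
  then show "decseq S \<Longrightarrow> range S \<subseteq> \<A> \<Longrightarrow> ?thesis" by simp
qed

lemma hull_tendsto:
  assumes "A \<in> \<A>" "e > 0"
  shows "\<exists>n0. \<forall>n\<ge>n0. ghull n A \<in> skeleton \<and> d (ghull n A) A < e"
proof -
  obtain n0 where n0: "\<And>n. n \<ge> n0 \<Longrightarrow> ghull n A \<in> skeleton"
    using eventually_hull_mem[OF assms(1)] by blast
  \<comment> \<open>The shift keeps the whole sequence inside \<open>\<A>\<close>, as continuity
    along decreasing sequences demands.\<close>
  define S where "S n = ghull (n + n0) A" for n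
  have S1: "decseq S" unfolding S_def decseq_def by (intro allI impI hull_antimono) simp
  have S2: "range S \<subseteq> \<A>"
  proof (rule image_subsetI)
    fix n show "S n \<in> \<A>" using n0[of "n + n0"] skeleton_subset unfolding S_def by auto
  qed
  have "(\<Inter>k. S k) = A"
  proof -
    have "(\<Inter>k. S k) \<subseteq> (\<Inter>n. ghull n A)"
      unfolding S_def by (rule INT_anti_mono[OF subset_UNIV hull_antimono]) simp
    moreover have "A \<subseteq> (\<Inter>k. S k)" unfolding S_def by (rule INT_greatest[OF hull_superset])
    ultimately show ?thesis using hull_Inter[OF assms(1)] by simp
  qed
  then have "(\<lambda>n. d (S n) A) \<longlonglongrightarrow> 0"
    using decseq_tendsto[OF S1 S2] by simp
  then have "eventually (\<lambda>n. d (S n) A < e) sequentially" using order_tendstoD(2) assms(2) by blast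
  then obtain n1 where n1: "\<And>n. n \<ge> n1 \<Longrightarrow> d (S n) A < e" by (auto simp: eventually_sequentially)
  have "ghull n A \<in> skeleton \<and> d (ghull n A) A < e" if "n \<ge> n0 + n1" for n
    using n0[of n] n1[of "n - n0"] that by (auto simp: S_def)
  then show ?thesis by blast
qed

text \<open>Every \<open>A'\<close> near \<open>A\<close> is a limit of members of the countable skeleton, which see the same points.\<close>

lemma victiny_eq:
  assumes A: "A \<in> \<A>"
  shows "victiny \<A> d A \<rho> = (\<Union>D\<in>{D\<in>skeleton. d A D < \<rho>}. sym_diff A D)"
proof
  show "(\<Union>D\<in>{D\<in>skeleton. d A D < \<rho>}. sym_diff A D) \<subseteq> victiny \<A> d A \<rho>"
    unfolding victiny_def index_ball_def using skeleton_subset by blast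
  show "victiny \<A> d A \<rho> \<subseteq> (\<Union>D\<in>{D\<in>skeleton. d A D < \<rho>}. sym_diff A D)"
  proof
    fix t assume "t \<in> victiny \<A> d A \<rho>"
    then obtain A' where A': "A' \<in> \<A>" "d A A' < \<rho>" "t \<in> sym_diff A A'"
      unfolding victiny_def index_ball_def by blast
    obtain n0 where n0: "\<And>n. n \<ge> n0 \<Longrightarrow> ghull n A' \<in> skeleton \<and> d (ghull n A') A' < \<rho> - d A A'"
      using hull_tendsto[OF A'(1), of "\<rho> - d A A'"] A'(2) by auto
    obtain n1 where n1: "\<And>n. n \<ge> n1 \<Longrightarrow> t \<in> ghull n A' \<longleftrightarrow> t \<in> A'"
    proof (cases "t \<in> A'")
      case True
      have "t \<in> ghull n A'" for n using hull_superset[of A' n] True by (rule subsetD)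
      then show ?thesis using that[of 0] True by simp
    next
      case False
      then obtain n1 where "t \<notin> ghull n1 A'" using hull_Inter[OF A'(1)] by auto
      then have "t \<notin> ghull n A'" if "n1 \<le> n" for n using hull_antimono[OF that, of A'] by (metis subsetD)
      then show ?thesis using that[of n1] False by simp
    qed
    define D where "D = ghull (max n0 n1) A'"
    have D: "D \<in> skeleton" "d D A' < \<rho> - d A A'" "t \<in> D \<longleftrightarrow> t \<in> A'"
      using n0[of "max n0 n1"] n1[of "max n0 n1"] by (auto simp: D_def)
    then have "d A D < \<rho>"
      using d_props(4)[OF A A'(1), of D] d_props(3)[OF A'(1), of D] skeleton_subset by auto
    then show "t \<in> (\<Union>D\<in>{D\<in>skeleton. d A D < \<rho>}. sym_diff A D)" using D A'(3) by auto
  qed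
qed

lemma victiny_mono: "\<rho> \<le> \<rho>' \<Longrightarrow> victiny \<A> d A \<rho> \<subseteq> victiny \<A> d A \<rho>'"
  unfolding victiny_def index_ball_def by (intro UN_mono) auto

text \<open>Balls are open, so a radius between \<open>d A A'\<close> and \<open>\<rho>\<close>
  still captures the same \<open>A'\<close>.\<close>

lemma victiny_shrink:
  assumes "t \<in> victiny \<A> d A \<rho>"
  shows "\<exists>\<rho>'<\<rho>. t \<in> victiny \<A> d A \<rho>'"
proof -
  obtain A' where A': "A' \<in> \<A>" "d A A' < \<rho>" "t \<in> sym_diff A A'"
    using assms unfolding victiny_def index_ball_def by blast
  then show ?thesis
    unfolding victiny_def index_ball_def by (intro exI[of _ "(d A A' + \<rho>) / 2"]) auto
qed

lemma divergence_le: "\<rho> > 0 \<Longrightarrow> t \<in> victiny \<A> d A \<rho> \<Longrightarrow> divergence \<A> d t A \<le> ennreal \<rho>"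
  unfolding divergence_def by (intro Inf_lower) auto

lemma divergence_less_iff:
  "divergence \<A> d t A < c \<longleftrightarrow> (\<exists>\<rho>>0. ennreal \<rho> < c \<and> t \<in> victiny \<A> d A \<rho>)"
  unfolding divergence_def Inf_less_iff by auto

text \<open>Intersecting \<open>A \<inter> D\<close> with \<open>V\<close> leaves it unchanged, and
  \<open>V\<close> is itself \<open>A \<inter> V\<close> or \<open>D \<inter> V\<close>. Contraction
  thus bounds \<open>d V (A \<inter> D)\<close> by \<open>d A D\<close>, and likewise
  \<open>d A (A \<inter> D)\<close>; the two passages give the factor \<open>2\<close>.\<close>

lemma between:
  assumes "A \<in> \<A>" "D \<in> \<A>" "V \<in> \<A>" "A \<inter> D \<subseteq> V" "V \<subseteq> D \<or> V \<subseteq> A"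
  shows "d A V \<le> 2 * d A D"
proof -
  have U: "A \<inter> D \<in> \<A>" using Int_mem assms by blast
  have AU: "d A (A \<inter> D) \<le> d A D" using d_props(5)[OF assms(1,2,1)] d_props(3)[OF assms(1) U] by (simp add: Int_commute)
  have nn: "0 \<le> d A D" using d_props(2) assms by blast
  have "d V (A \<inter> D) \<le> d A D"
  proof (cases "V \<subseteq> A")
    case True
    have "d V (A \<inter> D) = d (A \<inter> V) (A \<inter> D \<inter> V)" using True assms(4) by (simp add: Int_absorb1 Int_absorb2)
    also have "\<dots> \<le> d A (A \<inter> D)" using d_props(5)[OF assms(1) U assms(3)] .
    finally show ?thesis using AU by simp
  next
    case False
    then have VD: "V \<subseteq> D" using assms by blast
    have "d V (A \<inter> D) = d (D \<inter> V) (A \<inter> D \<inter> V)" using VD assms(4) by (simp add: Int_absorb1 Int_absorb2)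
    also have "\<dots> \<le> d D (A \<inter> D)" using d_props(5)[OF assms(2) U assms(3)] .
    also have "\<dots> = d (D \<inter> D) (A \<inter> D)" by simp
    also have "\<dots> \<le> d D A" using d_props(5)[OF assms(2,1,2)] .
    finally show ?thesis using d_props(3)[OF assms(1,2)] by simp
  qed
  then show ?thesis using d_props(4)[OF assms(1) U assms(3)] d_props(3)[OF assms(3) U] AU by simp
qed

end

section \<open>Measurability with respect to the reference measure\<close>

locale measured_indexing = metric_indexing T \<A> An d for T :: "'t set" and \<A> An d +
  fixes m :: "'t measure"
  assumes space_m: "space m = T" and sets_m: "sets m = sigma_sets T \<A>"
    and m_finite: "\<forall>A\<in>\<A>. emeasure m A < \<infinity>"
begin

lemma \<A>_sets[measurable]: "A \<in> \<A> \<Longrightarrow> A \<in> sets m"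
  unfolding sets_m by auto

lemma T_sets[measurable]: "T \<in> sets m"
  using space_m sets.top by metis

sublocale m: sigma_finite_measure m
proof
  show "\<exists>A. countable A \<and> A \<subseteq> sets m \<and> \<Union> A = space m \<and> (\<forall>a\<in>A. emeasure m a \<noteq> \<infinity>)"
  proof (intro exI[of _ skeleton] conjI ballI)
    show "skeleton \<subseteq> sets m" using skeleton_subset \<A>_sets by blast
    show "emeasure m a \<noteq> \<infinity>" if "a \<in> skeleton" for a
      using m_finite skeleton_subset that by (auto simp: less_top)
  qed (use countable_skeleton T_covered space_m in auto)
qed

lemma An_sets: "D \<in> An n \<union> {T} \<Longrightarrow> D \<in> sets m"
  using An_props(2)[of n] by auto

lemma hull_sets: "A \<subseteq> T \<Longrightarrow> ghull n A \<in> sets m"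
  by (rule An_sets[OF hull_mem])

lemma victiny_sets[measurable]: "A \<in> \<A> \<Longrightarrow> victiny \<A> d A \<rho> \<in> sets m"
  unfolding victiny_eq using countable_skeleton skeleton_subset
  by (intro sets.countable_UN') (auto intro: countable_subset[of _ skeleton])

lemma divergence_measurable[measurable]:
  assumes A: "A \<in> \<A>"
  shows "(\<lambda>t. divergence \<A> d t A) \<in> borel_measurable m"
proof (rule borel_measurableI_less)
  fix c :: ennreal
  \<comment> \<open>Victinies grow with the radius, so rational radii decide whether the divergence
    is below \<open>c\<close>.\<close>
  have "{t \<in> space m. divergence \<A> d t A < c} = (\<Union>\<rho>\<in>{\<rho>\<in>\<rat>. \<rho> > 0 \<and> ennreal \<rho> < c}. victiny \<A> d A \<rho>)"
  proof (intro equalityI subsetI)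
    fix t assume "t \<in> {t \<in> space m. divergence \<A> d t A < c}"
    then obtain \<rho> where \<rho>: "\<rho> > 0" "ennreal \<rho> < c" "t \<in> victiny \<A> d A \<rho>"
      using divergence_less_iff by auto
    obtain r where r: "\<rho> < r" "ennreal r < c"
    proof -
      obtain e where "ennreal \<rho> < e" "e < c" using dense \<rho>(2) by blast
      then show ?thesis using that[of "enn2real e"] \<rho>(1)
        by (cases e) (auto simp: ennreal_less_iff top_unique less_top)
    qed
    obtain q where q: "q \<in> \<rat>" "\<rho> < q" "q < r" using Rats_dense_in_real[OF r(1)] by blast
    then have "ennreal q < c" using r(2) by (meson ennreal_leI le_less_trans less_imp_le)
    then show "t \<in> (\<Union>\<rho>\<in>{\<rho>\<in>\<rat>. \<rho> > 0 \<and> ennreal \<rho> < c}. victiny \<A> d A \<rho>)"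
      using q \<rho> victiny_mono[of \<rho> q A] by (intro UN_I[of q]) auto
  next
    fix t assume "t \<in> (\<Union>\<rho>\<in>{\<rho>\<in>\<rat>. \<rho> > 0 \<and> ennreal \<rho> < c}. victiny \<A> d A \<rho>)"
    then obtain \<rho> where \<rho>: "\<rho> > 0" "ennreal \<rho> < c" "t \<in> victiny \<A> d A \<rho>" by auto
    moreover have "t \<in> space m" using \<rho>(3) sets.sets_into_space[OF victiny_sets[OF A]] by blast
    ultimately show "t \<in> {t \<in> space m. divergence \<A> d t A < c}" using divergence_less_iff by blast
  qed
  also have "\<dots> \<in> sets m"
    using victiny_sets[OF A] countable_rat
    by (intro sets.countable_UN') (auto intro: countable_subset[of _ "\<rat>"])
  finally show "{t \<in> space m. divergence \<A> d t A < c} \<in> sets m" .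
qed

lemma large_set_sets[measurable]:
  assumes "A \<in> \<A>" and [measurable]: "f \<in> borel_measurable m"
  shows "large_set T \<A> d f \<alpha> A \<in> sets m"
proof -
  note [measurable] = divergence_measurable[OF assms(1)]
  have "(\<lambda>s. ennpow (divergence \<A> d s A) \<alpha>) \<in> borel_measurable m"
    unfolding ennpow_def by measurable
  then show ?thesis unfolding large_set_def space_m[symmetric] by measurable
qed

end

section \<open>Maximal inequality for compensated jumps\<close>

text \<open>Eventual agreement of membership, point by point, settles the finite sum; the integral
  follows by domination through \<open>|h|\<close>.\<close>

lemma (in poisson_set) compensated_tendsto:
  assumes h: "integrable \<mu> h" and G: "\<And>k::nat. G k \<in> sets \<mu>" "G' \<in> sets \<mu>"
    and ev: "\<And>x. x \<in> space \<mu> \<Longrightarrow> eventually (\<lambda>k. x \<in> G k \<longleftrightarrow> x \<in> G') sequentially"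
    and w: "\<omega> \<in> space P" "finite (\<Xi> \<omega> \<inter> E0)"
  shows "(\<lambda>k. compensated E0 h (G k) \<omega>) \<longlonglongrightarrow> compensated E0 h G' \<omega>"
proof -
  have ind: "(\<lambda>k. indicator (G k) x :: real) \<longlonglongrightarrow> indicator G' x" if "x \<in> space \<mu>" for x
    by (rule tendsto_eventually, rule eventually_mono[OF ev[OF that]]) (auto simp: indicator_def)
  have sum_eq: "(\<Sum>x\<in>\<Xi> \<omega> \<inter> E0 \<inter> G. h x) = (\<Sum>x\<in>\<Xi> \<omega> \<inter> E0. indicator G x * h x)" for G
    using w(2) by (intro sum.mono_neutral_cong_left) auto
  show ?thesis
    unfolding compensated_def sum_eq set_lebesgue_integral_def
  proof (intro tendsto_diff tendsto_sum)
    fix x assume "x \<in> \<Xi> \<omega> \<inter> E0"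
    then have "x \<in> space \<mu>" using points_space[OF w(1)] by auto
    from ind[OF this] show "(\<lambda>k. indicator (G k) x * h x) \<longlonglongrightarrow> indicator G' x * h x"
      by (intro tendsto_intros)
  next
    have hm: "h \<in> borel_measurable \<mu>" using h by auto
    show "(\<lambda>k. \<integral>x. indicator (G k) x *\<^sub>R h x \<partial>\<mu>) \<longlonglongrightarrow> (\<integral>x. indicator G' x *\<^sub>R h x \<partial>\<mu>)"
    proof (rule integral_dominated_convergence[where w="\<lambda>x. norm (h x)"])
      show "(\<lambda>x. indicator G' x *\<^sub>R h x) \<in> borel_measurable \<mu>"
        "(\<lambda>x. indicator (G k) x *\<^sub>R h x) \<in> borel_measurable \<mu>" for k
        using G hm by auto
      show "AE x in \<mu>. (\<lambda>k. indicator (G k) x *\<^sub>R h x) \<longlonglongrightarrow> indicator G' x *\<^sub>R h x"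
        using ind by (auto intro!: tendsto_intros AE_I2)
      show "AE x in \<mu>. norm (indicator (G k) x *\<^sub>R h x) \<le> norm (h x)" for k
        by (auto simp: indicator_def)
    qed (use h in auto)
  qed
qed

lemma (in pair_sigma_finite) integral_product:
  fixes g :: "'a \<Rightarrow> real" and k :: "'b \<Rightarrow> real"
  assumes g: "integrable M1 g" and k: "integrable M2 k"
  shows "integrable (M1 \<Otimes>\<^sub>M M2) (\<lambda>(t, x). g t * k x)"
    "(\<integral>(t, x). g t * k x \<partial>(M1 \<Otimes>\<^sub>M M2)) = (\<integral>t. g t \<partial>M1) * (\<integral>x. k x \<partial>M2)"
proof -
  have [measurable]: "g \<in> borel_measurable M1" "k \<in> borel_measurable M2" using g k by auto
  show *: "integrable (M1 \<Otimes>\<^sub>M M2) (\<lambda>(t, x). g t * k x)"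
  proof (rule Fubini_integrable)
    show "integrable M1 (\<lambda>t. \<integral>x. norm (case (t, x) of (t, x) \<Rightarrow> g t * k x) \<partial>M2)"
      using g k by (simp add: abs_mult)
    show "AE t in M1. integrable M2 (\<lambda>x. case (t, x) of (t, x) \<Rightarrow> g t * k x)"
      using k by simp
  qed measurable
  show "(\<integral>(t, x). g t * k x \<partial>(M1 \<Otimes>\<^sub>M M2)) = (\<integral>t. g t \<partial>M1) * (\<integral>x. k x \<partial>M2)"
    using integral_fst'[OF *] by simp
qed

lemma (in pair_sigma_finite) nn_integral_product:
  assumes [measurable]: "u \<in> borel_measurable M1" "v \<in> borel_measurable M2"
  shows "(\<integral>\<^sup>+(t, x). u t * v x \<partial>(M1 \<Otimes>\<^sub>M M2)) = (\<integral>\<^sup>+t. u t \<partial>M1) * (\<integral>\<^sup>+x. v x \<partial>M2)"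
proof -
  have "(\<integral>\<^sup>+(t, x). u t * v x \<partial>(M1 \<Otimes>\<^sub>M M2)) = (\<integral>\<^sup>+t. \<integral>\<^sup>+x. u t * v x \<partial>M2 \<partial>M1)"
    by (subst M2.nn_integral_fst[symmetric]) auto
  then show ?thesis by (simp add: nn_integral_cmult nn_integral_multc)
qed

text \<open>\<open>|f| \<le> 1 + f^2\<close>, and the constant \<open>1\<close> is integrable over a
  set of finite measure.\<close>

lemma square_integrable_on_imp_integrable_on:
  fixes f :: "'a \<Rightarrow> real"
  assumes "W \<in> sets M" "emeasure M W < \<infinity>" "f \<in> borel_measurable M"
    and "integrable M (\<lambda>t. (f t * indicator W t)\<^sup>2)"
  shows "integrable M (\<lambda>t. f t * indicator W t)"
proof (rule Bochner_Integration.integrable_bound)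
  show "integrable M (\<lambda>t. indicator W t + (f t * indicator W t)\<^sup>2)"
    using assms by (intro Bochner_Integration.integrable_add) (auto simp: less_top)
  have "\<bar>f t * indicator W t\<bar> \<le> indicator W t + (f t * indicator W t)\<^sup>2" for t
  proof (cases "t \<in> W")
    case True
    have "0 \<le> (\<bar>f t\<bar> - 1/2)\<^sup>2" by simp
    then have "\<bar>f t\<bar> \<le> 1 + (f t)\<^sup>2" by (simp add: power2_diff power_divide)
    then show ?thesis using True by simp
  qed simp
  then show "AE t in M. norm (f t * indicator W t) \<le> norm (indicator W t + (f t * indicator W t)\<^sup>2)"
    by (intro AE_I2) (auto simp: abs_of_nonneg)
qed (use assms in measurable)

locale levy = measured_indexing T \<A> An d m + poisson_set P "m \<Otimes>\<^sub>M \<nu>" \<Xi>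
  for T :: "'t set" and \<A> An d and m :: "'t measure" and P :: "'w measure" and \<nu> :: "real measure" and \<Xi> +
  assumes fin_dim: "finite_dimensional \<A> An"
    and sets_\<nu>[measurable_cong]: "sets \<nu> = sets borel" and \<nu>_0: "emeasure \<nu> {0} = 0"
    and \<nu>_sq: "(\<integral>\<^sup>+x. ennreal (x\<^sup>2) \<partial>\<nu>) < \<infinity>"
begin

lemma space_\<nu>: "space \<nu> = UNIV"
  using sets_eq_imp_space_eq[OF sets_\<nu>] by simp

lemma \<nu>_large: "e > 0 \<Longrightarrow> emeasure \<nu> {x. e \<le> \<bar>x\<bar>} < \<infinity>"
proof -
  assume e: "e > 0"
  have [measurable]: "{x. e \<le> \<bar>x\<bar>} \<in> sets \<nu>" by simp
  have "ennreal (e\<^sup>2) * emeasure \<nu> {x. e \<le> \<bar>x\<bar>} = (\<integral>\<^sup>+x. ennreal (e\<^sup>2) * indicator {x. e \<le> \<bar>x\<bar>} x \<partial>\<nu>)"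
    by (subst nn_integral_cmult_indicator) auto
  also have "\<dots> \<le> (\<integral>\<^sup>+x. ennreal (x\<^sup>2) \<partial>\<nu>)"
  proof (intro nn_integral_mono)
    fix x
    have "e\<^sup>2 \<le> x\<^sup>2" if "e \<le> \<bar>x\<bar>" using that e by (metis abs_le_square_iff abs_of_pos)
    then show "ennreal (e\<^sup>2) * indicator {x. e \<le> \<bar>x\<bar>} x \<le> ennreal (x\<^sup>2)"
      by (auto simp: indicator_def intro: ennreal_leI)
  qed
  also have "\<dots> < \<infinity>" by (rule \<nu>_sq)
  finally show ?thesis using e by (auto simp: ennreal_mult_less_top)
qed

text \<open>The second moment gives finite mass to \<open>{x. e \<le> |x|}\<close> for
  \<open>e > 0\<close>, and the remaining point \<open>0\<close> has mass zero.\<close>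

sublocale \<nu>: sigma_finite_measure \<nu>
proof
  let ?A = "insert {0} (range (\<lambda>n. {x::real. 1 / real (Suc n) \<le> \<bar>x\<bar>}))"
  show "\<exists>A. countable A \<and> A \<subseteq> sets \<nu> \<and> \<Union>A = space \<nu> \<and> (\<forall>a\<in>A. emeasure \<nu> a \<noteq> \<infinity>)"
  proof (intro exI[of _ ?A] conjI ballI)
    have "x \<in> \<Union>?A" for x :: real
    proof (cases "x = 0")
      case False
      then obtain n where "inverse (real (Suc n)) < \<bar>x\<bar>" using reals_Archimedean[of "\<bar>x\<bar>"] by auto
      then have "x \<in> {x. 1 / real (Suc n) \<le> \<bar>x\<bar>}" by (simp add: field_simps)
      then show ?thesis by blast
    qed simp
    then show "\<Union>?A = space \<nu>" unfolding space_\<nu> by blast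
    show "emeasure \<nu> a \<noteq> \<infinity>" if "a \<in> ?A" for a
      using that \<nu>_0 \<nu>_large by (auto simp: less_top)
  qed auto
qed

sublocale m\<nu>: pair_sigma_finite m \<nu> ..

lemma integrable_\<nu>_sq: "integrable \<nu> (\<lambda>x. x\<^sup>2)"
  using \<nu>_sq by (intro integrableI_bounded) auto

text \<open>Half-open: lowering the truncation level from \<open>r\<close> to \<open>e\<close> adds
  exactly these jump sizes.\<close>

definition band :: "real \<Rightarrow> real \<Rightarrow> real set" where "band e r = {x. e \<le> \<bar>x\<bar> \<and> \<bar>x\<bar> < r}"

lemma band_sets[measurable]: "band e r \<in> sets \<nu>" "band e r \<in> sets borel"
  unfolding band_def by auto

lemma integrable_band:
  assumes "e > 0"
  shows "integrable \<nu> (\<lambda>x. indicator (band e r) x * x)"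
proof (rule Bochner_Integration.integrable_bound)
  show "integrable \<nu> (\<lambda>x. x\<^sup>2 / e)" using integrable_\<nu>_sq by simp
  have "\<bar>x\<bar> \<le> x\<^sup>2 / e" if "e \<le> \<bar>x\<bar>" for x
  proof -
    have "\<bar>x\<bar> * e \<le> \<bar>x\<bar> * \<bar>x\<bar>" using that by (intro mult_left_mono) auto
    then show ?thesis using assms by (simp add: field_simps power2_eq_square)
  qed
  then show "AE x in \<nu>. norm (indicator (band e r) x * x) \<le> norm (x\<^sup>2 / e)"
    using assms by (intro AE_I2) (auto simp: band_def indicator_def)
qed measurable

text \<open>As with \<open>compensated\<close>, only the sum is confined to \<open>W\<close>; the
  maximal inequalities are for \<open>g\<close> vanishing on the rest of \<open>T\<close>.\<close>

definition zsum :: "'t set \<Rightarrow> ('t \<Rightarrow> real) \<Rightarrow> real \<Rightarrow> real \<Rightarrow> 't set \<Rightarrow> 'w \<Rightarrow> real" where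
  "zsum W g r \<epsilon> A \<omega> = (\<Sum>(t, x)\<in>{(t, x)\<in>\<Xi> \<omega>. t \<in> A \<inter> W \<and> x \<in> band \<epsilon> r}. g t * x)
     - (LINT t:A|m. g t) * (LINT x:band \<epsilon> r|\<nu>. x)"

text \<open>The truncation level \<open>\<epsilon>\<close> moves into the set while the integrand
  keeps the fixed cutoff \<open>e0\<close>. A supremum over \<open>A\<close> and
  \<open>\<epsilon>\<close> becomes one over the sets
  \<open>A \<times> {x. \<epsilon> \<le> |x|}\<close>.\<close>

lemma compensated_zsum:
  assumes e0: "0 < e0" "e0 \<le> \<epsilon>" and A: "A \<in> sets m" and g: "integrable m g"
  shows "compensated (W \<times> band e0 r) (\<lambda>(t, x). g t * (indicator (band e0 r) x * x)) (A \<times> {x. \<epsilon> \<le> \<bar>x\<bar>}) \<omega>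
    = zsum W g r \<epsilon> A \<omega>"
proof -
  have band: "indicator {x. \<epsilon> \<le> \<bar>x\<bar>} x * indicator (band e0 r) x = (indicator (band \<epsilon> r) x :: real)" for x
    using e0 by (auto simp: band_def indicator_def)
  have "(LINT p:A \<times> {x. \<epsilon> \<le> \<bar>x\<bar>}|m \<Otimes>\<^sub>M \<nu>. (\<lambda>(t, x). g t * (indicator (band e0 r) x * x)) p)
      = (\<integral>(t, x). (indicator A t * g t) * (indicator (band \<epsilon> r) x * x) \<partial>(m \<Otimes>\<^sub>M \<nu>))"
    unfolding set_lebesgue_integral_def band[symmetric]
    by (intro Bochner_Integration.integral_cong) (auto simp: indicator_times)
  also have "\<dots> = (LINT t:A|m. g t) * (LINT x:band \<epsilon> r|\<nu>. x)"
  proof -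
    have 1: "integrable m (\<lambda>t. indicator A t * g t)"
      using integrable_real_mult_indicator[OF A g] by (simp add: mult.commute)
    have 2: "integrable \<nu> (\<lambda>x. indicator (band \<epsilon> r) x * x)" using e0 by (intro integrable_band) simp
    show ?thesis unfolding set_lebesgue_integral_def using m\<nu>.integral_product(2)[OF 1 2] by simp
  qed
  finally have 1: "(LINT p:A \<times> {x. \<epsilon> \<le> \<bar>x\<bar>}|m \<Otimes>\<^sub>M \<nu>. (\<lambda>(t, x). g t * (indicator (band e0 r) x * x)) p)
      = (LINT t:A|m. g t) * (LINT x:band \<epsilon> r|\<nu>. x)" .
  have 2: "\<Xi> \<omega> \<inter> W \<times> band e0 r \<inter> A \<times> {x. \<epsilon> \<le> \<bar>x\<bar>} = {(t, x)\<in>\<Xi> \<omega>. t \<in> A \<inter> W \<and> x \<in> band \<epsilon> r}"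
    using e0 by (auto simp: band_def)
  have "(\<Sum>p\<in>\<Xi> \<omega> \<inter> W \<times> band e0 r \<inter> A \<times> {x. \<epsilon> \<le> \<bar>x\<bar>}. (\<lambda>(t, x). g t * (indicator (band e0 r) x * x)) p)
    = (\<Sum>(t, x)\<in>{(t, x)\<in>\<Xi> \<omega>. t \<in> A \<inter> W \<and> x \<in> band \<epsilon> r}. g t * x)"
    unfolding 2 using e0 by (intro sum.cong) (auto simp: band_def indicator_def)
  with 1 show ?thesis unfolding compensated_def zsum_def by simp
qed

lemma emeasure_times_\<nu>: "A \<in> sets m \<Longrightarrow> S \<in> sets borel \<Longrightarrow> emeasure (m \<Otimes>\<^sub>M \<nu>) (A \<times> S) = emeasure m A * emeasure \<nu> S"
  by (rule \<nu>.emeasure_pair_measure_Times) (auto simp: sets_\<nu>)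

definition coordinatized :: "nat \<Rightarrow> bool" where
  "coordinatized p \<longleftrightarrow>
    (\<forall>n. \<exists>\<psi> \<phi>. \<forall>t\<in>T. \<forall>D\<in>An n \<union> {T}. t \<in> D \<longleftrightarrow> (\<forall>j<p. \<psi> t j \<le> (\<phi> D j :: nat)))"

text \<open>Fixed once for the collection and valid for every \<open>n\<close>, so that the constant
  \<open>maxc\<close> depends neither on the finite subfamily nor on the scale.\<close>

definition idim :: nat where "idim = (SOME p. coordinatized p)"

lemma idim: "\<exists>\<psi> \<phi>. \<forall>t\<in>T. \<forall>D\<in>An n \<union> {T}. t \<in> D \<longleftrightarrow> (\<forall>j<idim. \<psi> t j \<le> (\<phi> D j :: nat))"
proof -
  have "\<exists>p. coordinatized p"
  proof (rule embedding[OF fin_dim])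
    fix p :: nat assume "\<And>n. \<exists>\<psi> \<phi>. \<forall>t\<in>T. \<forall>D\<in>An n \<union> {T}. t \<in> D \<longleftrightarrow> (\<forall>j<p. \<psi> t j \<le> (\<phi> D j :: nat))"
    then show ?thesis unfolding coordinatized_def by (intro exI[of _ p] allI)
  qed
  then have "coordinatized idim" unfolding idim_def by (rule someI_ex)
  then show ?thesis unfolding coordinatized_def by (rule spec)
qed

text \<open>
  The jump size serves as one more coordinate, so that one maximal inequality covers the suprema
  over the sets of \<open>\<A>\<close> and over the truncation levels at once.
\<close>

lemma product_coordinates:
  assumes "finite F"
  shows "\<exists>\<psi> \<phi>. \<forall>G\<in>(\<lambda>(D, e). D \<times> {x::real. e \<le> \<bar>x\<bar>}) ` ((An n \<union> {T}) \<times> F). \<forall>p\<in>T \<times> UNIV.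
    p \<in> G \<longleftrightarrow> (\<forall>j<Suc idim. \<psi> p j \<le> (\<phi> G j :: nat))"
proof -
  let ?box = "\<lambda>(D, e). D \<times> {x::real. e \<le> \<bar>x\<bar>}"
  obtain \<psi> \<phi> where \<psi>: "\<forall>t\<in>T. \<forall>D\<in>An n \<union> {T}. t \<in> D \<longleftrightarrow> (\<forall>j<idim. \<psi> t j \<le> (\<phi> D j :: nat))"
    using idim[of n] by blast
  \<comment> \<open>The last coordinate counts the levels above \<open>|x|\<close> and falls as
    \<open>|x|\<close> grows. Reaching a level is thus an upper bound on a natural number, the shape
    that orthants require.\<close>
  define \<psi>' where "\<psi>' = (\<lambda>(t, x) j. if j < idim then \<psi> t j else card {e\<in>F. \<bar>x\<bar> < e})"
  \<comment> \<open>Different pairs may give the same box, for instance when \<open>D\<close> is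
    empty, so one pair is chosen for each set.\<close>
  define rep where "rep G = (SOME i. i \<in> (An n \<union> {T}) \<times> F \<and> G = ?box i)" for G
  define \<phi>' where "\<phi>' G j = (if j < idim then \<phi> (fst (rep G)) j else card {e\<in>F. snd (rep G) < e})" for G j
  have "p \<in> G \<longleftrightarrow> (\<forall>j<Suc idim. \<psi>' p j \<le> \<phi>' G j)" if G: "G \<in> ?box ` ((An n \<union> {T}) \<times> F)" and p: "p \<in> T \<times> UNIV" for G p
  proof -
    have "rep G \<in> (An n \<union> {T}) \<times> F \<and> G = ?box (rep G)"
      unfolding rep_def by (rule someI_ex) (use G in blast)
    then obtain D e where De: "rep G = (D, e)" "D \<in> An n \<union> {T}" "e \<in> F" "G = D \<times> {x. e \<le> \<bar>x\<bar>}"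
      by (cases "rep G") auto
    obtain t x where tx: "p = (t, x)" "t \<in> T" using p by auto
    have "e \<le> \<bar>x\<bar> \<longleftrightarrow> card {e'\<in>F. \<bar>x\<bar> < e'} \<le> card {e'\<in>F. e < e'}"
    proof
      assume "e \<le> \<bar>x\<bar>"
      then show "card {e'\<in>F. \<bar>x\<bar> < e'} \<le> card {e'\<in>F. e < e'}"
        using assms by (intro card_mono) auto
    next
      assume *: "card {e'\<in>F. \<bar>x\<bar> < e'} \<le> card {e'\<in>F. e < e'}"
      show "e \<le> \<bar>x\<bar>"
      proof (rule ccontr)
        assume "\<not> e \<le> \<bar>x\<bar>"
        then have x: "\<bar>x\<bar> < e" by simp
        have "{e'\<in>F. e < e'} \<subseteq> {e'\<in>F. \<bar>x\<bar> < e'}" using x by (intro Collect_mono) (meson less_trans)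
        moreover have "e \<in> {e'\<in>F. \<bar>x\<bar> < e'}" "e \<notin> {e'\<in>F. e < e'}" using De(3) x by simp_all
        ultimately have "{e'\<in>F. e < e'} \<subset> {e'\<in>F. \<bar>x\<bar> < e'}" by (metis psubsetI)
        then have "card {e'\<in>F. e < e'} < card {e'\<in>F. \<bar>x\<bar> < e'}"
          using assms by (intro psubset_card_mono) auto
        then show False using * by simp
      qed
    qed
    moreover have "t \<in> D \<longleftrightarrow> (\<forall>j<idim. \<psi> t j \<le> \<phi> D j)" using \<psi> tx(2) De(2) by blast
    moreover have "(\<forall>j<Suc idim. \<psi>' p j \<le> \<phi>' G j) \<longleftrightarrow>
        (\<forall>j<idim. \<psi> t j \<le> \<phi> D j) \<and> card {e'\<in>F. \<bar>x\<bar> < e'} \<le> card {e'\<in>F. e < e'}"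
      unfolding All_less_Suc by (simp add: \<psi>'_def \<phi>'_def De(1) tx(1) conj_commute)
    moreover have "p \<in> G \<longleftrightarrow> t \<in> D \<and> e \<le> \<bar>x\<bar>" using De(4) tx(1) by simp
    ultimately show ?thesis by blast
  qed
  then show ?thesis by (intro exI[of _ \<psi>'] exI[of _ \<phi>']) blast
qed

text \<open>With \<open>idim + 1\<close> coordinates the orthant inequality loses
  \<open>2 ^ Suc idim\<close> in the probability and the same factor in the level, where it enters
  squared. The \<open>4\<close> comes from the approximation by simple functions.\<close>

definition maxc :: real where "maxc = 2 ^ Suc idim * 4 * (2 ^ Suc idim)\<^sup>2"

lemma maxc_pos: "maxc > 0"
  by (simp add: maxc_def)

text \<open>The boxes built from \<open>An n \<union> {T}\<close> and the first rationals form
  finite families with a bound on \<open>prob B\<close> independent of \<open>n\<close>. General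
  \<open>A\<close> and \<open>\<epsilon>\<close> are then approached by hulls and by rational
  levels.\<close>

lemma levy_maximal_cut:
  assumes W: "W \<in> sets m" "emeasure m W < \<infinity>"
    and g: "integrable m g" "integrable m (\<lambda>t. (g t)\<^sup>2)" "\<And>t. t \<in> T - W \<Longrightarrow> g t = 0"
    and e0: "e0 > 0" and l: "l > 0"
  shows "\<exists>B\<in>sets P. prob B \<le> maxc * ((\<integral>t. (g t)\<^sup>2 \<partial>m) * (LINT x:band e0 r|\<nu>. x\<^sup>2)) / l\<^sup>2 \<and>
    (\<forall>\<omega>\<in>space P - B. finite (\<Xi> \<omega> \<inter> W \<times> band e0 r) \<longrightarrow> (\<forall>A\<in>\<A>. \<forall>\<epsilon>\<ge>e0. \<bar>zsum W g r \<epsilon> A \<omega>\<bar> \<le> l))"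
proof -
  let ?\<mu> = "m \<Otimes>\<^sub>M \<nu>" and ?E0 = "W \<times> band e0 r"
  define h where "h = (\<lambda>(t::'t, x::real). g t * (indicator (band e0 r) x * x))"
  have E0: "?E0 \<in> sets ?\<mu>" "emeasure ?\<mu> ?E0 < \<infinity>"
  proof -
    show "?E0 \<in> sets ?\<mu>" using W by auto
    have "emeasure \<nu> (band e0 r) \<le> emeasure \<nu> {x. e0 \<le> \<bar>x\<bar>}"
      by (intro emeasure_mono) (auto simp: band_def)
    then have "emeasure \<nu> (band e0 r) < \<infinity>" using \<nu>_large[OF e0] by (rule le_less_trans)
    then show "emeasure ?\<mu> ?E0 < \<infinity>" using W by (subst emeasure_times_\<nu>) (auto simp: ennreal_mult_less_top)
  qed
  have h1: "integrable ?\<mu> h"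
    unfolding h_def by (rule m\<nu>.integral_product(1)[OF g(1) integrable_band[OF e0]])
  have sq: "(h p)\<^sup>2 = (case p of (t, x) \<Rightarrow> (g t)\<^sup>2 * (indicator (band e0 r) x * x\<^sup>2))" for p
    unfolding h_def by (auto simp: power_mult_distrib indicator_def split: prod.splits)
  have b2: "integrable \<nu> (\<lambda>x. indicator (band e0 r) x * x\<^sup>2)"
    using integrable_real_mult_indicator[OF band_sets(1) integrable_\<nu>_sq] by (simp add: mult.commute)
  have h2: "integrable ?\<mu> (\<lambda>p. (h p)\<^sup>2)" "(\<integral>p. (h p)\<^sup>2 \<partial>?\<mu>) = (\<integral>t. (g t)\<^sup>2 \<partial>m) * (LINT x:band e0 r|\<nu>. x\<^sup>2)"
    unfolding sq using m\<nu>.integral_product[OF g(2) b2] by (auto simp: set_lebesgue_integral_def)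
  have h0: "h p = 0" if "p \<in> space ?\<mu> - ?E0" for p
  proof -
    obtain t x where p: "p = (t, x)" by (cases p)
    have "t \<in> T" "t \<in> W \<Longrightarrow> x \<notin> band e0 r" using that unfolding p by (auto simp: space_pair_measure space_m)
    then show ?thesis using g(3)[of t] unfolding p h_def by (cases "t \<in> W") auto
  qed
  define c where "c = (2::real) ^ Suc idim"
  have c: "c > 0" by (simp add: c_def)
  define F where "F n = from_nat_into (\<rat> :: real set) ` {..n}" for n
  define \<G> where "\<G> n = (\<lambda>(D, e). D \<times> {x::real. e \<le> \<bar>x\<bar>}) ` ((An n \<union> {T}) \<times> F n)" for n
  define b where "b = maxc * ((\<integral>t. (g t)\<^sup>2 \<partial>m) * (LINT x:band e0 r|\<nu>. x\<^sup>2)) / l\<^sup>2"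
  have "\<exists>B\<in>sets P. prob B \<le> b \<and>
    (\<forall>\<omega>\<in>space P - B. finite (\<Xi> \<omega> \<inter> ?E0) \<longrightarrow> (\<forall>G\<in>\<G> n. \<bar>compensated ?E0 h G \<omega>\<bar> \<le> l))" for n
  proof -
    have finF: "finite (F n)" unfolding F_def by simp
    obtain \<psi> \<phi> where \<psi>: "\<forall>G\<in>\<G> n. \<forall>p\<in>T \<times> UNIV. p \<in> G \<longleftrightarrow> (\<forall>j<Suc idim. \<psi> p j \<le> (\<phi> G j :: nat))"
      using product_coordinates[OF finF] unfolding \<G>_def by blast
    \<comment> \<open>The orthant inequality raises the level by the factor \<open>c\<close>, hence
      the call with \<open>l / c\<close>.\<close>
    have "\<exists>B\<in>sets P. prob B \<le> 2^Suc idim * (4 * (\<integral>p. (h p)\<^sup>2 \<partial>?\<mu>)) / (l / c)\<^sup>2 \<and>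
      (\<forall>\<omega>\<in>space P - B. finite (\<Xi> \<omega> \<inter> ?E0) \<longrightarrow> (\<forall>G\<in>\<G> n. \<bar>compensated ?E0 h G \<omega>\<bar> \<le> 2^Suc idim * (l / c)))"
    proof (rule finite_maximal[OF E0 h1 h2(1) h0])
      show "finite (\<G> n)" unfolding \<G>_def using finF An_props(1) by auto
      show "\<G> n \<subseteq> sets ?\<mu>" unfolding \<G>_def using An_sets[of _ n]
        by (intro image_subsetI) (auto intro!: pair_measureI)
      show "p \<in> G \<longleftrightarrow> (\<forall>j<Suc idim. \<psi> p j \<le> \<phi> G j)" if "G \<in> \<G> n" "p \<in> space ?\<mu>" for G p
        using \<psi> that space_m space_\<nu> by (auto simp: space_pair_measure)
      show "l / c > 0" using l c by simp
    qed
    moreover have "2^Suc idim * (4 * (\<integral>p. (h p)\<^sup>2 \<partial>?\<mu>)) / (l / c)\<^sup>2 = b"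
      unfolding b_def h2(2) maxc_def c_def by (simp add: power_divide field_simps)
    moreover have "2^Suc idim * (l / c) = l" using c unfolding c_def by simp
    ultimately show ?thesis by simp
  qed
  then obtain B where B: "\<And>n. B n \<in> sets P" "\<And>n. prob (B n) \<le> b"
    "\<And>n \<omega> G. \<omega> \<in> space P - B n \<Longrightarrow> finite (\<Xi> \<omega> \<inter> ?E0) \<Longrightarrow> G \<in> \<G> n \<Longrightarrow> \<bar>compensated ?E0 h G \<omega>\<bar> \<le> l"
    by metis
  obtain D where D: "D \<in> sets P" "prob D \<le> b" "\<And>\<omega> m. \<omega> \<in> space P - D \<Longrightarrow> \<exists>n\<ge>m. \<omega> \<notin> B n"
    using liminf_bound[of B b] B by metis
  have "\<bar>zsum W g r \<epsilon> A \<omega>\<bar> \<le> l"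
    if w: "\<omega> \<in> space P - D" and fin: "finite (\<Xi> \<omega> \<inter> ?E0)" and A: "A \<in> \<A>" and \<epsilon>: "\<epsilon> \<ge> e0" for \<omega> A \<epsilon>
  proof -
    \<comment> \<open>Levels approach \<open>\<epsilon>\<close> from below: the half-lines are
      closed, so \<open>e k \<le> |x|\<close> eventually agrees with
      \<open>\<epsilon> \<le> |x|\<close> even at \<open>|x| = \<epsilon>\<close>.\<close>
    have "\<exists>e\<in>\<rat>. \<epsilon> - 1 / real (Suc k) < e \<and> e < \<epsilon>" for k
      by (rule Rats_dense_in_real) simp
    then obtain e where e: "\<And>k. e k \<in> \<rat>" "\<And>k. \<epsilon> - 1 / real (Suc k) < e k" "\<And>k. e k < \<epsilon>" by metis
    define G where "G k = ghull k A \<times> {x. e k \<le> \<bar>x\<bar>}" for k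
    have AT: "A \<subseteq> T" using subset_T[OF A] .
    have "\<bar>compensated ?E0 h (G k) \<omega>\<bar> \<le> l" for k
    proof -
      obtain i where i: "e k = from_nat_into \<rat> i" using e(1)[of k] by (metis countable_rat from_nat_into_surj)
      obtain n where n: "n \<ge> max k i" "\<omega> \<notin> B n" using D(3)[OF w] by blast
      have "ghull k A \<in> An n \<union> {T}" using hull_mem[OF AT, of k] An_props(4) n(1) unfolding incseq_def by auto
      moreover have "e k \<in> F n" unfolding F_def i using n(1) by auto
      ultimately have "G k \<in> \<G> n" unfolding \<G>_def G_def by blast
      then show ?thesis using B(3)[of \<omega> n "G k"] w n(2) fin by auto
    qed
    moreover have "(\<lambda>k. compensated ?E0 h (G k) \<omega>) \<longlonglongrightarrow> compensated ?E0 h (A \<times> {x. \<epsilon> \<le> \<bar>x\<bar>}) \<omega>"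
    proof (rule compensated_tendsto[OF h1])
      show "G k \<in> sets ?\<mu>" for k unfolding G_def using hull_sets[OF AT] by (intro pair_measureI) auto
      show "A \<times> {x. \<epsilon> \<le> \<bar>x\<bar>} \<in> sets ?\<mu>" using A by (intro pair_measureI) auto
      show "\<forall>\<^sub>F k in sequentially. p \<in> G k \<longleftrightarrow> p \<in> A \<times> {x. \<epsilon> \<le> \<bar>x\<bar>}" for p
      proof -
        obtain t x where p: "p = (t, x)" by (cases p)
        have 1: "\<forall>\<^sub>F k in sequentially. t \<in> ghull k A \<longleftrightarrow> t \<in> A"
        proof (cases "t \<in> A")
          case True
          then have "t \<in> ghull k A" for k using hull_superset[of A k] by (metis subsetD)
          then show ?thesis using True by simp
        next
          case False
          then obtain n1 where n1: "t \<notin> ghull n1 A" using hull_Inter[OF A] by auto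
          have "t \<notin> ghull n A" if "n1 \<le> n" for n using n1 hull_antimono[OF that, of A] by (metis subsetD)
          then show ?thesis using False unfolding eventually_sequentially by (intro exI[of _ n1]) simp
        qed
        have 2: "\<forall>\<^sub>F k in sequentially. e k \<le> \<bar>x\<bar> \<longleftrightarrow> \<epsilon> \<le> \<bar>x\<bar>"
        proof (cases "\<epsilon> \<le> \<bar>x\<bar>")
          case True
          then have "e k \<le> \<bar>x\<bar>" for k using e(3)[of k] by simp
          then show ?thesis using True by simp
        next
          case False
          then obtain n0 where n0: "inverse (real (Suc n0)) < \<epsilon> - \<bar>x\<bar>" using reals_Archimedean[of "\<epsilon> - \<bar>x\<bar>"] by auto
          have "\<not> e n \<le> \<bar>x\<bar>" if "n0 \<le> n" for n
          proof -
            have "1 / real (Suc n) \<le> 1 / real (Suc n0)" using that by (simp add: field_simps)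
            then show ?thesis using e(2)[of n] n0 by (simp add: inverse_eq_divide)
          qed
          then show ?thesis using False unfolding eventually_sequentially by (intro exI[of _ n0]) simp
        qed
        show ?thesis using 1 2 unfolding p G_def by eventually_elim simp
      qed
    qed (use w fin in auto)
    ultimately have "\<bar>compensated ?E0 h (A \<times> {x. \<epsilon> \<le> \<bar>x\<bar>}) \<omega>\<bar> \<le> l"
      by (intro LIMSEQ_le_const2[OF tendsto_rabs]) auto
    then show ?thesis unfolding h_def using compensated_zsum[OF e0 \<epsilon> _ g(1)] A by simp
  qed
  then show ?thesis using D(1,2) unfolding b_def by (intro bexI[of _ D]) auto
qed

text \<open>The second moment over \<open>{x. |x| < r}\<close> dominates that over every
  \<open>band e r\<close>, so the estimate is uniform in the cutoff. Outside a lim inf set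
  arbitrarily small cutoffs are good.\<close>

lemma levy_maximal:
  assumes W: "W \<in> sets m" "emeasure m W < \<infinity>"
    and g: "integrable m g" "integrable m (\<lambda>t. (g t)\<^sup>2)" "\<And>t. t \<in> T - W \<Longrightarrow> g t = 0"
    and l: "l > 0"
  shows "\<exists>B\<in>sets P. prob B \<le> maxc * ((\<integral>t. (g t)\<^sup>2 \<partial>m) * (LINT x:{x. \<bar>x\<bar> < r}|\<nu>. x\<^sup>2)) / l\<^sup>2 \<and>
    (\<forall>\<omega>\<in>space P - B. \<forall>A\<in>\<A>. \<forall>\<epsilon>>0. \<bar>zsum W g r \<epsilon> A \<omega>\<bar> \<le> l)"
proof -
  define e where "e j = 1 / real (Suc j)" for j
  have e: "e j > 0" for j by (simp add: e_def)
  define b where "b = maxc * ((\<integral>t. (g t)\<^sup>2 \<partial>m) * (LINT x:{x. \<bar>x\<bar> < r}|\<nu>. x\<^sup>2)) / l\<^sup>2"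
  have "\<exists>B\<in>sets P. prob B \<le> b \<and> (\<forall>\<omega>\<in>space P - B. \<forall>A\<in>\<A>. \<forall>\<epsilon>\<ge>e j. \<bar>zsum W g r \<epsilon> A \<omega>\<bar> \<le> l)" for j
  proof -
    obtain B where B: "B \<in> sets P" "prob B \<le> maxc * ((\<integral>t. (g t)\<^sup>2 \<partial>m) * (LINT x:band (e j) r|\<nu>. x\<^sup>2)) / l\<^sup>2"
      "\<forall>\<omega>\<in>space P - B. finite (\<Xi> \<omega> \<inter> W \<times> band (e j) r) \<longrightarrow> (\<forall>A\<in>\<A>. \<forall>\<epsilon>\<ge>e j. \<bar>zsum W g r \<epsilon> A \<omega>\<bar> \<le> l)"
      using levy_maximal_cut[OF W g e l] by blast
    have "(LINT x:band (e j) r|\<nu>. x\<^sup>2) \<le> (LINT x:{x. \<bar>x\<bar> < r}|\<nu>. x\<^sup>2)"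
      unfolding set_lebesgue_integral_def
      by (intro integral_mono integrable_mult_indicator integrable_\<nu>_sq) (auto simp: band_def indicator_def)
    then have "maxc * ((\<integral>t. (g t)\<^sup>2 \<partial>m) * (LINT x:band (e j) r|\<nu>. x\<^sup>2)) / l\<^sup>2 \<le> b"
      unfolding b_def using maxc_pos by (intro divide_right_mono mult_left_mono) auto
    with B(2) have B2: "prob B \<le> b" by simp
    have "emeasure \<nu> (band (e j) r) \<le> emeasure \<nu> {x. e j \<le> \<bar>x\<bar>}"
      by (intro emeasure_mono) (auto simp: band_def)
    then have "emeasure \<nu> (band (e j) r) < \<infinity>" using \<nu>_large[OF e] by (rule le_less_trans)
    then have "emeasure (m \<Otimes>\<^sub>M \<nu>) (W \<times> band (e j) r) < \<infinity>"
      using W by (subst emeasure_times_\<nu>) (auto simp: ennreal_mult_less_top)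
    then have "AE \<omega> in P. finite (\<Xi> \<omega> \<inter> W \<times> band (e j) r)"
      using W by (intro AE_finite_points) auto
    then obtain Z where Z: "{\<omega>\<in>space P. \<not> finite (\<Xi> \<omega> \<inter> W \<times> band (e j) r)} \<subseteq> Z" "emeasure P Z = 0" "Z \<in> sets P"
      by (rule AE_E)
    have "prob (B \<union> Z) \<le> prob B + prob Z" using B(1) Z(3) by (rule measure_Un_le)
    also have "\<dots> \<le> b" using Z(2) B2 by (simp add: measure_def)
    finally have "prob (B \<union> Z) \<le> b" .
    moreover have "\<forall>\<omega>\<in>space P - (B \<union> Z). \<forall>A\<in>\<A>. \<forall>\<epsilon>\<ge>e j. \<bar>zsum W g r \<epsilon> A \<omega>\<bar> \<le> l"
      using B(3) Z(1) by blast
    ultimately show ?thesis using B(1) Z(3) by (intro bexI[of _ "B \<union> Z"]) auto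
  qed
  then obtain B where B: "\<And>n. B n \<in> sets P" "\<And>n. prob (B n) \<le> b"
    "\<And>n \<omega> A \<epsilon>. \<omega> \<in> space P - B n \<Longrightarrow> A \<in> \<A> \<Longrightarrow> \<epsilon> \<ge> e n \<Longrightarrow> \<bar>zsum W g r \<epsilon> A \<omega>\<bar> \<le> l"
    by metis
  obtain D where D: "D \<in> sets P" "prob D \<le> b" "\<And>\<omega> m. \<omega> \<in> space P - D \<Longrightarrow> \<exists>n\<ge>m. \<omega> \<notin> B n"
    using liminf_bound[of B b] B by metis
  have "\<bar>zsum W g r \<epsilon> A \<omega>\<bar> \<le> l" if w: "\<omega> \<in> space P - D" and "A \<in> \<A>" "\<epsilon> > 0" for \<omega> A \<epsilon>
  proof -
    obtain n0 where n0: "inverse (real (Suc n0)) < \<epsilon>" using reals_Archimedean[OF \<open>\<epsilon> > 0\<close>] by auto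
    obtain n where n: "n \<ge> n0" "\<omega> \<notin> B n" using D(3)[OF w] by blast
    have "e n \<le> e n0" unfolding e_def using n(1) by (simp add: field_simps)
    then have "e n \<le> \<epsilon>" using n0 by (simp add: e_def inverse_eq_divide)
    then show ?thesis using B(3)[of \<omega> n A \<epsilon>] w n that by auto
  qed
  then show ?thesis using D(1,2) unfolding b_def by (intro bexI[of _ D]) auto
qed

end

section \<open>Existence of the jump integral\<close>

text \<open>\<open>Lim\<close> is only a description, so existence of the limit has to come first.
  The Cauchy condition compares with a single level \<open>r\<close>, the form in which tail
  estimates provide it.\<close>

lemma cauchy_at_right_0:
  fixes h :: "real \<Rightarrow> real"
  assumes "\<And>k::nat. \<exists>r>0. \<forall>\<epsilon>. 0 < \<epsilon> \<and> \<epsilon> \<le> r \<longrightarrow> \<bar>h \<epsilon> - h r\<bar> \<le> 1 / real (Suc k)"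
  shows "(h \<longlongrightarrow> Lim (at_right 0) h) (at_right 0)"
    "r > 0 \<Longrightarrow> (\<And>\<epsilon>. 0 < \<epsilon> \<Longrightarrow> \<epsilon> \<le> r \<Longrightarrow> \<bar>h \<epsilon> - h r\<bar> \<le> a) \<Longrightarrow> \<bar>Lim (at_right 0) h - h r\<bar> \<le> a"
proof -
  define X where "X n = h (1 / real (Suc n))" for n
  have small: "\<exists>N. \<forall>n\<ge>N. 1 / real (Suc n) \<le> r" if r: "r > 0" for r :: real
  proof -
    obtain N where N: "inverse (real (Suc N)) < r" using reals_Archimedean[OF r] by auto
    have "1 / real (Suc n) \<le> r" if "n \<ge> N" for n
    proof -
      have "1 / real (Suc n) \<le> 1 / real (Suc N)" using that by (simp add: field_simps)
      then show ?thesis using N by (simp add: inverse_eq_divide)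
    qed
    then show ?thesis by blast
  qed
  have "Cauchy X"
  proof (rule metric_CauchyI)
    fix e :: real assume "e > 0"
    then obtain k where k: "inverse (real (Suc k)) < e / 2" using reals_Archimedean[of "e/2"] by auto
    obtain r where r: "r > 0" "\<And>\<epsilon>. 0 < \<epsilon> \<Longrightarrow> \<epsilon> \<le> r \<Longrightarrow> \<bar>h \<epsilon> - h r\<bar> \<le> 1 / real (Suc k)" using assms[of k] by blast
    obtain N where N: "\<And>n. n \<ge> N \<Longrightarrow> 1 / real (Suc n) \<le> r" using small[OF r(1)] by blast
    have "dist (X a) (X b) < e" if "a \<ge> N" "b \<ge> N" for a b
      using r(2)[of "1 / real (Suc a)"] r(2)[of "1 / real (Suc b)"] N[OF that(1)] N[OF that(2)] k
      by (simp add: X_def dist_real_def inverse_eq_divide)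
    then show "\<exists>N. \<forall>m\<ge>N. \<forall>n\<ge>N. dist (X m) (X n) < e" by blast
  qed
  then obtain L where L: "X \<longlonglongrightarrow> L" using Cauchy_convergent convergent_def by blast
  have close: "\<bar>L - h r\<bar> \<le> a" if r: "r > 0" and a: "\<And>\<epsilon>. 0 < \<epsilon> \<Longrightarrow> \<epsilon> \<le> r \<Longrightarrow> \<bar>h \<epsilon> - h r\<bar> \<le> a" for r a
  proof -
    obtain N where N: "\<And>n. n \<ge> N \<Longrightarrow> 1 / real (Suc n) \<le> r" using small[OF r] by blast
    have "(\<lambda>n. \<bar>X n - h r\<bar>) \<longlonglongrightarrow> \<bar>L - h r\<bar>" by (intro tendsto_intros L)
    then show ?thesis
    proof (rule LIMSEQ_le_const2)
      show "\<exists>N. \<forall>n\<ge>N. \<bar>X n - h r\<bar> \<le> a" using a N unfolding X_def by (intro exI[of _ N]) auto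
    qed
  qed
  have lim: "(h \<longlongrightarrow> L) (at_right 0)"
  proof (rule tendstoI)
    fix e :: real assume "e > 0"
    then obtain k where k: "inverse (real (Suc k)) < e / 2" using reals_Archimedean[of "e/2"] by auto
    obtain r where r: "r > 0" "\<And>\<epsilon>. 0 < \<epsilon> \<Longrightarrow> \<epsilon> \<le> r \<Longrightarrow> \<bar>h \<epsilon> - h r\<bar> \<le> 1 / real (Suc k)" using assms[of k] by blast
    have "\<bar>L - h r\<bar> \<le> 1 / real (Suc k)" using close[OF r] .
    then have "dist (h \<epsilon>) L < e" if "0 < \<epsilon>" "\<epsilon> < r" for \<epsilon>
      using r(2)[of \<epsilon>] that k by (simp add: dist_real_def inverse_eq_divide)
    then show "\<forall>\<^sub>F \<epsilon> in at_right 0. dist (h \<epsilon>) L < e"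
      unfolding eventually_at_right_field using r(1) by blast
  qed
  then have "Lim (at_right 0) h = L" by (intro tendsto_Lim) auto
  then show "(h \<longlongrightarrow> Lim (at_right 0) h) (at_right 0)"
    "r > 0 \<Longrightarrow> (\<And>\<epsilon>. 0 < \<epsilon> \<Longrightarrow> \<epsilon> \<le> r \<Longrightarrow> \<bar>h \<epsilon> - h r\<bar> \<le> a) \<Longrightarrow> \<bar>Lim (at_right 0) h - h r\<bar> \<le> a"
    using lim close by auto
qed

lemma (in prob_space) prob_Markov:
  assumes [measurable]: "u \<in> borel_measurable M" and c: "c > 0" and b: "(\<integral>\<^sup>+\<omega>. u \<omega> \<partial>M) \<le> ennreal b"
  shows "{\<omega>\<in>space M. ennreal c < u \<omega>} \<in> sets M" "b \<ge> 0 \<Longrightarrow> prob {\<omega>\<in>space M. ennreal c < u \<omega>} \<le> b / c"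
proof -
  show 1: "{\<omega>\<in>space M. ennreal c < u \<omega>} \<in> sets M" by measurable
  assume b0: "b \<ge> 0"
  have "ennreal c * emeasure M {\<omega>\<in>space M. ennreal c < u \<omega>} = (\<integral>\<^sup>+\<omega>. ennreal c * indicator {\<omega>\<in>space M. ennreal c < u \<omega>} \<omega> \<partial>M)"
    by (rule nn_integral_cmult_indicator[OF 1, symmetric])
  also have "\<dots> \<le> (\<integral>\<^sup>+\<omega>. u \<omega> \<partial>M)" by (intro nn_integral_mono) (auto simp: indicator_def)
  also have "\<dots> \<le> ennreal b" by (rule b)
  finally have "ennreal (c * prob {\<omega>\<in>space M. ennreal c < u \<omega>}) \<le> ennreal b"
    using c by (simp add: emeasure_eq_measure ennreal_mult)
  then have "c * prob {\<omega>\<in>space M. ennreal c < u \<omega>} \<le> b" using b0 by (simp add: ennreal_le_iff)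
  then show "prob {\<omega>\<in>space M. ennreal c < u \<omega>} \<le> b / c" using c by (simp add: field_simps)
qed

text \<open>\<open>Q\<close> need not define a measurable event: the measurable intersection of the
  \<open>B i\<close> covers the set where it fails.\<close>

lemma (in prob_space) AE_of_small_exceptions:
  assumes "\<And>\<delta>. \<delta> > 0 \<Longrightarrow> \<exists>B\<in>sets M. prob B \<le> \<delta> \<and> (\<forall>\<omega>\<in>space M - B. Q \<omega>)"
  shows "AE \<omega> in M. Q \<omega>"
proof -
  have "\<exists>B\<in>sets M. prob B \<le> 1 / real (Suc i) \<and> (\<forall>\<omega>\<in>space M - B. Q \<omega>)" for i
    by (rule assms) simp
  then obtain B where B: "\<And>i. B i \<in> sets M" "\<And>i. prob (B i) \<le> 1 / real (Suc i)" "\<And>i \<omega>. \<omega> \<in> space M - B i \<Longrightarrow> Q \<omega>"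
    by metis
  have m: "(\<Inter>i. B i) \<in> sets M" using B(1) by auto
  have "prob (\<Inter>i. B i) \<le> 0"
  proof (rule LIMSEQ_le_const[OF LIMSEQ_inverse_real_of_nat])
    have "prob (\<Inter>i. B i) \<le> inverse (real (Suc i))" for i
    proof -
      have "(\<Inter>i. B i) \<subseteq> B i" by blast
      from finite_measure_mono[OF this B(1)] B(2)[of i] show ?thesis by (simp add: inverse_eq_divide)
    qed
    then show "\<exists>N. \<forall>n\<ge>N. prob (\<Inter>i. B i) \<le> inverse (real (Suc n))" by blast
  qed
  then have "(\<Inter>i. B i) \<in> null_sets M"
    using m by (simp add: null_sets_def emeasure_eq_measure ennreal_eq_0_iff)
  then show ?thesis by (rule AE_I') (use B(3) in auto)
qed

context levy
begin

text \<open>Absorbs the case distinction of \<open>jump_integral\<close>: the compensator is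
  \<open>0\<close> when the small jumps are summable.\<close>

definition compens :: "real \<Rightarrow> real" where
  "compens \<epsilon> = (if small_jumps_summable \<nu> then 0 else LINT x:{x. \<epsilon> \<le> \<bar>x\<bar> \<and> \<bar>x\<bar> \<le> 1}|\<nu>. x)"

definition Yeps :: "('t \<Rightarrow> real) \<Rightarrow> real \<Rightarrow> 't set \<Rightarrow> 'w \<Rightarrow> real" where
  "Yeps g \<epsilon> A \<omega> = jump_sum \<Xi> g \<epsilon> A \<omega> - (LINT t:A|m. g t) * compens \<epsilon>"

lemma jump_integral_Lim: "jump_integral m \<nu> \<Xi> g A \<omega> = Lim (at_right 0) (\<lambda>\<epsilon>. Yeps g \<epsilon> A \<omega>)"
  unfolding jump_integral_def Yeps_def compens_def compensated_jump_sum_def by simp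

definition pts :: "'t set \<Rightarrow> real \<Rightarrow> 'w \<Rightarrow> ('t \<times> real) set" where
  "pts W \<epsilon> \<omega> = {(t, x)\<in>\<Xi> \<omega>. t \<in> W \<and> \<epsilon> \<le> \<bar>x\<bar>}"

text \<open>A sum over an infinite set is \<open>0\<close> by convention; on this almost sure event
  the truncated sums are the intended ones.\<close>

definition fin_pts :: "'t set \<Rightarrow> 'w \<Rightarrow> bool" where
  "fin_pts W \<omega> \<longleftrightarrow> (\<forall>\<epsilon>>0. finite (pts W \<epsilon> \<omega>))"

lemma pts_antimono: "\<epsilon> \<le> \<epsilon>' \<Longrightarrow> pts W \<epsilon>' \<omega> \<subseteq> pts W \<epsilon> \<omega>"
  by (auto simp: pts_def)

lemma AE_fin_pts:
  assumes W: "W \<in> sets m" "emeasure m W < \<infinity>"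
  shows "AE \<omega> in P. fin_pts W \<omega>"
proof -
  have "AE \<omega> in P. finite (\<Xi> \<omega> \<inter> W \<times> {x. 1 / real (Suc j) \<le> \<bar>x\<bar>})" for j
  proof (rule AE_finite_points)
    show "W \<times> {x. 1 / real (Suc j) \<le> \<bar>x\<bar>} \<in> sets (m \<Otimes>\<^sub>M \<nu>)" using W by (intro pair_measureI) auto
    show "emeasure (m \<Otimes>\<^sub>M \<nu>) (W \<times> {x. 1 / real (Suc j) \<le> \<bar>x\<bar>}) < \<infinity>"
      using W \<nu>_large[of "1 / real (Suc j)"] by (subst emeasure_times_\<nu>) (auto simp: ennreal_mult_less_top)
  qed
  then have "AE \<omega> in P. \<forall>j. finite (\<Xi> \<omega> \<inter> W \<times> {x. 1 / real (Suc j) \<le> \<bar>x\<bar>})"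
    by (simp add: AE_all_countable)
  then show ?thesis
  proof eventually_elim
    case (elim \<omega>)
    show ?case unfolding fin_pts_def
    proof (intro allI impI)
      fix \<epsilon> :: real assume "\<epsilon> > 0"
      then obtain j where j: "inverse (real (Suc j)) < \<epsilon>" using reals_Archimedean by blast
      have "pts W \<epsilon> \<omega> \<subseteq> \<Xi> \<omega> \<inter> W \<times> {x. 1 / real (Suc j) \<le> \<bar>x\<bar>}"
        using j by (auto simp: pts_def inverse_eq_divide)
      then show "finite (pts W \<epsilon> \<omega>)" using elim finite_subset by blast
    qed
  qed
qed

lemma fin_pts_mono: "fin_pts W \<omega> \<Longrightarrow> W' \<subseteq> W \<Longrightarrow> fin_pts W' \<omega>"
  unfolding fin_pts_def
proof (intro allI impI)
  fix \<epsilon> :: real assume "\<forall>\<epsilon>>0. finite (pts W \<epsilon> \<omega>)" "W' \<subseteq> W" "\<epsilon> > 0"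
  moreover from this have "pts W' \<epsilon> \<omega> \<subseteq> pts W \<epsilon> \<omega>" by (auto simp: pts_def)
  ultimately show "finite (pts W' \<epsilon> \<omega>)" using finite_subset by blast
qed

lemma jump_sum_pts:
  assumes "fin_pts W \<omega>" "\<epsilon> > 0" "A \<inter> W = A' \<inter> W" "A' \<subseteq> W"
  shows "jump_sum \<Xi> f \<epsilon> A' \<omega> = (\<Sum>(t, x)\<in>pts W \<epsilon> \<omega>. indicator A t * f t * x)"
proof -
  have "(\<Sum>(t, x)\<in>pts W \<epsilon> \<omega>. indicator A t * f t * x) = (\<Sum>(t, x)\<in>{(t, x)\<in>\<Xi> \<omega>. t \<in> A' \<and> \<epsilon> \<le> \<bar>x\<bar>}. indicator A t * f t * x)"
    using assms unfolding fin_pts_def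
    by (intro sum.mono_neutral_right) (auto simp: pts_def indicator_def)
  also have "\<dots> = jump_sum \<Xi> f \<epsilon> A' \<omega>"
    unfolding jump_sum_def using assms(3,4) by (intro sum.cong) (auto simp: indicator_def)
  finally show ?thesis ..
qed

text \<open>Summing only over points above \<open>W\<close>, a set of finite measure, lets one
  almost sure event serve every \<open>A\<close> in \<open>\<A>\<close>. It agrees with
  \<open>Yeps\<close> for \<open>A \<subseteq> W\<close> once \<open>g\<close> carries the indicator
  of \<open>W\<close>.\<close>

definition Yloc :: "'t set \<Rightarrow> ('t \<Rightarrow> real) \<Rightarrow> real \<Rightarrow> 't set \<Rightarrow> 'w \<Rightarrow> real" where
  "Yloc W g \<epsilon> A \<omega> = (\<Sum>(t, x)\<in>pts W \<epsilon> \<omega>. indicator A t * g t * x) - (LINT t:A|m. g t) * compens \<epsilon>"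

lemma Yeps_Yloc:
  assumes "fin_pts W \<omega>" "\<epsilon> > 0" "A \<subseteq> W"
  shows "Yeps f \<epsilon> A \<omega> = Yloc W (\<lambda>t. f t * indicator W t) \<epsilon> A \<omega>"
proof -
  have "(LINT t:A|m. f t) = (LINT t:A|m. f t * indicator W t)"
    unfolding set_lebesgue_integral_def using assms(3)
    by (intro Bochner_Integration.integral_cong) (auto simp: indicator_def)
  moreover have "(\<Sum>(t, x)\<in>pts W \<epsilon> \<omega>. indicator A t * f t * x) = (\<Sum>(t, x)\<in>pts W \<epsilon> \<omega>. indicator A t * (f t * indicator W t) * x)"
    by (intro sum.cong) (auto simp: pts_def)
  ultimately show ?thesis
    unfolding Yeps_def Yloc_def using jump_sum_pts[OF assms(1,2) refl assms(3)] by simp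
qed

lemma integrable_\<nu>_01:
  assumes "0 < \<epsilon>"
  shows "integrable \<nu> (\<lambda>x. indicator {x. \<epsilon> \<le> \<bar>x\<bar> \<and> \<bar>x\<bar> \<le> 1} x * x)"
proof (rule Bochner_Integration.integrable_bound[OF integrable_band[OF assms, of 2]])
  show "AE x in \<nu>. norm (indicator {x. \<epsilon> \<le> \<bar>x\<bar> \<and> \<bar>x\<bar> \<le> 1} x * x) \<le> norm (indicator (band \<epsilon> 2) x * x)"
    by (intro AE_I2) (auto simp: band_def indicator_def)
qed measurable

lemma comp_diff:
  assumes "\<not> small_jumps_summable \<nu>" "0 < \<epsilon>" "\<epsilon> \<le> r" "r \<le> 1"
  shows "compens \<epsilon> = (LINT x:band \<epsilon> r|\<nu>. x) + compens r"
proof -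
  have eq: "indicator {x. \<epsilon> \<le> \<bar>x\<bar> \<and> \<bar>x\<bar> \<le> 1} x * x
      = indicator (band \<epsilon> r) x * x + indicator {x. r \<le> \<bar>x\<bar> \<and> \<bar>x\<bar> \<le> 1} x * x" for x :: real
    using assms by (auto simp: band_def indicator_def)
  have "0 < r" using assms by simp
  then show ?thesis
    unfolding compens_def set_lebesgue_integral_def using assms(1)
    by (simp add: eq integrable_band[OF assms(2)] integrable_\<nu>_01)
qed

lemma Yloc_diff:
  assumes fin: "fin_pts W \<omega>" and "0 < \<epsilon>" "\<epsilon> \<le> r" "r \<le> 1" "\<not> small_jumps_summable \<nu>"
  shows "Yloc W g \<epsilon> A \<omega> - Yloc W g r A \<omega> = zsum W g r \<epsilon> A \<omega>"
proof -
  have "(\<Sum>(t, x)\<in>pts W \<epsilon> \<omega>. indicator A t * g t * x) =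
     (\<Sum>(t, x)\<in>pts W \<epsilon> \<omega> - pts W r \<omega>. indicator A t * g t * x) + (\<Sum>(t, x)\<in>pts W r \<omega>. indicator A t * g t * x)"
    using fin assms pts_antimono[of \<epsilon> r] unfolding fin_pts_def by (intro sum.subset_diff) auto
  moreover have "(\<Sum>(t, x)\<in>pts W \<epsilon> \<omega> - pts W r \<omega>. indicator A t * g t * x)
      = (\<Sum>(t, x)\<in>{(t, x)\<in>\<Xi> \<omega>. t \<in> A \<inter> W \<and> x \<in> band \<epsilon> r}. indicator A t * g t * x)"
    using fin assms unfolding fin_pts_def
    by (intro sum.mono_neutral_right) (auto simp: pts_def band_def indicator_def)
  moreover have "\<dots> = (\<Sum>(t, x)\<in>{(t, x)\<in>\<Xi> \<omega>. t \<in> A \<inter> W \<and> x \<in> band \<epsilon> r}. g t * x)"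
    by (intro sum.cong) auto
  ultimately have eq: "(\<Sum>(t, x)\<in>pts W \<epsilon> \<omega>. indicator A t * g t * x) =
     (\<Sum>(t, x)\<in>{(t, x)\<in>\<Xi> \<omega>. t \<in> A \<inter> W \<and> x \<in> band \<epsilon> r}. g t * x) + (\<Sum>(t, x)\<in>pts W r \<omega>. indicator A t * g t * x)"
    by (simp only:)
  have ring: "(a + b - i * (c + e)) - (b - i * e) = a - i * c" for a b c e i :: real
    by (simp add: algebra_simps)
  show ?thesis
    unfolding Yloc_def zsum_def eq comp_diff[OF assms(5,2,3,4)] by (rule ring)
qed

lemma small_integral_tendsto:
  assumes "integrable \<nu> u" "u 0 = (0::real)"
  shows "(\<lambda>n. \<integral>x. indicator {x. \<bar>x\<bar> < 1 / real (Suc n)} x * u x \<partial>\<nu>) \<longlonglongrightarrow> 0"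
proof -
  have [measurable]: "u \<in> borel_measurable \<nu>" using assms by auto
  have "(\<lambda>n. \<integral>x. indicator {x. \<bar>x\<bar> < 1 / real (Suc n)} x * u x \<partial>\<nu>) \<longlonglongrightarrow> (\<integral>x. 0 \<partial>\<nu>)"
  proof (rule integral_dominated_convergence[where w="\<lambda>x. norm (u x)"])
    have "(\<lambda>n. indicator {x. \<bar>x\<bar> < 1 / real (Suc n)} x * u x) \<longlonglongrightarrow> 0" for x :: real
    proof (cases "x = 0")
      case False
      then obtain N where N: "inverse (real (Suc N)) < \<bar>x\<bar>" using reals_Archimedean[of "\<bar>x\<bar>"] by auto
      have "indicator {x. \<bar>x\<bar> < 1 / real (Suc n)} x = (0::real)" if "n \<ge> N" for n
      proof -
        have "1 / real (Suc n) \<le> 1 / real (Suc N)" using that by (simp add: field_simps)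
        then show ?thesis using N by (simp add: inverse_eq_divide)
      qed
      then have "\<forall>\<^sub>F n in sequentially. indicator {x. \<bar>x\<bar> < 1 / real (Suc n)} x * u x = 0"
        unfolding eventually_sequentially by (intro exI[of _ N]) auto
      then show ?thesis by (rule tendsto_eventually)
    qed (simp add: assms)
    then show "AE x in \<nu>. (\<lambda>n. indicator {x. \<bar>x\<bar> < 1 / real (Suc n)} x * u x) \<longlonglongrightarrow> 0" by simp
    show "AE x in \<nu>. norm (indicator {x. \<bar>x\<bar> < 1 / real (Suc n)} x * u x) \<le> norm (u x)" for n
      by (intro AE_I2) (auto simp: indicator_def)
  qed (use assms in auto)
  then show ?thesis by simp
qed

lemma nn_sum_points:
  assumes "finite F" "F \<subseteq> \<Xi> \<omega>" "\<And>p. p \<in> F \<Longrightarrow> 0 \<le> v p" "\<And>p. p \<in> F \<Longrightarrow> ennreal (v p) \<le> u p"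
  shows "ennreal (\<Sum>p\<in>F. v p) \<le> (\<integral>\<^sup>+p. u p \<partial>count_space (\<Xi> \<omega>))"
proof -
  have "ennreal (\<Sum>p\<in>F. v p) = (\<Sum>p\<in>F. ennreal (v p))" using assms by (simp add: sum_ennreal)
  also have "\<dots> = (\<integral>\<^sup>+p. ennreal (v p) \<partial>count_space F)" using assms by (simp add: nn_integral_count_space_finite)
  also have "\<dots> \<le> (\<integral>\<^sup>+p. u p \<partial>count_space F)" using assms by (intro nn_integral_mono) auto
  also have "\<dots> = (\<integral>\<^sup>+p. u p * indicator F p \<partial>count_space (\<Xi> \<omega>))"
    using assms(2) by (subst nn_integral_count_space_indicator) 
      (auto simp: nn_integral_count_space_indicator intro!: nn_integral_cong split: split_indicator)
  also have "\<dots> \<le> (\<integral>\<^sup>+p. u p \<partial>count_space (\<Xi> \<omega>))"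
    by (intro nn_integral_mono) (auto simp: indicator_def)
  finally show ?thesis .
qed

text \<open>The jumps below \<open>r\<close> are bounded uniformly in \<open>A\<close> and
  \<open>\<epsilon>\<close>, either by the maximal inequality and their second moment, or by
  Campbell and Markov with their first moment. Both moments tend to \<open>0\<close> with
  \<open>r\<close>.\<close>

lemma Yloc_tail:
  assumes W: "W \<in> sets m" "emeasure m W < \<infinity>"
    and g: "integrable m g" "integrable m (\<lambda>t. (g t)\<^sup>2)" "\<And>t. t \<in> T - W \<Longrightarrow> g t = 0"
    and l: "l > 0" and \<delta>: "\<delta> > 0"
  shows "\<exists>B\<in>sets P. prob B \<le> \<delta> \<and> (\<forall>\<omega>\<in>space P - B. fin_pts W \<omega> \<longrightarrow>
    (\<exists>r>0. r \<le> 1 \<and> (\<forall>A\<in>\<A>. \<forall>\<epsilon>. 0 < \<epsilon> \<and> \<epsilon> \<le> r \<longrightarrow> \<bar>Yloc W g \<epsilon> A \<omega> - Yloc W g r A \<omega>\<bar> \<le> l)))"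
proof (cases "small_jumps_summable \<nu>")
  case False
  define a where "a n = maxc * ((\<integral>t. (g t)\<^sup>2 \<partial>m) * (LINT x:{x. \<bar>x\<bar> < 1 / real (Suc n)}|\<nu>. x\<^sup>2)) / l\<^sup>2" for n
  have "a \<longlonglongrightarrow> maxc * ((\<integral>t. (g t)\<^sup>2 \<partial>m) * 0) / l\<^sup>2"
    unfolding a_def set_lebesgue_integral_def real_scaleR_def
    by (intro tendsto_intros small_integral_tendsto integrable_\<nu>_sq) (use l in auto)
  then have "\<forall>\<^sub>F n in sequentially. a n < \<delta>" using \<delta> by (intro order_tendstoD(2)) auto
  then obtain n where n: "a n < \<delta>" by (auto simp: eventually_sequentially)
  define r where "r = 1 / real (Suc n)"
  have r: "0 < r" "r \<le> 1" unfolding r_def by (auto simp: field_simps)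
  obtain B where B: "B \<in> sets P" "prob B \<le> a n" "\<forall>\<omega>\<in>space P - B. \<forall>A\<in>\<A>. \<forall>\<epsilon>>0. \<bar>zsum W g r \<epsilon> A \<omega>\<bar> \<le> l"
    using levy_maximal[OF W g l, of r] unfolding a_def r_def by blast
  have "\<forall>\<omega>\<in>space P - B. fin_pts W \<omega> \<longrightarrow>
    (\<exists>r>0. r \<le> 1 \<and> (\<forall>A\<in>\<A>. \<forall>\<epsilon>. 0 < \<epsilon> \<and> \<epsilon> \<le> r \<longrightarrow> \<bar>Yloc W g \<epsilon> A \<omega> - Yloc W g r A \<omega>\<bar> \<le> l))"
    using B(3) r Yloc_diff[OF _ _ _ r(2) False] by (intro ballI impI exI[of _ r]) auto
  then show ?thesis using B(1,2) n by (intro bexI[of _ B]) auto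
next
  case True
  define v where "v x = indicator {x. \<bar>x\<bar> \<le> 1} x * \<bar>x\<bar>" for x :: real
  have v: "integrable \<nu> v"
  proof (rule integrableI_bounded)
    show "v \<in> borel_measurable \<nu>" unfolding v_def by measurable
    have "(\<integral>\<^sup>+x. ennreal (norm (v x)) \<partial>\<nu>) = (\<integral>\<^sup>+x\<in>{x. \<bar>x\<bar> \<le> 1}. ennreal \<bar>x\<bar> \<partial>\<nu>)"
      by (intro nn_integral_cong) (auto simp: v_def indicator_def)
    then show "(\<integral>\<^sup>+x. ennreal (norm (v x)) \<partial>\<nu>) < \<infinity>" using True unfolding small_jumps_summable_def by simp
  qed
  define a where "a n = ((\<integral>t. \<bar>g t\<bar> \<partial>m) * (\<integral>x. indicator {x. \<bar>x\<bar> < 1 / real (Suc n)} x * v x \<partial>\<nu>)) / l" for n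
  have "a \<longlonglongrightarrow> ((\<integral>t. \<bar>g t\<bar> \<partial>m) * 0) / l"
    unfolding a_def by (intro tendsto_intros small_integral_tendsto v) (use l in \<open>auto simp: v_def\<close>)
  then have "\<forall>\<^sub>F n in sequentially. a n < \<delta>" using \<delta> by (intro order_tendstoD(2)) auto
  then obtain n where n: "a n < \<delta>" by (auto simp: eventually_sequentially)
  define r where "r = 1 / real (Suc n)"
  have r: "0 < r" "r \<le> 1" unfolding r_def by (auto simp: field_simps)
  define k where "k x = indicator {x. \<bar>x\<bar> < r} x * v x" for x
  have k: "integrable \<nu> k" "\<And>x. k x \<ge> 0"
    unfolding k_def using integrable_real_mult_indicator[OF _ v, of "{x. \<bar>x\<bar> < r}"]
    by (auto simp: mult.commute v_def)
  define u where "u = (\<lambda>(t::'t, x). ennreal \<bar>g t\<bar> * ennreal (k x))"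
  have um[measurable]: "u \<in> borel_measurable (m \<Otimes>\<^sub>M \<nu>)"
    unfolding u_def using g(1) k(1) by measurable
  have "(\<integral>\<^sup>+p. u p \<partial>(m \<Otimes>\<^sub>M \<nu>)) = (\<integral>\<^sup>+t. ennreal \<bar>g t\<bar> \<partial>m) * (\<integral>\<^sup>+x. ennreal (k x) \<partial>\<nu>)"
    unfolding u_def
    by (intro m\<nu>.nn_integral_product measurable_compose[OF _ measurable_ennreal] borel_measurable_abs
        borel_measurable_integrable g(1) k(1))
  also have "\<dots> = ennreal (a n * l)"
  proof -
    have "a n * l = (\<integral>t. \<bar>g t\<bar> \<partial>m) * (\<integral>x. k x \<partial>\<nu>)" unfolding a_def k_def r_def using l by simp
    moreover have "(\<integral>\<^sup>+t. ennreal \<bar>g t\<bar> \<partial>m) = ennreal (\<integral>t. \<bar>g t\<bar> \<partial>m)"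
      using g(1) by (intro nn_integral_eq_integral) auto
    moreover have "(\<integral>\<^sup>+x. ennreal (k x) \<partial>\<nu>) = ennreal (\<integral>x. k x \<partial>\<nu>)"
      using k by (intro nn_integral_eq_integral) auto
    ultimately show ?thesis using k(2) by (simp add: ennreal_mult integral_nonneg_AE)
  qed
  finally have E: "(\<integral>\<^sup>+\<omega>. (\<integral>\<^sup>+p. u p \<partial>count_space (\<Xi> \<omega>)) \<partial>P) = ennreal (a n * l)"
    using Campbell[OF um] by simp
  define B where "B = {\<omega>\<in>space P. ennreal l < (\<integral>\<^sup>+p. u p \<partial>count_space (\<Xi> \<omega>))}"
  have an: "0 \<le> a n" unfolding a_def using l by (auto intro!: divide_nonneg_pos mult_nonneg_nonneg integral_nonneg_AE simp: v_def)
  have B: "B \<in> sets P" "prob B \<le> (a n * l) / l"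
    unfolding B_def using prob_Markov[OF conjunct1[OF Campbell[OF um]] l eq_refl[OF E]] an l by auto
  have "\<bar>Yloc W g \<epsilon> A \<omega> - Yloc W g r A \<omega>\<bar> \<le> l"
    if w: "\<omega> \<in> space P - B" and fin: "fin_pts W \<omega>" and \<epsilon>: "0 < \<epsilon>" "\<epsilon> \<le> r" for \<omega> A \<epsilon>
  proof -
    define F where "F = pts W \<epsilon> \<omega> - pts W r \<omega>"
    have F: "finite F" "F \<subseteq> \<Xi> \<omega>" using fin \<epsilon> unfolding F_def fin_pts_def by (auto simp: pts_def)
    have "(\<Sum>(t, x)\<in>pts W \<epsilon> \<omega>. indicator A t * g t * x) =
       (\<Sum>(t, x)\<in>F. indicator A t * g t * x) + (\<Sum>(t, x)\<in>pts W r \<omega>. indicator A t * g t * x)"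
      unfolding F_def using fin \<epsilon> pts_antimono[of \<epsilon> r] unfolding fin_pts_def by (intro sum.subset_diff) auto
    then have "\<bar>Yloc W g \<epsilon> A \<omega> - Yloc W g r A \<omega>\<bar> = \<bar>\<Sum>(t, x)\<in>F. indicator A t * g t * x\<bar>"
      unfolding Yloc_def compens_def using True by simp
    also have "\<dots> \<le> (\<Sum>p\<in>F. \<bar>case p of (t, x) \<Rightarrow> indicator A t * g t * x\<bar>)" by (rule sum_abs)
    also have "\<dots> \<le> l"
    proof -
      have "ennreal (\<Sum>p\<in>F. \<bar>case p of (t, x) \<Rightarrow> indicator A t * g t * x\<bar>) \<le> (\<integral>\<^sup>+p. u p \<partial>count_space (\<Xi> \<omega>))"
      proof (rule nn_sum_points[OF F])
        fix p assume p: "p \<in> F"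
        obtain t x where tx: "p = (t, x)" by (cases p)
        have "\<bar>x\<bar> < r" using p unfolding F_def tx pts_def by auto
        then have "k x = \<bar>x\<bar>" using r by (simp add: k_def v_def)
        then show "ennreal \<bar>case p of (t, x) \<Rightarrow> indicator A t * g t * x\<bar> \<le> u p"
          unfolding tx u_def by (auto simp: ennreal_mult[symmetric] abs_mult indicator_def intro!: ennreal_leI)
      qed auto
      also have "\<dots> \<le> ennreal l" using w unfolding B_def by auto
      finally show ?thesis using l by (simp add: ennreal_le_iff)
    qed
    finally show ?thesis .
  qed
  then show ?thesis using B n l r by (intro bexI[of _ B] conjI ballI impI exI[of _ r]) auto
qed

text \<open>The tail estimates for all levels \<open>1 / Suc k\<close> hold on one almost sure event
  that does not depend on \<open>A\<close>. The limits therefore exist for all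
  \<open>A \<subseteq> W\<close> at once and inherit the uniform rate.\<close>

lemma jump_integral_uniform:
  assumes W: "W \<in> sets m" "emeasure m W < \<infinity>"
    and f: "f \<in> borel_measurable m" "integrable m (\<lambda>t. (f t * indicator W t)\<^sup>2)"
  shows "AE \<omega> in P. fin_pts W \<omega> \<and>
    (\<forall>A\<in>\<A>. A \<subseteq> W \<longrightarrow> ((\<lambda>\<epsilon>. Yeps f \<epsilon> A \<omega>) \<longlongrightarrow> jump_integral m \<nu> \<Xi> f A \<omega>) (at_right 0)) \<and>
    (\<forall>\<eta>>0. \<exists>r>0. \<forall>A\<in>\<A>. A \<subseteq> W \<longrightarrow> (\<forall>\<epsilon>. 0 < \<epsilon> \<and> \<epsilon> \<le> r \<longrightarrow> \<bar>Yeps f \<epsilon> A \<omega> - jump_integral m \<nu> \<Xi> f A \<omega>\<bar> \<le> \<eta>))"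
proof -
  define g where "g t = f t * indicator W t" for t
  have g2: "integrable m (\<lambda>t. (g t)\<^sup>2)" using f(2) unfolding g_def .
  have g0: "g t = 0" if "t \<in> T - W" for t using that by (simp add: g_def)
  have g1: "integrable m g"
    using square_integrable_on_imp_integrable_on[OF W f] unfolding g_def[abs_def] .
  have "AE \<omega> in P. fin_pts W \<omega> \<longrightarrow> (\<exists>r>0. r \<le> 1 \<and> (\<forall>A\<in>\<A>. \<forall>\<epsilon>. 0 < \<epsilon> \<and> \<epsilon> \<le> r \<longrightarrow> \<bar>Yloc W g \<epsilon> A \<omega> - Yloc W g r A \<omega>\<bar> \<le> 1 / real (Suc k)))" for k
    by (rule AE_of_small_exceptions, rule Yloc_tail[OF W g1 g2 g0]) auto
  then have "AE \<omega> in P. \<forall>k. fin_pts W \<omega> \<longrightarrow> (\<exists>r>0. r \<le> 1 \<and> (\<forall>A\<in>\<A>. \<forall>\<epsilon>. 0 < \<epsilon> \<and> \<epsilon> \<le> r \<longrightarrow> \<bar>Yloc W g \<epsilon> A \<omega> - Yloc W g r A \<omega>\<bar> \<le> 1 / real (Suc k)))"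
    unfolding AE_all_countable ..
  then show ?thesis using AE_fin_pts[OF W]
  proof eventually_elim
    case (elim \<omega>)
    have Y: "Yeps f \<epsilon> A \<omega> = Yloc W g \<epsilon> A \<omega>" if "0 < \<epsilon>" "A \<subseteq> W" for \<epsilon> A
      unfolding g_def using Yeps_Yloc[OF elim(2) that] .
    have c: "\<exists>r>0. \<forall>A\<in>\<A>. A \<subseteq> W \<longrightarrow> (\<forall>\<epsilon>. 0 < \<epsilon> \<and> \<epsilon> \<le> r \<longrightarrow> \<bar>Yeps f \<epsilon> A \<omega> - Yeps f r A \<omega>\<bar> \<le> 1 / real (Suc k))" for k
    proof -
      obtain r where "r > 0" "\<forall>A\<in>\<A>. \<forall>\<epsilon>. 0 < \<epsilon> \<and> \<epsilon> \<le> r \<longrightarrow> \<bar>Yloc W g \<epsilon> A \<omega> - Yloc W g r A \<omega>\<bar> \<le> 1 / real (Suc k)"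
        using elim by blast
      then show ?thesis using Y by (intro exI[of _ r]) auto
    qed
    have lim: "((\<lambda>\<epsilon>. Yeps f \<epsilon> A \<omega>) \<longlongrightarrow> jump_integral m \<nu> \<Xi> f A \<omega>) (at_right 0)"
      "r > 0 \<Longrightarrow> (\<And>\<epsilon>. 0 < \<epsilon> \<Longrightarrow> \<epsilon> \<le> r \<Longrightarrow> \<bar>Yeps f \<epsilon> A \<omega> - Yeps f r A \<omega>\<bar> \<le> a) \<Longrightarrow> \<bar>jump_integral m \<nu> \<Xi> f A \<omega> - Yeps f r A \<omega>\<bar> \<le> a"
      if "A \<in> \<A>" "A \<subseteq> W" for A r a
    proof -
      have "\<exists>r>0. \<forall>\<epsilon>. 0 < \<epsilon> \<and> \<epsilon> \<le> r \<longrightarrow> \<bar>Yeps f \<epsilon> A \<omega> - Yeps f r A \<omega>\<bar> \<le> 1 / real (Suc k)" for k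
        using c[of k] that by blast
      note L = cauchy_at_right_0[where h="\<lambda>\<epsilon>. Yeps f \<epsilon> A \<omega>", OF this]
      show "((\<lambda>\<epsilon>. Yeps f \<epsilon> A \<omega>) \<longlongrightarrow> jump_integral m \<nu> \<Xi> f A \<omega>) (at_right 0)"
        unfolding jump_integral_Lim by (rule L(1))
      show "r > 0 \<Longrightarrow> (\<And>\<epsilon>. 0 < \<epsilon> \<Longrightarrow> \<epsilon> \<le> r \<Longrightarrow> \<bar>Yeps f \<epsilon> A \<omega> - Yeps f r A \<omega>\<bar> \<le> a) \<Longrightarrow> \<bar>jump_integral m \<nu> \<Xi> f A \<omega> - Yeps f r A \<omega>\<bar> \<le> a"
        unfolding jump_integral_Lim by (rule L(2))
    qed
    have "\<exists>r>0. \<forall>A\<in>\<A>. A \<subseteq> W \<longrightarrow> (\<forall>\<epsilon>. 0 < \<epsilon> \<and> \<epsilon> \<le> r \<longrightarrow> \<bar>Yeps f \<epsilon> A \<omega> - jump_integral m \<nu> \<Xi> f A \<omega>\<bar> \<le> \<eta>)"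
      if \<eta>: "\<eta> > 0" for \<eta>
    proof -
      obtain k where k: "inverse (real (Suc k)) < \<eta> / 2" using reals_Archimedean[of "\<eta>/2"] \<eta> by auto
      obtain r where r: "r > 0" "\<And>A \<epsilon>. A \<in> \<A> \<Longrightarrow> A \<subseteq> W \<Longrightarrow> 0 < \<epsilon> \<Longrightarrow> \<epsilon> \<le> r \<Longrightarrow> \<bar>Yeps f \<epsilon> A \<omega> - Yeps f r A \<omega>\<bar> \<le> 1 / real (Suc k)"
        using c[of k] by blast
      have "\<bar>Yeps f \<epsilon> A \<omega> - jump_integral m \<nu> \<Xi> f A \<omega>\<bar> \<le> \<eta>" if A: "A \<in> \<A>" "A \<subseteq> W" and \<epsilon>: "0 < \<epsilon>" "\<epsilon> \<le> r" for A \<epsilon>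
      proof -
        have "\<bar>jump_integral m \<nu> \<Xi> f A \<omega> - Yeps f r A \<omega>\<bar> \<le> 1 / real (Suc k)"
          by (rule lim(2)[OF A r(1)]) (use r(2) A in auto)
        then show ?thesis using r(2)[OF A \<epsilon>] k by (simp add: inverse_eq_divide)
      qed
      then show ?thesis using r(1) by blast
    qed
    then show ?case using elim(2) lim(1) by blast
  qed
qed

end

section \<open>Fractional moments\<close>

text \<open>A share \<open>z / s\<close> of \<open>s = x + y\<close> lies in the unit interval,
  hence is at most \<open>(z / s) powr b\<close>; the two shares add up to \<open>1\<close>.\<close>

lemma powr_add_le:
  fixes x y :: real
  assumes "0 \<le> x" "0 \<le> y" "0 < b" "b \<le> 1"
  shows "(x + y) powr b \<le> x powr b + y powr b"
proof (cases "x + y = 0")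
  case False
  define s where "s = x + y"
  have s: "s > 0" using assms False by (simp add: s_def)
  have part: "s powr b * (z / s) \<le> z powr b" if z: "0 \<le> z" "z \<le> s" for z
  proof (cases "z = 0")
    case False
    have "z / s = (z / s) powr 1" using z s False by simp
    also have "\<dots> \<le> (z / s) powr b" using z s False assms by (intro powr_mono') auto
    finally have "s powr b * (z / s) \<le> s powr b * (z / s) powr b" by (intro mult_left_mono) auto
    also have "\<dots> = z powr b" using z s False by (simp add: powr_divide)
    finally show ?thesis .
  qed simp
  have "s powr b = s powr b * (x / s) + s powr b * (y / s)"
    using s by (simp add: s_def field_simps flip: distrib_left add_divide_distrib)
  also have "\<dots> \<le> x powr b + y powr b" using assms by (intro add_mono part) (auto simp: s_def)
  finally show ?thesis by (simp add: s_def)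
qed (use assms in simp)

lemma powr_sum_le:
  fixes y :: "'a \<Rightarrow> real"
  assumes "finite F" "\<And>p. p \<in> F \<Longrightarrow> 0 \<le> y p" "0 < b" "b \<le> 1"
  shows "(\<Sum>p\<in>F. y p) powr b \<le> (\<Sum>p\<in>F. y p powr b)"
  using assms(1,2)
proof (induction F rule: finite_induct)
  case (insert p F)
  have "(y p + (\<Sum>p\<in>F. y p)) powr b \<le> y p powr b + (\<Sum>p\<in>F. y p) powr b"
    using insert assms by (intro powr_add_le) (auto intro: sum_nonneg)
  also have "\<dots> \<le> y p powr b + (\<Sum>p\<in>F. y p powr b)" using insert by auto
  finally show ?case using insert by simp
qed simp

text \<open>Evaluates the estimates at the threshold \<open>l / K\<close>: the first moment above it
  (\<open>a = 1\<close>) and the second moment below it (\<open>a = 2\<close>) lead to the same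
  power \<open>(K / l) powr b\<close>.\<close>

lemma powr_ratio_identity:
  fixes K l b a :: real
  assumes "K > 0" "l > 0"
  shows "(K / l) powr a * (l / K) powr (a - b) = (K / l) powr b"
proof -
  have "(l / K) powr (a - b) = (K / l) powr (b - a)"
    using assms by (simp add: powr_divide powr_diff field_simps)
  then show ?thesis using assms by (simp add: powr_add[symmetric])
qed

context levy
begin

text \<open>Factor \<open>|x| powr b\<close> out of \<open>|x|\<close> or \<open>x\<^sup>2\<close>;
  the remaining power is monotone in \<open>|x|\<close> and bounded by its value at
  \<open>r\<close>.\<close>

lemma moment_bounds:
  assumes b: "integrable \<nu> (\<lambda>x. \<bar>x\<bar> powr b)" and r: "r > 0"
  shows "1 \<le> b \<Longrightarrow> (LINT x:{x. r \<le> \<bar>x\<bar>}|\<nu>. \<bar>x\<bar>) \<le> r powr (1 - b) * (LINT x|\<nu>. \<bar>x\<bar> powr b)"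
    "b \<le> 2 \<Longrightarrow> (LINT x:{x. \<bar>x\<bar> < r}|\<nu>. x\<^sup>2) \<le> r powr (2 - b) * (LINT x|\<nu>. \<bar>x\<bar> powr b)"
    "integrable \<nu> (\<lambda>x. indicator {x. r \<le> \<bar>x\<bar>} x * \<bar>x\<bar>)"
proof -
  show int1: "integrable \<nu> (\<lambda>x. indicator {x. r \<le> \<bar>x\<bar>} x * \<bar>x\<bar>)"
  proof (rule Bochner_Integration.integrable_bound)
    show "integrable \<nu> (\<lambda>x. x\<^sup>2 / r)" using integrable_\<nu>_sq by simp
    have "\<bar>x\<bar> \<le> x\<^sup>2 / r" if "r \<le> \<bar>x\<bar>" for x
    proof -
      have "\<bar>x\<bar> * r \<le> \<bar>x\<bar> * \<bar>x\<bar>" using that by (intro mult_left_mono) auto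
      then show ?thesis using r by (simp add: field_simps power2_eq_square)
    qed
    then show "AE x in \<nu>. norm (indicator {x. r \<le> \<bar>x\<bar>} x * \<bar>x\<bar>) \<le> norm (x\<^sup>2 / r)"
      using r by (intro AE_I2) (auto simp: indicator_def)
  qed measurable
  have split: "\<bar>x\<bar> powr c = \<bar>x\<bar> powr (c - b) * \<bar>x\<bar> powr b" if "x \<noteq> 0" for x c :: real
    using that by (simp add: powr_add[symmetric])
  show "(LINT x:{x. r \<le> \<bar>x\<bar>}|\<nu>. \<bar>x\<bar>) \<le> r powr (1 - b) * (LINT x|\<nu>. \<bar>x\<bar> powr b)" if "1 \<le> b"
  proof -
    have pt: "\<bar>x\<bar> \<le> r powr (1 - b) * \<bar>x\<bar> powr b" if "r \<le> \<bar>x\<bar>" for x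
    proof -
      have x: "x \<noteq> 0" using that r by auto
      have "\<bar>x\<bar> = \<bar>x\<bar> powr (1 - b) * \<bar>x\<bar> powr b" using split[OF x, of 1] by simp
      also have "\<dots> \<le> r powr (1 - b) * \<bar>x\<bar> powr b"
        using that r \<open>1 \<le> b\<close> by (intro mult_right_mono powr_mono2') auto
      finally show ?thesis .
    qed
    have "(LINT x:{x. r \<le> \<bar>x\<bar>}|\<nu>. \<bar>x\<bar>) \<le> (\<integral>x. r powr (1 - b) * \<bar>x\<bar> powr b \<partial>\<nu>)"
      unfolding set_lebesgue_integral_def real_scaleR_def using b pt
      by (intro integral_mono int1) (auto simp: indicator_def)
    then show ?thesis by simp
  qed
  show "(LINT x:{x. \<bar>x\<bar> < r}|\<nu>. x\<^sup>2) \<le> r powr (2 - b) * (LINT x|\<nu>. \<bar>x\<bar> powr b)" if "b \<le> 2"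
  proof -
    have pt: "x\<^sup>2 \<le> r powr (2 - b) * \<bar>x\<bar> powr b" if "\<bar>x\<bar> < r" for x
    proof (cases "x = 0")
      case False
      have "x\<^sup>2 = \<bar>x\<bar> powr 2" using False by (simp add: powr_numeral)
      also have "\<dots> = \<bar>x\<bar> powr (2 - b) * \<bar>x\<bar> powr b" by (rule split[OF False])
      also have "\<dots> \<le> r powr (2 - b) * \<bar>x\<bar> powr b"
        using that r \<open>b \<le> 2\<close> by (intro mult_right_mono powr_mono2) auto
      finally show ?thesis .
    qed simp
    have "(LINT x:{x. \<bar>x\<bar> < r}|\<nu>. x\<^sup>2) \<le> (\<integral>x. r powr (2 - b) * \<bar>x\<bar> powr b \<partial>\<nu>)"
      unfolding set_lebesgue_integral_def real_scaleR_def using b pt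
      by (intro integral_mono integrable_real_mult_indicator[OF _ integrable_\<nu>_sq, simplified mult.commute]) (auto simp: indicator_def)
    then show ?thesis by simp
  qed
qed

lemma sum_points_le:
  assumes "fin_pts E \<omega>" "\<epsilon> > 0" "\<And>t x. (t, x) \<in> pts E \<epsilon> \<omega> \<Longrightarrow> ennreal (v (t, x)) \<le> u (t, x)" "\<And>p. 0 \<le> v p"
  shows "ennreal (\<Sum>p\<in>pts E \<epsilon> \<omega>. v p) \<le> (\<integral>\<^sup>+p. u p \<partial>count_space (\<Xi> \<omega>))"
proof (rule nn_sum_points)
  show "finite (pts E \<epsilon> \<omega>)" using assms unfolding fin_pts_def by auto
  show "pts E \<epsilon> \<omega> \<subseteq> \<Xi> \<omega>" unfolding pts_def by auto
qed (use assms in auto)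

lemma point_sum_Markov:
  assumes E: "E \<in> sets m" "emeasure m E < \<infinity>" and k: "integrable \<nu> k" "\<And>x. 0 \<le> k x" and l: "l > 0"
  defines "u \<equiv> (\<lambda>(t, x). indicator E t * ennreal (k x))"
  shows "\<exists>B\<in>sets P. prob B \<le> measure m E * (LINT x|\<nu>. k x) / l \<and>
    (\<forall>\<omega>\<in>space P - B. (\<integral>\<^sup>+p. u p \<partial>count_space (\<Xi> \<omega>)) \<le> ennreal l)"
proof -
  have [measurable]: "k \<in> borel_measurable \<nu>" using k by auto
  note [measurable] = E(1)
  have um: "u \<in> borel_measurable (m \<Otimes>\<^sub>M \<nu>)" unfolding u_def by measurable
  have "(\<integral>\<^sup>+p. u p \<partial>(m \<Otimes>\<^sub>M \<nu>)) = (\<integral>\<^sup>+t. indicator E t \<partial>m) * (\<integral>\<^sup>+x. ennreal (k x) \<partial>\<nu>)"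
    unfolding u_def by (intro m\<nu>.nn_integral_product) measurable
  also have "(\<integral>\<^sup>+x. ennreal (k x) \<partial>\<nu>) = ennreal (LINT x|\<nu>. k x)"
    using k by (intro nn_integral_eq_integral) auto
  also have "(\<integral>\<^sup>+t. indicator E t \<partial>m) = ennreal (measure m E)"
    using E by (simp add: emeasure_eq_ennreal_measure)
  also have "ennreal (measure m E) * ennreal (LINT x|\<nu>. k x) = ennreal (measure m E * (LINT x|\<nu>. k x))"
    using k by (simp add: ennreal_mult integral_nonneg_AE)
  finally have Eq: "(\<integral>\<^sup>+\<omega>. (\<integral>\<^sup>+p. u p \<partial>count_space (\<Xi> \<omega>)) \<partial>P) = ennreal (measure m E * (LINT x|\<nu>. k x))"
    using Campbell[OF um] by simp
  have nn: "0 \<le> measure m E * (LINT x|\<nu>. k x)" using k by (simp add: integral_nonneg_AE)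
  let ?B = "{\<omega>\<in>space P. ennreal l < (\<integral>\<^sup>+p. u p \<partial>count_space (\<Xi> \<omega>))}"
  note M = prob_Markov[OF conjunct1[OF Campbell[OF um]] l eq_refl[OF Eq]]
  show ?thesis using M(1) M(2)[OF nn] by (intro bexI[of _ ?B]) auto
qed

text \<open>
  In the compensated case the jumps are split at \<open>r = min 1 (l/K)\<close>, which balances the first
  moment of the large jumps against the second moment of the small ones.
\<close>

lemma Yloc_maximal:
  assumes b: "0 < b" "integrable \<nu> (\<lambda>x. \<bar>x\<bar> powr b)"
    "small_jumps_summable \<nu> \<Longrightarrow> b \<le> 1" "\<not> small_jumps_summable \<nu> \<Longrightarrow> 1 \<le> b \<and> b \<le> 2"
    and E: "E \<in> sets m" "emeasure m E < \<infinity>"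
    and g: "g \<in> borel_measurable m" "\<And>t. \<bar>g t\<bar> \<le> K" "\<And>t. t \<notin> E \<Longrightarrow> g t = 0"
    and K: "K > 0" and l: "l > 0"
  shows "\<exists>B\<in>sets P. prob B \<le> (1 + maxc) * (LINT x|\<nu>. \<bar>x\<bar> powr b) * measure m E * ((K / l) powr b + (K / l) powr (min b 1)) \<and>
    (\<forall>\<omega>\<in>space P - B. fin_pts E \<omega> \<longrightarrow> (\<forall>A\<in>\<A>. \<forall>\<epsilon>>0. \<bar>Yloc E g \<epsilon> A \<omega>\<bar> \<le> 3 * l))"
proof (cases "small_jumps_summable \<nu>")
  case True
  then have b1: "b \<le> 1" using b by simp
  define I where "I = (LINT x|\<nu>. \<bar>x\<bar> powr b)"
  have I: "I \<ge> 0" unfolding I_def by (simp add: integral_nonneg_AE)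
  define k where "k x = K powr b * \<bar>x\<bar> powr b" for x :: real
  have k: "integrable \<nu> k" "\<And>x. 0 \<le> k x" "(LINT x|\<nu>. k x) = K powr b * I" using b by (auto simp: k_def[abs_def] I_def)
  obtain B where B: "B \<in> sets P" "prob B \<le> measure m E * (K powr b * I) / l powr b"
    "\<And>\<omega>. \<omega> \<in> space P - B \<Longrightarrow> (\<integral>\<^sup>+p. (case p of (t, x) \<Rightarrow> indicator E t * ennreal (k x)) \<partial>count_space (\<Xi> \<omega>)) \<le> ennreal (l powr b)"
    using point_sum_Markov[OF E k(1,2), of "l powr b"] l unfolding k(3) by auto
  have "prob B \<le> I * measure m E * (K / l) powr b" using B(2) K l by (simp add: powr_divide mult_ac)
  also have "\<dots> \<le> (1 + maxc) * I * measure m E * ((K / l) powr b + (K / l) powr (min b 1))"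
  proof -
    have "1 * (I * measure m E * (K / l) powr b) \<le> (1 + maxc) * (I * measure m E * ((K / l) powr b + (K / l) powr (min b 1)))"
      using I maxc_pos by (intro mult_mono mult_nonneg_nonneg) auto
    then show ?thesis by (simp add: mult_ac)
  qed
  finally have pB: "prob B \<le> (1 + maxc) * I * measure m E * ((K / l) powr b + (K / l) powr (min b 1))" .
  have "\<bar>Yloc E g \<epsilon> A \<omega>\<bar> \<le> 3 * l"
    if w: "\<omega> \<in> space P - B" and fin: "fin_pts E \<omega>" and \<epsilon>: "\<epsilon> > 0" for \<omega> A \<epsilon>
  proof -
    let ?y = "\<lambda>p. \<bar>case p of (t, x) \<Rightarrow> indicator A t * g t * x\<bar>"
    define S where "S = (\<Sum>p\<in>pts E \<epsilon> \<omega>. ?y p)"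
    have finp: "finite (pts E \<epsilon> \<omega>)" using fin \<epsilon> unfolding fin_pts_def by auto
    have "\<bar>Yloc E g \<epsilon> A \<omega>\<bar> \<le> S" unfolding Yloc_def compens_def S_def using True by simp
    moreover have "S powr b \<le> l powr b"
    proof -
      have "S powr b \<le> (\<Sum>p\<in>pts E \<epsilon> \<omega>. ?y p powr b)" unfolding S_def using b b1 finp by (intro powr_sum_le) auto
      moreover have "ennreal (\<Sum>p\<in>pts E \<epsilon> \<omega>. ?y p powr b) \<le> (\<integral>\<^sup>+p. (case p of (t, x) \<Rightarrow> indicator E t * ennreal (k x)) \<partial>count_space (\<Xi> \<omega>))"
      proof (rule sum_points_le[OF fin \<epsilon>])
        fix t x assume "(t, x) \<in> pts E \<epsilon> \<omega>"
        then have t: "t \<in> E" by (auto simp: pts_def)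
        have "\<bar>indicator A t * g t * x\<bar> \<le> K * \<bar>x\<bar>"
          using g(2)[of t] K by (auto simp: abs_mult indicator_def intro!: mult_right_mono mult_nonneg_nonneg)
        then have "\<bar>indicator A t * g t * x\<bar> powr b \<le> (K * \<bar>x\<bar>) powr b" using b by (intro powr_mono2) auto
        also have "\<dots> = k x" using K by (simp add: k_def powr_mult)
        finally show "ennreal (?y (t, x) powr b) \<le> (case (t, x) of (t, x) \<Rightarrow> indicator E t * ennreal (k x))"
          using t by (auto intro: ennreal_leI)
      qed simp
      ultimately have "ennreal (S powr b) \<le> ennreal (l powr b)" using B(3)[OF w] by (meson ennreal_leI order_trans)
      then show ?thesis using l by (simp add: ennreal_le_iff)
    qed
    moreover have "S \<le> l"
    proof (rule ccontr)
      assume "\<not> S \<le> l"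
      then have "l powr b < S powr b" using l b by (intro powr_less_mono2) auto
      then show False using \<open>S powr b \<le> l powr b\<close> by simp
    qed
    ultimately show ?thesis using l by simp
  qed
  then show ?thesis using B(1) pB unfolding I_def by blast
next
  case False
  then have b1: "1 \<le> b" "b \<le> 2" using b by auto
  define I where "I = (LINT x|\<nu>. \<bar>x\<bar> powr b)"
  have I: "I \<ge> 0" unfolding I_def by (simp add: integral_nonneg_AE)
  \<comment> \<open>The cap at \<open>1\<close> is where compensation ends, as
    \<open>Yloc_diff\<close> requires. When it is active, the linear term \<open>K / l\<close> of
    \<open>R\<close> takes over.\<close>
  define r where "r = min 1 (l / K)"
  have r: "0 < r" "r \<le> 1" unfolding r_def using l K by auto
  define R where "R = (K / l) powr b + (K / l) powr (min b 1)"
  have min1: "(K / l) powr (min b 1) = K / l" using b1 K l by (simp add: min_def)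
  have R1: "K / l * r powr (1 - b) \<le> R"
  proof (cases "l / K \<le> 1")
    case True
    then have "K / l * r powr (1 - b) = (K / l) powr b"
      using powr_ratio_identity[OF K l, of 1 b] K l by (simp add: r_def min_def)
    then show ?thesis unfolding R_def by simp
  next
    case False
    then have "r = 1" by (simp add: r_def)
    then show ?thesis unfolding R_def min1 by simp
  qed
  have R2: "(K / l)\<^sup>2 * r powr (2 - b) \<le> R"
  proof (cases "l / K \<le> 1")
    case True
    then have "(K / l) powr 2 * r powr (2 - b) = (K / l) powr b"
      using powr_ratio_identity[OF K l, of 2 b] by (simp add: r_def min_def)
    then show ?thesis unfolding R_def using K l by (simp add: powr_numeral)
  next
    case False
    then have 1: "r = 1" and "K / l \<le> 1" using K l by (auto simp: r_def field_simps)
    then have "(K / l) * (K / l) \<le> (K / l) * 1" using K l by (intro mult_left_mono) auto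
    then show ?thesis unfolding R_def min1 1 by (simp add: power2_eq_square) (smt (verit) powr_ge_zero)
  qed
  define J where "J = (LINT x:{x. r \<le> \<bar>x\<bar>}|\<nu>. \<bar>x\<bar>)"
  have J: "0 \<le> J" "J \<le> r powr (1 - b) * I"
    unfolding J_def I_def using moment_bounds(1)[OF b(2) r(1) b1(1)] by (auto simp: set_lebesgue_integral_def intro!: integral_nonneg_AE)
  define k where "k x = K * (indicator {x. r \<le> \<bar>x\<bar>} x * \<bar>x\<bar>)" for x :: real
  have k: "integrable \<nu> k" "\<And>x. 0 \<le> k x" "(LINT x|\<nu>. k x) = K * J"
    using moment_bounds(3)[OF b(2) r(1)] K by (auto simp: k_def[abs_def] J_def set_lebesgue_integral_def)
  obtain B1 where B1: "B1 \<in> sets P" "prob B1 \<le> measure m E * (K * J) / l"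
    "\<And>\<omega>. \<omega> \<in> space P - B1 \<Longrightarrow> (\<integral>\<^sup>+p. (case p of (t, x) \<Rightarrow> indicator E t * ennreal (k x)) \<partial>count_space (\<Xi> \<omega>)) \<le> ennreal l"
    using point_sum_Markov[OF E k(1,2) l] unfolding k(3) by auto
  have p1: "measure m E * (K * J) / l \<le> I * measure m E * R"
  proof -
    have "measure m E * (K * J) / l = measure m E * (K / l * J)" by simp
    also have "\<dots> \<le> measure m E * (K / l * (r powr (1 - b) * I))" using J K l by (intro mult_left_mono) auto
    also have "\<dots> = measure m E * I * (K / l * r powr (1 - b))" by (simp add: mult_ac)
    also have "\<dots> \<le> measure m E * I * R" using I R1 by (intro mult_left_mono) auto
    finally show ?thesis by (simp add: mult_ac)
  qed
  have gE: "\<bar>g t\<bar> \<le> K * indicator E t" for t using g(2)[of t] g(3)[of t] by (auto simp: indicator_def)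
  have intE: "integrable m (\<lambda>t. a * indicator E t :: real)" "(\<integral>t. a * indicator E t \<partial>m) = a * measure m E" for a
    using E by (auto simp: less_top Int_absorb2 sets.sets_into_space)
  have g1: "integrable m g"
    using gE K by (intro Bochner_Integration.integrable_bound[OF intE(1)[of K] g(1)] AE_I2) auto
  have g2E: "(g t)\<^sup>2 \<le> K\<^sup>2 * indicator E t" for t
    using g(2)[of t] g(3)[of t] K by (auto simp: indicator_def abs_le_square_iff[symmetric])
  have g2: "integrable m (\<lambda>t. (g t)\<^sup>2)"
    using g2E g(1) K by (intro Bochner_Integration.integrable_bound[OF intE(1)[of "K\<^sup>2"]] AE_I2) auto
  have g2le: "(\<integral>t. (g t)\<^sup>2 \<partial>m) \<le> K\<^sup>2 * measure m E"
    unfolding intE(2)[symmetric] by (intro integral_mono g2 intE g2E)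
  have g0: "g t = 0" if "t \<in> T - E" for t using g(3) that by simp
  obtain B2 where B2: "B2 \<in> sets P"
    "prob B2 \<le> maxc * ((\<integral>t. (g t)\<^sup>2 \<partial>m) * (LINT x:{x. \<bar>x\<bar> < r}|\<nu>. x\<^sup>2)) / l\<^sup>2"
    "\<forall>\<omega>\<in>space P - B2. \<forall>A\<in>\<A>. \<forall>\<epsilon>>0. \<bar>zsum E g r \<epsilon> A \<omega>\<bar> \<le> l"
    using levy_maximal[OF E g1 g2 g0 l, of r] by blast
  have p2: "prob B2 \<le> maxc * I * measure m E * R"
  proof -
    have "(\<integral>t. (g t)\<^sup>2 \<partial>m) * (LINT x:{x. \<bar>x\<bar> < r}|\<nu>. x\<^sup>2) \<le> (K\<^sup>2 * measure m E) * (r powr (2 - b) * I)"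
      unfolding I_def using moment_bounds(2)[OF b(2) r(1) b1(2)] g2le
      by (intro mult_mono) (auto simp: set_lebesgue_integral_def intro!: integral_nonneg_AE)
    then have "prob B2 \<le> maxc * ((K\<^sup>2 * measure m E) * (r powr (2 - b) * I)) / l\<^sup>2"
      using maxc_pos by (intro order_trans[OF B2(2)] divide_right_mono mult_left_mono) auto
    also have "\<dots> = maxc * I * measure m E * ((K / l)\<^sup>2 * r powr (2 - b))"
      by (simp add: power_divide mult_ac)
    also have "\<dots> \<le> maxc * I * measure m E * R" using maxc_pos I R2 by (intro mult_left_mono) auto
    finally show ?thesis .
  qed
  show ?thesis
  \<comment> \<open>This product bounds the compensator of the large jumps. If it exceeds
    \<open>l\<close>, the claimed probability bound is at least \<open>1\<close> and the whole space
    serves as exceptional set.\<close>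
  proof (cases "measure m E * (K * J) \<le> l")
    case big: False
    then have "1 \<le> measure m E * (K * J) / l" using l by simp
    also have "\<dots> \<le> I * measure m E * R" by (rule p1)
    also have "\<dots> \<le> (1 + maxc) * (I * measure m E * R)"
      using maxc_pos I by (simp add: distrib_right R_def)
    finally have "prob (space P) \<le> (1 + maxc) * I * measure m E * R" by (simp add: prob_space mult_ac)
    then show ?thesis unfolding R_def I_def by (intro bexI[of _ "space P"]) auto
  next
    case small: True
    have "prob (B1 \<union> B2) \<le> prob B1 + prob B2" using B1(1) B2(1) by (rule measure_Un_le)
    also have "\<dots> \<le> (1 + maxc) * I * measure m E * R"
      using B1(2) p1 p2 by (simp add: algebra_simps)
    finally have pB: "prob (B1 \<union> B2) \<le> (1 + maxc) * I * measure m E * R" .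
    \<comment> \<open>One \<open>l\<close> for the sum of the large jumps and one for their
      compensator; the small jumps add the third.\<close>
    have large: "\<bar>Yloc E g \<epsilon> A \<omega>\<bar> \<le> 2 * l"
      if w: "\<omega> \<in> space P - B1" and fin: "fin_pts E \<omega>" and \<epsilon>: "r \<le> \<epsilon>" and A: "A \<in> \<A>" for \<omega> A \<epsilon>
    proof -
      have e0: "\<epsilon> > 0" using \<epsilon> r by simp
      let ?y = "\<lambda>p. \<bar>case p of (t, x) \<Rightarrow> indicator A t * g t * x\<bar>"
      have "ennreal (\<Sum>p\<in>pts E \<epsilon> \<omega>. ?y p) \<le> (\<integral>\<^sup>+p. (case p of (t, x) \<Rightarrow> indicator E t * ennreal (k x)) \<partial>count_space (\<Xi> \<omega>))"
      proof (rule sum_points_le[OF fin e0])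
        fix t x assume "(t, x) \<in> pts E \<epsilon> \<omega>"
        then have t: "t \<in> E" "r \<le> \<bar>x\<bar>" using \<epsilon> by (auto simp: pts_def)
        have "\<bar>indicator A t * g t * x\<bar> \<le> K * \<bar>x\<bar>"
          using g(2)[of t] K by (auto simp: abs_mult indicator_def intro!: mult_right_mono mult_nonneg_nonneg)
        then show "ennreal (?y (t, x)) \<le> (case (t, x) of (t, x) \<Rightarrow> indicator E t * ennreal (k x))"
          using t by (auto simp: k_def intro: ennreal_leI)
      qed simp
      also have "\<dots> \<le> ennreal l" by (rule B1(3)[OF w])
      finally have 1: "(\<Sum>p\<in>pts E \<epsilon> \<omega>. ?y p) \<le> l" using l by (simp add: ennreal_le_iff)
      have 2: "\<bar>compens \<epsilon>\<bar> \<le> J"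
      proof -
        have "\<bar>compens \<epsilon>\<bar> \<le> (\<integral>x. \<bar>indicator {x. \<epsilon> \<le> \<bar>x\<bar> \<and> \<bar>x\<bar> \<le> 1} x * x\<bar> \<partial>\<nu>)"
          unfolding compens_def set_lebesgue_integral_def using False by simp
        also have "\<dots> \<le> J"
          unfolding J_def set_lebesgue_integral_def real_scaleR_def using \<epsilon>
          by (intro integral_mono moment_bounds(3)[OF b(2) r(1)] integrable_abs integrable_\<nu>_01 e0) (auto simp: indicator_def)
        finally show ?thesis .
      qed
      have 3: "\<bar>LINT t:A|m. g t\<bar> \<le> K * measure m E"
      proof -
        have iA: "integrable m (\<lambda>t. indicator A t * g t)"
          using integrable_real_mult_indicator[OF \<A>_sets[OF A] g1] by (simp add: mult.commute)
        have "\<bar>LINT t:A|m. g t\<bar> \<le> (\<integral>t. \<bar>indicator A t * g t\<bar> \<partial>m)"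
          unfolding set_lebesgue_integral_def by simp
        also have "\<dots> \<le> (\<integral>t. K * indicator E t \<partial>m)"
          using g(2,3) K by (intro integral_mono integrable_abs iA intE(1)) (auto simp: indicator_def abs_mult)
        finally show ?thesis unfolding intE(2) .
      qed
      have "\<bar>(LINT t:A|m. g t) * compens \<epsilon>\<bar> \<le> (K * measure m E) * J"
        unfolding abs_mult using 2 3 K by (intro mult_mono) auto
      then have 4: "\<bar>(LINT t:A|m. g t) * compens \<epsilon>\<bar> \<le> l" using small by (simp add: mult_ac)
      have "\<bar>\<Sum>(t, x)\<in>pts E \<epsilon> \<omega>. indicator A t * g t * x\<bar> \<le> l" using sum_abs 1 by (rule order_trans)
      then show ?thesis using 4 unfolding Yloc_def by linarith
    qed
    have "\<bar>Yloc E g \<epsilon> A \<omega>\<bar> \<le> 3 * l"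
      if w: "\<omega> \<in> space P - (B1 \<union> B2)" and fin: "fin_pts E \<omega>" and A: "A \<in> \<A>" and e0: "\<epsilon> > 0" for \<omega> A \<epsilon>
    proof (cases "r \<le> \<epsilon>")
      case True
      then show ?thesis using large[OF _ fin True A] w l by fastforce
    next
      case e: False
      have "Yloc E g \<epsilon> A \<omega> - Yloc E g r A \<omega> = zsum E g r \<epsilon> A \<omega>"
        by (rule Yloc_diff[OF fin e0 _ r(2) False]) (use e in simp)
      moreover have "\<bar>zsum E g r \<epsilon> A \<omega>\<bar> \<le> l" using B2(3) w A e0 by blast
      moreover have "\<bar>Yloc E g r A \<omega>\<bar> \<le> 2 * l" using large[OF _ fin order_refl A] w by blast
      ultimately show ?thesis by linarith
    qed
    then show ?thesis using B1(1) B2(1) pB unfolding R_def I_def by (intro bexI[of _ "B1 \<union> B2"]) auto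
  qed
qed

end

section \<open>Lower bound for the exponent\<close>

lemma bdd_ratio:
  fixes a :: ennreal
  assumes "a / ennreal y \<le> ennreal C" "y > 0" "C \<ge> 0"
  shows "a \<le> ennreal (C * y)"
proof -
  have "a = a / ennreal y * ennreal y"
    using assms(2) by (cases a) (auto simp: divide_ennreal ennreal_mult[symmetric] top_ennreal.rep_eq ennreal_top_divide ennreal_top_mult)
  also have "\<dots> \<le> ennreal C * ennreal y" using assms(1) by (intro mult_right_mono) auto
  finally show ?thesis using assms by (simp add: ennreal_mult)
qed

lemma ennpow_mono:
  assumes "x \<le> ennreal \<rho>" "\<rho> > 0" "\<alpha> \<ge> 0"
  shows "ennpow x \<alpha> \<le> ennreal (\<rho> powr \<alpha>)"
proof (cases "\<alpha> = 0")
  case False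
  have "x \<noteq> \<infinity>" using assms(1) by (auto simp: top_unique)
  moreover have "enn2real x \<le> \<rho>" using assms by (metis enn2real_mono enn2real_ennreal ennreal_less_top less_imp_le)
  ultimately show ?thesis using False assms unfolding ennpow_def
    by (auto intro!: ennreal_leI powr_mono2)
qed (use assms in \<open>auto simp: ennpow_def\<close>)

lemma dyadic_bracket:
  fixes \<rho> s :: real
  assumes "0 < \<rho>" "\<rho> < s * (1/2)^N"
  shows "\<exists>n\<ge>N. s * (1/2)^(Suc n) \<le> \<rho> \<and> \<rho> < s * (1/2)^n"
proof -
  have "0 < s * (1/2)^N" using assms by linarith
  then have s: "s > 0" by (simp add: zero_less_mult_iff)
  have ex: "\<exists>k. s * (1/2)^k \<le> \<rho>"
  proof -
    obtain k where "(1/2)^k < \<rho> / s" using real_arch_pow_inv[of "\<rho> / s" "1/2"] assms s by auto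
    then show ?thesis using s by (intro exI[of _ k]) (simp add: field_simps)
  qed
  define k where "k = (LEAST k. s * (1/2)^k \<le> \<rho>)"
  have k: "s * (1/2)^k \<le> \<rho>" unfolding k_def by (rule LeastI_ex[OF ex])
  have "N < k"
  proof (rule ccontr)
    assume "\<not> N < k"
    then have "(1/2)^N \<le> (1/2::real)^k" by (intro power_decreasing) auto
    then have "s * (1/2)^N \<le> s * (1/2)^k" using s by simp
    then show False using k assms by simp
  qed
  then obtain n where n: "k = Suc n" by (cases k) auto
  have "\<not> s * (1/2)^n \<le> \<rho>" using not_less_Least[of n "\<lambda>k. s * (1/2)^k \<le> \<rho>"] n by (simp add: k_def)
  then show ?thesis using k n \<open>N < k\<close> by (intro exI[of _ n]) auto
qed

lemma summable_dyadic_powr: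
  assumes "s > 0" "e > 0"
  shows "summable (\<lambda>n. (s * (1/2)^n) powr e :: real)"
proof -
  have "(s * (1/2)^n) powr e = s powr e * ((1/2) powr e)^n" for n
  proof -
    have "((1/2)^n) powr e = ((1/2::real) powr e)^n"
      by (simp add: powr_realpow[symmetric] powr_powr mult.commute)
    then show ?thesis using assms by (simp add: powr_mult)
  qed
  moreover have "(1/2::real) powr e < 1" using assms powr_less_mono2[of e "1/2" 1] by simp
  ultimately show ?thesis by (auto intro!: summable_mult summable_geometric)
qed

context levy
begin

lemma victiny_subset_T: "A \<in> \<A> \<Longrightarrow> victiny \<A> d A \<rho> \<subseteq> T"
  using sets.sets_into_space[OF victiny_sets] space_m by blast

lemma region_bounds:
  assumes "(\<alpha>, q, q') \<in> lower_region T \<A> d m f A"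
  shows "\<exists>C \<rho>1. 0 \<le> C \<and> 0 < \<rho>1 \<and> (\<forall>\<rho>. 0 < \<rho> \<and> \<rho> < \<rho>1 \<longrightarrow>
    emeasure m (victiny \<A> d A \<rho> \<inter> large_set T \<A> d f \<alpha> A) \<le> ennreal (C * \<rho> powr q) \<and>
    emeasure m (victiny \<A> d A \<rho> - large_set T \<A> d f \<alpha> A) \<le> ennreal (C * \<rho> powr q'))"
proof -
  let ?F = "\<lambda>\<rho>. emeasure m (victiny \<A> d A \<rho> \<inter> large_set T \<A> d f \<alpha> A) / ennreal (\<rho> powr q) +
       emeasure m (victiny \<A> d A \<rho> - large_set T \<A> d f \<alpha> A) / ennreal (\<rho> powr q')"
  have "Limsup (at_right 0) ?F < \<infinity>" using assms unfolding lower_region_def by auto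
  then obtain c where c: "Limsup (at_right 0) ?F < c" "c < \<infinity>" using dense by blast
  then have "\<forall>\<^sub>F \<rho> in at_right 0. ?F \<rho> < c" by (intro Limsup_lessD)
  then obtain \<rho>1 :: real where \<rho>1: "\<rho>1 > 0" "\<And>\<rho>. 0 < \<rho> \<Longrightarrow> \<rho> < \<rho>1 \<Longrightarrow> ?F \<rho> < c"
    unfolding eventually_at_right_field by auto
  define C where "C = enn2real c"
  have C: "c = ennreal C" "C \<ge> 0" using c(2) by (auto simp: C_def less_top)
  have "emeasure m (victiny \<A> d A \<rho> \<inter> large_set T \<A> d f \<alpha> A) \<le> ennreal (C * \<rho> powr q) \<and>
    emeasure m (victiny \<A> d A \<rho> - large_set T \<A> d f \<alpha> A) \<le> ennreal (C * \<rho> powr q')" if "0 < \<rho>" "\<rho> < \<rho>1" for \<rho>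
  proof -
    have F: "?F \<rho> \<le> ennreal C" using \<rho>1(2)[OF that] C by simp
    show ?thesis
    proof (intro conjI bdd_ratio)
      show "emeasure m (victiny \<A> d A \<rho> \<inter> large_set T \<A> d f \<alpha> A) / ennreal (\<rho> powr q) \<le> ennreal C"
        by (rule order_trans[OF _ F]) simp
      show "emeasure m (victiny \<A> d A \<rho> - large_set T \<A> d f \<alpha> A) / ennreal (\<rho> powr q') \<le> ennreal C"
        by (rule order_trans[OF _ F]) simp
    qed (use that C in auto)
  qed
  then show ?thesis using C(2) \<rho>1(1) by blast
qed

text \<open>A point of the victiny of radius \<open>\<rho>\<close> has divergence at most
  \<open>\<rho>\<close>, so outside the large set \<open>|f|\<close> is at most that divergence to
  the power \<open>\<alpha>\<close>.\<close>

lemma small_set_bound: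
  assumes "s \<in> victiny \<A> d A \<rho> - large_set T \<A> d f \<alpha> A" "A \<in> \<A>" "\<rho> > 0" "\<alpha> \<ge> 0"
  shows "\<bar>f s\<bar> \<le> \<rho> powr \<alpha>"
proof -
  have "s \<in> T" using victiny_subset_T assms by blast
  then have "ennreal \<bar>f s\<bar> \<le> ennpow (divergence \<A> d s A) \<alpha>"
    using assms(1) by (auto simp: large_set_def not_less)
  also have "\<dots> \<le> ennreal (\<rho> powr \<alpha>)"
    using assms by (intro ennpow_mono divergence_le) auto
  finally show ?thesis by (simp add: ennreal_le_iff)
qed

text \<open>At scale \<open>\<rho> = s * (1/2)^n\<close> the measure is of order
  \<open>\<rho> powr q\<close> and the ratio of bound to level of order
  \<open>\<rho> powr (a - \<gamma>)\<close>. The maximal estimate becomes two powers of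
  \<open>\<rho>\<close>, for the orders \<open>b\<close> and \<open>min b 1\<close>;
  \<open>rate\<close> makes both exponents positive, and Borel-Cantelli applies.\<close>

lemma small_part:
  assumes b: "0 < b" "integrable \<nu> (\<lambda>x. \<bar>x\<bar> powr b)"
    "small_jumps_summable \<nu> \<Longrightarrow> b \<le> 1" "\<not> small_jumps_summable \<nu> \<Longrightarrow> 1 \<le> b \<and> b \<le> 2"
    and s: "s > 0" and C: "C \<ge> 0" and q: "q \<ge> 0"
    and E: "\<And>n. E n \<in> sets m" "\<And>n. emeasure m (E n) \<le> ennreal (C * (s * (1/2)^n) powr q)"
    and g: "\<And>n. g n \<in> borel_measurable m" "\<And>n t. \<bar>g n t\<bar> \<le> K * (s * (1/2)^n) powr a" "\<And>n t. t \<notin> E n \<Longrightarrow> g n t = 0"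
    and K: "K > 0" and rate: "(\<gamma> - a) * b < q"
  shows "AE \<omega> in P. \<exists>N0. \<forall>n\<ge>N0. fin_pts (E n) \<omega> \<longrightarrow>
    (\<forall>A\<in>\<A>. \<forall>\<epsilon>>0. \<bar>Yloc (E n) (g n) \<epsilon> A \<omega>\<bar> \<le> 3 * (s * (1/2)^n) powr \<gamma>)"
proof -
  define \<rho> where "\<rho> n = s * (1/2)^n" for n
  have \<rho>: "\<rho> n > 0" for n using s by (simp add: \<rho>_def)
  define c where "c = (1 + maxc) * (LINT x|\<nu>. \<bar>x\<bar> powr b)"
  have c: "c \<ge> 0" unfolding c_def using maxc_pos by (simp add: integral_nonneg_AE)
  define R where "R e n = c * C * (K powr e * \<rho> n powr (q + (a - \<gamma>) * e))" for e n
  have Ef: "emeasure m (E n) < \<infinity>" for n using E(2)[of n] by (rule le_less_trans) simp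
  have mE: "measure m (E n) \<le> C * \<rho> n powr q" for n
    using E(2)[of n] Ef[of n] C by (simp add: emeasure_eq_ennreal_measure less_top \<rho>_def ennreal_le_iff)
  have "\<exists>B\<in>sets P. prob B \<le> R b n + R (min b 1) n \<and>
    (\<forall>\<omega>\<in>space P - B. fin_pts (E n) \<omega> \<longrightarrow> (\<forall>A\<in>\<A>. \<forall>\<epsilon>>0. \<bar>Yloc (E n) (g n) \<epsilon> A \<omega>\<bar> \<le> 3 * \<rho> n powr \<gamma>))" for n
  proof -
    have gn: "\<bar>g n t\<bar> \<le> K * \<rho> n powr a" for t using g(2) unfolding \<rho>_def .
    have g0: "g n t = 0" if "t \<notin> E n" for t using g(3)[OF that] .
    have Kn: "K * \<rho> n powr a > 0" and ln: "\<rho> n powr \<gamma> > 0" using K \<rho>[of n] by auto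
    obtain B where B: "B \<in> sets P"
      "prob B \<le> c * measure m (E n) * ((K * \<rho> n powr a / \<rho> n powr \<gamma>) powr b + (K * \<rho> n powr a / \<rho> n powr \<gamma>) powr (min b 1))"
      "\<forall>\<omega>\<in>space P - B. fin_pts (E n) \<omega> \<longrightarrow> (\<forall>A\<in>\<A>. \<forall>\<epsilon>>0. \<bar>Yloc (E n) (g n) \<epsilon> A \<omega>\<bar> \<le> 3 * \<rho> n powr \<gamma>)"
      using Yloc_maximal[OF b E(1)[of n] Ef[of n] g(1)[of n] gn g0 Kn ln] unfolding c_def by blast
    have pw: "(K * \<rho> n powr a / \<rho> n powr \<gamma>) powr e = K powr e * \<rho> n powr ((a - \<gamma>) * e)" for e
      using K \<rho>[of n] by (simp add: powr_diff[symmetric] powr_mult powr_powr flip: times_divide_eq_right)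
    have "c * measure m (E n) * (K powr e * \<rho> n powr ((a - \<gamma>) * e)) \<le> R e n" for e
    proof -
      have "c * measure m (E n) * (K powr e * \<rho> n powr ((a - \<gamma>) * e)) \<le> c * (C * \<rho> n powr q) * (K powr e * \<rho> n powr ((a - \<gamma>) * e))"
        using c mE[of n] by (intro mult_right_mono mult_left_mono) auto
      also have "\<dots> = R e n" unfolding R_def by (simp add: powr_add mult_ac)
      finally show ?thesis .
    qed
    from this[of b] this[of "min b 1"] have "prob B \<le> R b n + R (min b 1) n"
      using B(2) unfolding pw by (simp add: distrib_left)
    then show ?thesis using B(1,3) by blast
  qed
  then obtain B where B: "\<And>n. B n \<in> sets P" "\<And>n. prob (B n) \<le> R b n + R (min b 1) n"
    "\<And>n \<omega> A \<epsilon>. \<omega> \<in> space P - B n \<Longrightarrow> fin_pts (E n) \<omega> \<Longrightarrow> A \<in> \<A> \<Longrightarrow> \<epsilon> > 0 \<Longrightarrow> \<bar>Yloc (E n) (g n) \<epsilon> A \<omega>\<bar> \<le> 3 * \<rho> n powr \<gamma>"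
    by metis
  have sum: "summable (R e)" if e: "q + (a - \<gamma>) * e > 0" for e
    unfolding R_def \<rho>_def by (intro summable_mult summable_dyadic_powr s e)
  have e1: "q + (a - \<gamma>) * b > 0" using rate by (simp add: algebra_simps)
  \<comment> \<open>For \<open>\<gamma> > a\<close> the smaller order only helps, for
    \<open>\<gamma> < a\<close> the exponent exceeds \<open>q \<ge> 0\<close>, and for
    \<open>\<gamma> = a\<close> the order drops out.\<close>
  have e2: "q + (a - \<gamma>) * min b 1 > 0"
  proof (cases "\<gamma> \<le> a")
    case True
    show ?thesis
    proof (cases "\<gamma> = a")
      case False
      then have "(a - \<gamma>) * min b 1 > 0" using True b by simp
      then show ?thesis using q by simp
    qed (use e1 in simp)
  next
    case False
    then have "(\<gamma> - a) * min b 1 \<le> (\<gamma> - a) * b" by (intro mult_left_mono) auto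
    then show ?thesis using rate by (simp add: algebra_simps)
  qed
  have "summable (\<lambda>n. prob (B n))"
    by (rule summable_comparison_test'[OF summable_add[OF sum[OF e1] sum[OF e2]], of 0]) (use B(2) in auto)
  then have "AE \<omega> in P. eventually (\<lambda>n. \<omega> \<in> space P - B n) sequentially"
    by (intro borel_cantelli_AE1) (use B(1) in \<open>auto simp: emeasure_eq_measure\<close>)
  then show ?thesis
  proof eventually_elim
    case (elim \<omega>)
    then show ?case using B(3) unfolding eventually_sequentially \<rho>_def by blast
  qed
qed

text \<open>All terms are values of one linear functional \<open>lin\<close> of the integrand, and
  the difference of the indicators of \<open>A'\<close> and \<open>A\<close> vanishes off
  \<open>E1 \<union> E2\<close>.\<close>

lemma increment_decomposition:
  assumes fin: "fin_pts W \<omega>" and \<epsilon>: "\<epsilon> > 0" and W: "A \<subseteq> W" "A' \<subseteq> W" "A \<in> sets m" "A' \<in> sets m"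
    and f: "f \<in> borel_measurable m" "integrable m (\<lambda>t. f t * indicator W t)"
    and E: "E1 \<in> sets m" "E2 \<in> sets m" "E1 \<inter> E2 = {}" "E1 \<subseteq> W" "E2 \<subseteq> W" "sym_diff A A' \<subseteq> E1 \<union> E2"
  defines "g1 \<equiv> \<lambda>t. f t * indicator E1 t" and "g2 \<equiv> \<lambda>t. f t * indicator E2 t"
  shows "Yeps f \<epsilon> A' \<omega> - Yeps f \<epsilon> A \<omega>
    = (Yloc E1 g1 \<epsilon> A' \<omega> - Yloc E1 g1 \<epsilon> A \<omega>) + (Yloc E2 g2 \<epsilon> A' \<omega> - Yloc E2 g2 \<epsilon> A \<omega>)"
proof -
  define lin where "lin \<phi> = (\<Sum>(t, x)\<in>pts W \<epsilon> \<omega>. \<phi> t * x) - (\<integral>t. \<phi> t \<partial>m) * compens \<epsilon>" for \<phi> :: "'t \<Rightarrow> real"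
  have finW: "finite (pts W \<epsilon> \<omega>)" using fin \<epsilon> unfolding fin_pts_def by auto
  have int: "integrable m (\<lambda>t. indicator A t * (f t * indicator E t))" if "A \<in> sets m" "E \<in> sets m" "E \<subseteq> W" for A E
  proof -
    have "integrable m (\<lambda>t. indicator (A \<inter> E) t * (f t * indicator W t))"
      using integrable_real_mult_indicator[OF _ f(2), of "A \<inter> E"] that by (simp add: mult_ac)
    then show ?thesis
      by (rule Bochner_Integration.integrable_bound) (use that f(1) in \<open>auto simp: indicator_def\<close>)
  qed
  have Y: "Yeps f \<epsilon> A \<omega> = lin (\<lambda>t. indicator A t * (f t * indicator W t))" if "A \<subseteq> W" for A
    using Yeps_Yloc[OF fin \<epsilon> that, of f] unfolding Yloc_def lin_def set_lebesgue_integral_def real_scaleR_def by (simp add: mult.assoc)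
  have Yl: "Yloc E (\<lambda>t. f t * indicator E t) \<epsilon> A \<omega> = lin (\<lambda>t. indicator A t * (f t * indicator E t))" if "E \<subseteq> W" for E A
  proof -
    have "(\<Sum>(t, x)\<in>pts W \<epsilon> \<omega>. indicator A t * (f t * indicator E t) * x) = (\<Sum>(t, x)\<in>pts E \<epsilon> \<omega>. indicator A t * (f t * indicator E t) * x)"
      using finW that by (intro sum.mono_neutral_right) (auto simp: pts_def indicator_def)
    then show ?thesis unfolding Yloc_def lin_def set_lebesgue_integral_def by simp
  qed
  have lin_diff: "lin \<phi> - lin \<psi> = lin (\<lambda>t. \<phi> t - \<psi> t)" if "integrable m \<phi>" "integrable m \<psi>" for \<phi> \<psi>
  proof -
    have "(\<Sum>(t, x)\<in>pts W \<epsilon> \<omega>. (\<phi> t - \<psi> t) * x) = (\<Sum>(t, x)\<in>pts W \<epsilon> \<omega>. \<phi> t * x) - (\<Sum>(t, x)\<in>pts W \<epsilon> \<omega>. \<psi> t * x)"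
      by (simp add: sum_subtractf case_prod_beta left_diff_distrib)
    moreover have "(\<integral>t. \<phi> t - \<psi> t \<partial>m) = (\<integral>t. \<phi> t \<partial>m) - (\<integral>t. \<psi> t \<partial>m)" using that by simp
    moreover have "x - i * c - (y - j * c) = (x - y) - (i - j) * c" for x y i j c :: real by (simp add: algebra_simps)
    ultimately show ?thesis unfolding lin_def by (simp only:)
  qed
  have lin_add: "lin \<phi> + lin \<psi> = lin (\<lambda>t. \<phi> t + \<psi> t)" if "integrable m \<phi>" "integrable m \<psi>" for \<phi> \<psi>
  proof -
    have "(\<Sum>(t, x)\<in>pts W \<epsilon> \<omega>. (\<phi> t + \<psi> t) * x) = (\<Sum>(t, x)\<in>pts W \<epsilon> \<omega>. \<phi> t * x) + (\<Sum>(t, x)\<in>pts W \<epsilon> \<omega>. \<psi> t * x)"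
      by (simp add: sum.distrib case_prod_beta distrib_right)
    moreover have "(\<integral>t. \<phi> t + \<psi> t \<partial>m) = (\<integral>t. \<phi> t \<partial>m) + (\<integral>t. \<psi> t \<partial>m)" using that by simp
    moreover have "(x - i * c) + (y - j * c) = (x + y) - (i + j) * c" for x y i j c :: real by (simp add: algebra_simps)
    ultimately show ?thesis unfolding lin_def by (simp only:)
  qed
  have intf: "integrable m (\<lambda>t. indicator A t * (f t * indicator W t))" if "A \<in> sets m" for A
    using integrable_real_mult_indicator[OF that f(2)] by (simp add: mult.commute)
  have "Yeps f \<epsilon> A' \<omega> - Yeps f \<epsilon> A \<omega> = lin (\<lambda>t. indicator A' t * (f t * indicator W t) - indicator A t * (f t * indicator W t))"
    unfolding Y[OF W(1)] Y[OF W(2)] by (rule lin_diff[OF intf[OF W(4)] intf[OF W(3)]])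
  also have "(\<lambda>t. indicator A' t * (f t * indicator W t) - indicator A t * (f t * indicator W t)) =
     (\<lambda>t. (indicator A' t * (f t * indicator E1 t) - indicator A t * (f t * indicator E1 t)) +
          (indicator A' t * (f t * indicator E2 t) - indicator A t * (f t * indicator E2 t)))"
    using E W by (intro ext) (auto simp: indicator_def)
  also have "lin \<dots> = (Yloc E1 g1 \<epsilon> A' \<omega> - Yloc E1 g1 \<epsilon> A \<omega>) + (Yloc E2 g2 \<epsilon> A' \<omega> - Yloc E2 g2 \<epsilon> A \<omega>)"
    unfolding g1_def g2_def Yl[OF E(4)] Yl[OF E(5)]
      lin_diff[OF int[OF W(4) E(1,4)] int[OF W(3) E(1,4)]] lin_diff[OF int[OF W(4) E(2,5)] int[OF W(3) E(2,5)]]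
    by (rule lin_add[symmetric]; intro Bochner_Integration.integrable_diff int W E)
  finally show ?thesis .
qed

text \<open>The parts of the victiny inside and outside the large set enter
  \<open>small_part\<close> with \<open>a = 0\<close> and \<open>a = \<alpha>\<close>. The resulting
  estimates are uniform in the truncation level and so pass to the jump integral.\<close>

lemma hoelder_lower:
  assumes A: "A \<in> \<A>" and f: "f \<in> borel_measurable m" "integrable m (\<lambda>t. (f t * indicator A t)\<^sup>2)"
    and \<rho>0: "\<rho>0 > 0" "\<And>s. s \<in> victiny \<A> d A \<rho>0 \<Longrightarrow> \<bar>f s\<bar> \<le> K0"
    and region: "(\<alpha>, q, q') \<in> lower_region T \<A> d m f A"
    and b: "0 < b" "integrable \<nu> (\<lambda>x. \<bar>x\<bar> powr b)"
    "small_jumps_summable \<nu> \<Longrightarrow> b \<le> 1" "\<not> small_jumps_summable \<nu> \<Longrightarrow> 1 \<le> b \<and> b \<le> 2"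
    and rates: "\<gamma> * b < q" "(\<gamma> - \<alpha>) * b < q'" and \<gamma>: "\<gamma> \<ge> 0"
  shows "AE \<omega> in P. \<exists>C. \<exists>\<rho>1>0. \<forall>\<rho>. 0 < \<rho> \<and> \<rho> < \<rho>1 \<longrightarrow> (\<forall>A'\<in>index_ball \<A> d A \<rho>.
    \<bar>jump_integral m \<nu> \<Xi> f A \<omega> - jump_integral m \<nu> \<Xi> f A' \<omega>\<bar> \<le> C * \<rho> powr \<gamma>)"
proof -
  define L where "L = large_set T \<A> d f \<alpha> A"
  define V where "V = victiny \<A> d A"
  have \<alpha>q: "\<alpha> \<ge> 0" "q \<ge> 0" "q' \<ge> 0" using region unfolding lower_region_def by auto
  obtain C \<rho>1 where C: "0 \<le> C" and \<rho>1: "0 < \<rho>1" and meas: "\<And>\<rho>. 0 < \<rho> \<Longrightarrow> \<rho> < \<rho>1 \<Longrightarrow>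
    emeasure m (V \<rho> \<inter> L) \<le> ennreal (C * \<rho> powr q) \<and> emeasure m (V \<rho> - L) \<le> ennreal (C * \<rho> powr q')"
    using region_bounds[OF region] unfolding L_def V_def by blast
  define s where "s = min \<rho>0 \<rho>1 / 2"
  have s: "s > 0" "s < \<rho>0" "s < \<rho>1" using \<rho>0(1) \<rho>1 by (auto simp: s_def)
  define \<rho> where "\<rho> n = s * (1/2)^n" for n
  have \<rho>: "0 < \<rho> n" "\<rho> n \<le> s" for n using s by (auto simp: \<rho>_def power_le_one)
  have \<rho>_less: "\<rho> n < \<rho>1" for n using \<rho>(2)[of n] s(3) by linarith
  have Lm[measurable]: "L \<in> sets m" unfolding L_def using A f(1) by simp
  have Vm[measurable]: "V r \<in> sets m" for r unfolding V_def using A by simp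
  have Vmono: "V r \<subseteq> V r'" if "r \<le> r'" for r r' unfolding V_def by (rule victiny_mono[OF that])
  \<comment> \<open>\<open>W\<close> contains every \<open>A'\<close> in the balls of radius at most
    \<open>s\<close>, so a single almost sure event yields all their jump integrals as
    limits.\<close>
  define W where "W = A \<union> V s"
  \<comment> \<open>A victiny may be a union over very many sets; that its measure is finite is read
    off from the lower region.\<close>
  have VsFin: "emeasure m (V s) < \<infinity>"
  proof -
    have "emeasure m (V s) \<le> emeasure m (V s \<inter> L) + emeasure m (V s - L)"
      by (rule order_trans[OF _ emeasure_subadditive]) (auto intro!: emeasure_mono)
    also have "\<dots> < \<infinity>" using meas[OF s(1,3)] by (auto simp: less_top[symmetric] top_unique)
    finally show ?thesis .
  qed
  have W: "W \<in> sets m" "emeasure m W < \<infinity>"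
  proof -
    show "W \<in> sets m" unfolding W_def using A by simp
    have "emeasure m W \<le> emeasure m A + emeasure m (V s)" unfolding W_def using A by (intro emeasure_subadditive) auto
    also have "\<dots> < \<infinity>" using m_finite A VsFin by (auto simp: less_top[symmetric])
    finally show "emeasure m W < \<infinity>" .
  qed
  define K where "K = max K0 1"
  have K: "K > 0" "K0 \<le> K" by (auto simp: K_def)
  have fV: "\<bar>f t\<bar> \<le> K" if "t \<in> V s" for t
    using \<rho>0(2)[of t] Vmono[of s \<rho>0] that s K unfolding V_def by force
  have f2: "integrable m (\<lambda>t. (f t * indicator W t)\<^sup>2)"
  proof (rule Bochner_Integration.integrable_bound)
    show "integrable m (\<lambda>t. (f t * indicator A t)\<^sup>2 + K\<^sup>2 * indicator (V s) t)"
      using f(2) VsFin by (auto simp: less_top)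
    have "(f t * indicator W t)\<^sup>2 \<le> (f t * indicator A t)\<^sup>2 + K\<^sup>2 * indicator (V s) t" for t
    proof (cases "t \<in> V s")
      case True
      have "(f t)\<^sup>2 \<le> K\<^sup>2" using fV[OF True] K by (simp add: abs_le_square_iff[symmetric])
      then show ?thesis using True by (auto simp: W_def indicator_def)
    qed (auto simp: W_def indicator_def)
    then show "AE t in m. norm ((f t * indicator W t)\<^sup>2) \<le> norm ((f t * indicator A t)\<^sup>2 + K\<^sup>2 * indicator (V s) t)"
      by (intro AE_I2) (auto intro: order_trans)
  qed (use f(1) W in measurable)
  note f1 = square_integrable_on_imp_integrable_on[OF W f(1) f2]
  define E1 where "E1 n = V (\<rho> n) \<inter> L" for n
  define E2 where "E2 n = V (\<rho> n) - L" for n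
  define g1 where "g1 n t = f t * indicator (E1 n) t" for n t
  define g2 where "g2 n t = f t * indicator (E2 n) t" for n t
  have Em[measurable]: "E1 n \<in> sets m" "E2 n \<in> sets m" for n unfolding E1_def E2_def by auto
  have EV: "E1 n \<subseteq> V s" "E2 n \<subseteq> V s" for n unfolding E1_def E2_def using Vmono[OF \<rho>(2)] by auto
  have gm: "g1 n \<in> borel_measurable m" "g2 n \<in> borel_measurable m" for n
    unfolding g1_def g2_def using f(1) Em by measurable
  have 1: "AE \<omega> in P. \<exists>N0. \<forall>n\<ge>N0. fin_pts (E1 n) \<omega> \<longrightarrow>
    (\<forall>A\<in>\<A>. \<forall>\<epsilon>>0. \<bar>Yloc (E1 n) (g1 n) \<epsilon> A \<omega>\<bar> \<le> 3 * (s * (1/2)^n) powr \<gamma>)"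
  proof (rule small_part[where a=0 and K=K and C=C and q=q and b=b])
    show "emeasure m (E1 n) \<le> ennreal (C * (s * (1/2)^n) powr q)" for n
      unfolding E1_def using meas[OF \<rho>(1) \<rho>_less, of n] by (simp add: \<rho>_def)
    show "\<bar>g1 n t\<bar> \<le> K * (s * (1/2)^n) powr 0" for n t
      using fV[of t] EV(1)[of n] K s by (auto simp: g1_def indicator_def)
    show "g1 n t = 0" if "t \<notin> E1 n" for n t using that by (simp add: g1_def)
  qed (use b s C \<alpha>q gm K rates Em in auto)
  have 2: "AE \<omega> in P. \<exists>N0. \<forall>n\<ge>N0. fin_pts (E2 n) \<omega> \<longrightarrow>
    (\<forall>A\<in>\<A>. \<forall>\<epsilon>>0. \<bar>Yloc (E2 n) (g2 n) \<epsilon> A \<omega>\<bar> \<le> 3 * (s * (1/2)^n) powr \<gamma>)"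
  proof (rule small_part[where a=\<alpha> and K=1 and C=C and q=q' and b=b])
    show "emeasure m (E2 n) \<le> ennreal (C * (s * (1/2)^n) powr q')" for n
      unfolding E2_def using meas[OF \<rho>(1) \<rho>_less, of n] by (simp add: \<rho>_def)
    show "\<bar>g2 n t\<bar> \<le> 1 * (s * (1/2)^n) powr \<alpha>" for n t
      using small_set_bound[of t A "\<rho> n" f \<alpha>] A \<alpha>q \<rho>(1)[of n]
      by (auto simp: g2_def indicator_def E2_def V_def L_def \<rho>_def)
    show "g2 n t = 0" if "t \<notin> E2 n" for n t using that by (simp add: g2_def)
  qed (use b s C \<alpha>q gm rates Em in auto)
  show ?thesis using 1 2 jump_integral_uniform[OF W f(1) f2]
  proof eventually_elim
    case (elim \<omega>)
    then have fin: "fin_pts W \<omega>" by blast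
    have lim: "((\<lambda>\<epsilon>. Yeps f \<epsilon> A' \<omega>) \<longlongrightarrow> jump_integral m \<nu> \<Xi> f A' \<omega>) (at_right 0)" if "A' \<in> \<A>" "A' \<subseteq> W" for A'
      using elim that by blast
    from elim(1) obtain N1 where "\<forall>n\<ge>N1. fin_pts (E1 n) \<omega> \<longrightarrow>
        (\<forall>A\<in>\<A>. \<forall>\<epsilon>>0. \<bar>Yloc (E1 n) (g1 n) \<epsilon> A \<omega>\<bar> \<le> 3 * \<rho> n powr \<gamma>)"
      unfolding \<rho>_def by (elim exE)
    then have N1: "\<And>n A \<epsilon>. n \<ge> N1 \<Longrightarrow> fin_pts (E1 n) \<omega> \<Longrightarrow> A \<in> \<A> \<Longrightarrow> \<epsilon> > 0 \<Longrightarrow>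
        \<bar>Yloc (E1 n) (g1 n) \<epsilon> A \<omega>\<bar> \<le> 3 * \<rho> n powr \<gamma>" by simp
    from elim(2) obtain N2 where "\<forall>n\<ge>N2. fin_pts (E2 n) \<omega> \<longrightarrow>
        (\<forall>A\<in>\<A>. \<forall>\<epsilon>>0. \<bar>Yloc (E2 n) (g2 n) \<epsilon> A \<omega>\<bar> \<le> 3 * \<rho> n powr \<gamma>)"
      unfolding \<rho>_def by (elim exE)
    then have N2: "\<And>n A \<epsilon>. n \<ge> N2 \<Longrightarrow> fin_pts (E2 n) \<omega> \<Longrightarrow> A \<in> \<A> \<Longrightarrow> \<epsilon> > 0 \<Longrightarrow>
        \<bar>Yloc (E2 n) (g2 n) \<epsilon> A \<omega>\<bar> \<le> 3 * \<rho> n powr \<gamma>" by simp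
    have finE: "fin_pts (E1 n) \<omega>" "fin_pts (E2 n) \<omega>" for n
      using fin_pts_mono[OF fin] EV[of n] unfolding W_def by blast+
    \<comment> \<open>\<open>12\<close> stands for four local terms, one for each of the two sets
      and each of the two parts, all at most \<open>3 * \<rho> n powr \<gamma>\<close>.\<close>
    have main: "\<bar>jump_integral m \<nu> \<Xi> f A \<omega> - jump_integral m \<nu> \<Xi> f A' \<omega>\<bar> \<le> 12 * \<rho> n powr \<gamma>"
      if n: "n \<ge> N1" "n \<ge> N2" and A': "A' \<in> index_ball \<A> d A (\<rho> n)" for n A'
    proof -
      have A'm: "A' \<in> \<A>" using A' unfolding index_ball_def by auto
      have sd: "sym_diff A A' \<subseteq> V (\<rho> n)" unfolding V_def victiny_def using A' by blast
      have AW: "A \<subseteq> W" "A' \<subseteq> W" using sd Vmono[OF \<rho>(2), of n] unfolding W_def by blast+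
      have bd: "\<bar>Yeps f \<epsilon> A \<omega> - Yeps f \<epsilon> A' \<omega>\<bar> \<le> 12 * \<rho> n powr \<gamma>" if \<epsilon>: "\<epsilon> > 0" for \<epsilon>
      proof -
        have "Yeps f \<epsilon> A' \<omega> - Yeps f \<epsilon> A \<omega>
          = (Yloc (E1 n) (g1 n) \<epsilon> A' \<omega> - Yloc (E1 n) (g1 n) \<epsilon> A \<omega>) + (Yloc (E2 n) (g2 n) \<epsilon> A' \<omega> - Yloc (E2 n) (g2 n) \<epsilon> A \<omega>)"
          unfolding g1_def g2_def
        proof (rule increment_decomposition[OF fin \<epsilon> AW _ _ f(1) f1])
          show "E1 n \<inter> E2 n = {}" "sym_diff A A' \<subseteq> E1 n \<union> E2 n" using sd by (auto simp: E1_def E2_def)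
          show "E1 n \<subseteq> W" "E2 n \<subseteq> W" using EV[of n] unfolding W_def by blast+
        qed (use A A'm in auto)
        then show ?thesis
          using N1[OF n(1) finE(1) A \<epsilon>] N1[OF n(1) finE(1) A'm \<epsilon>] N2[OF n(2) finE(2) A \<epsilon>] N2[OF n(2) finE(2) A'm \<epsilon>]
          by linarith
      qed
      have "((\<lambda>\<epsilon>. \<bar>Yeps f \<epsilon> A \<omega> - Yeps f \<epsilon> A' \<omega>\<bar>) \<longlongrightarrow> \<bar>jump_integral m \<nu> \<Xi> f A \<omega> - jump_integral m \<nu> \<Xi> f A' \<omega>\<bar>) (at_right 0)"
        by (intro tendsto_intros lim A A'm AW)
      then show ?thesis
        by (rule tendsto_upperbound) (auto simp: eventually_at_right_field bd intro!: exI[of _ 1])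
    qed
    define N0 where "N0 = max N1 N2"
    \<comment> \<open>\<open>2 powr \<gamma>\<close> is the price for replacing \<open>r\<close> by
      the dyadic radius above it.\<close>
    have "\<bar>jump_integral m \<nu> \<Xi> f A \<omega> - jump_integral m \<nu> \<Xi> f A' \<omega>\<bar> \<le> (12 * 2 powr \<gamma>) * r powr \<gamma>"
      if r: "0 < r" "r < s * (1/2)^N0" and A': "A' \<in> index_ball \<A> d A r" for r A'
    proof -
      obtain n where n: "n \<ge> N0" "s * (1/2)^(Suc n) \<le> r" "r < s * (1/2)^n" using dyadic_bracket[OF r] by blast
      have "A' \<in> index_ball \<A> d A (\<rho> n)" using A' n(3) unfolding index_ball_def \<rho>_def by auto
      then have "\<bar>jump_integral m \<nu> \<Xi> f A \<omega> - jump_integral m \<nu> \<Xi> f A' \<omega>\<bar> \<le> 12 * \<rho> n powr \<gamma>"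
        using main n(1) unfolding N0_def by simp
      also have "\<rho> n powr \<gamma> \<le> (2 * r) powr \<gamma>" using n(2) \<rho>(1)[of n] \<gamma> by (intro powr_mono2) (auto simp: \<rho>_def)
      also have "(2 * r) powr \<gamma> = 2 powr \<gamma> * r powr \<gamma>" using r by (simp add: powr_mult)
      finally show ?thesis by (simp add: mult.assoc)
    qed
    moreover have "s * (1/2)^N0 > 0" using s by simp
    ultimately show ?case by blast
  qed
qed

end

section \<open>Detection of jumps\<close>

context levy
begin

text \<open>Otherwise the tail of \<open>\<nu>\<close> at \<open>r\<close> would be at most
  \<open>K * r powr (- \<delta>)\<close> for all \<open>r < r0\<close>. Summing over dyadic shells
  would then give a finite moment of an order \<open>\<delta>'\<close> strictly between
  \<open>\<delta>\<close> and the infimum of such orders.\<close>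

lemma blumenthal_getoor_tail:
  assumes \<delta>: "0 < \<delta>" "\<delta> < blumenthal_getoor \<nu>" and r0: "r0 > 0"
  shows "\<exists>r. 0 < r \<and> r < r0 \<and> K < r powr \<delta> * measure \<nu> {x. r \<le> \<bar>x\<bar>}"
proof (rule ccontr)
  assume neg: "\<not> ?thesis"
  define \<kappa> where "\<kappa> r = measure \<nu> {x. r \<le> \<bar>x\<bar>}" for r
  have \<kappa>: "r powr \<delta> * \<kappa> r \<le> K" if "0 < r" "r < r0" for r using neg that unfolding \<kappa>_def by force
  define \<delta>' where "\<delta>' = (\<delta> + blumenthal_getoor \<nu>) / 2"
  have \<delta>': "\<delta> < \<delta>'" "\<delta>' < blumenthal_getoor \<nu>" "\<delta>' > 0" using \<delta> by (auto simp: \<delta>'_def)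
  let ?h = "\<lambda>n::nat. (1/2::real)^n"
  define a where "a n = (?h n) powr \<delta>' * \<kappa> (?h (Suc n))" for n
  have K0: "K \<ge> 0"
  proof -
    have "(r0/2) powr \<delta> * \<kappa> (r0/2) \<ge> 0" by (simp add: \<kappa>_def)
    then show ?thesis using \<kappa>[of "r0/2"] r0 by simp
  qed
  obtain N where N: "?h N < r0" using real_arch_pow_inv[of r0 "1/2"] r0 by auto
  have "summable a"
  proof (rule summable_comparison_test')
    show "summable (\<lambda>n. K * 2 powr \<delta> * (1 * ?h n) powr (\<delta>' - \<delta>))"
      using \<delta>' by (intro summable_mult summable_dyadic_powr) auto
    fix n assume "n \<ge> N"
    have "?h (Suc n) \<le> ?h N" using \<open>n \<ge> N\<close> by (intro power_decreasing) auto
    then have lt: "?h (Suc n) < r0" using N by linarith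
    have "(?h (Suc n)) powr \<delta> * \<kappa> (?h (Suc n)) \<le> K" using \<kappa>[OF _ lt] by simp
    moreover have "(?h n) powr \<delta>' = (?h n) powr (\<delta>' - \<delta>) * (2 powr \<delta> * (?h (Suc n)) powr \<delta>)"
      by (simp add: powr_mult[symmetric] powr_add[symmetric])
    ultimately have "a n \<le> (?h n) powr (\<delta>' - \<delta>) * (2 powr \<delta> * K)"
      unfolding a_def by (simp add: mult.assoc mult_left_mono)
    then show "norm (a n) \<le> K * 2 powr \<delta> * (1 * ?h n) powr (\<delta>' - \<delta>)"
      by (simp add: a_def \<kappa>_def mult_ac)
  qed
  have \<nu>fin: "emeasure \<nu> {x. ?h (Suc n) \<le> \<bar>x\<bar>} = ennreal (\<kappa> (?h (Suc n)))" for n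
    unfolding \<kappa>_def using \<nu>_large[of "?h (Suc n)"] by (intro emeasure_eq_ennreal_measure) (auto simp: less_top)
  have "(\<integral>\<^sup>+x\<in>{x. \<bar>x\<bar> \<le> 1}. ennreal (\<bar>x\<bar> powr \<delta>') \<partial>\<nu>) \<le> (\<integral>\<^sup>+x. (\<Sum>n. ennreal ((?h n) powr \<delta>') * indicator {x. ?h (Suc n) \<le> \<bar>x\<bar>} x) \<partial>\<nu>)"
  proof (rule nn_integral_mono)
    fix x :: real
    show "ennreal (\<bar>x\<bar> powr \<delta>') * indicator {x. \<bar>x\<bar> \<le> 1} x \<le> (\<Sum>n. ennreal ((?h n) powr \<delta>') * indicator {x. ?h (Suc n) \<le> \<bar>x\<bar>} x)"
    proof (cases "x \<noteq> 0 \<and> \<bar>x\<bar> \<le> 1")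
      case True
      obtain n where n: "2 * ?h (Suc n) \<le> 2 * \<bar>x\<bar>" "\<bar>x\<bar> \<le> ?h n"
      proof (cases "\<bar>x\<bar> = 1")
        case True
        then show ?thesis using that[of 0] by simp
      next
        case False
        then have "\<exists>n\<ge>0. 1 * ?h (Suc n) \<le> \<bar>x\<bar> \<and> \<bar>x\<bar> < 1 * ?h n"
          using True by (intro dyadic_bracket) auto
        then obtain n where "1 * ?h (Suc n) \<le> \<bar>x\<bar>" "\<bar>x\<bar> < 1 * ?h n" by blast
        then show ?thesis using that[of n] by simp
      qed
      have "ennreal (\<bar>x\<bar> powr \<delta>') * indicator {x. \<bar>x\<bar> \<le> 1} x \<le> ennreal ((?h n) powr \<delta>') * indicator {x. ?h (Suc n) \<le> \<bar>x\<bar>} x"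
        using n \<delta>' by (auto simp: indicator_def intro!: ennreal_leI powr_mono2)
      also have "\<dots> \<le> (\<Sum>n. ennreal ((?h n) powr \<delta>') * indicator {x. ?h (Suc n) \<le> \<bar>x\<bar>} x)"
      proof -
        have "g n \<le> suminf g" for g :: "nat \<Rightarrow> ennreal"
          using sum_le_suminf[of g "{n}"] by simp
        then show ?thesis .
      qed
      finally show ?thesis .
    qed (auto simp: indicator_def)
  qed
  also have "\<dots> = (\<Sum>n. \<integral>\<^sup>+x. ennreal ((?h n) powr \<delta>') * indicator {x. ?h (Suc n) \<le> \<bar>x\<bar>} x \<partial>\<nu>)"
    by (intro nn_integral_suminf) measurable
  also have "\<dots> = (\<Sum>n. ennreal (a n))"
  proof (rule suminf_cong)
    fix n
    have "(\<integral>\<^sup>+x. ennreal ((?h n) powr \<delta>') * indicator {x. ?h (Suc n) \<le> \<bar>x\<bar>} x \<partial>\<nu>)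
      = ennreal ((?h n) powr \<delta>') * emeasure \<nu> {x. ?h (Suc n) \<le> \<bar>x\<bar>}"
      by (intro nn_integral_cmult_indicator) simp
    then show "(\<integral>\<^sup>+x. ennreal ((?h n) powr \<delta>') * indicator {x. ?h (Suc n) \<le> \<bar>x\<bar>} x \<partial>\<nu>) = ennreal (a n)"
      unfolding \<nu>fin a_def by (simp add: ennreal_mult \<kappa>_def)
  qed
  also have "\<dots> = ennreal (\<Sum>n. a n)"
  proof (rule suminf_ennreal2)
    show "0 \<le> a n" for n by (simp add: a_def \<kappa>_def)
  qed (rule \<open>summable a\<close>)
  also have "\<dots> < \<infinity>" by simp
  finally have "\<delta>' \<in> {\<delta>. \<delta> > 0 \<and> (\<integral>\<^sup>+x\<in>{x. \<bar>x\<bar> \<le> 1}. ennreal (\<bar>x\<bar> powr \<delta>) \<partial>\<nu>) < \<infinity>}" using \<delta>' by simp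
  then have "blumenthal_getoor \<nu> \<le> \<delta>'"
    unfolding blumenthal_getoor_def by (intro cInf_lower) (auto intro: bdd_belowI[of _ 0])
  then show False using \<delta>' by simp
qed

end

section \<open>Chains of equal measure and detection of single jumps\<close>

locale levy_m = levy T \<A> An d m P \<nu> \<Xi>
  for T :: "'t set" and \<A> An d m and P :: "'w measure" and \<nu> \<Xi> +
  assumes m_compatible: "compatible_metric T \<A> An (measure_metric m)"
begin

sublocale mm: metric_indexing T \<A> An "measure_metric m"
  by unfold_locales (rule m_compatible)

lemma m_midpoint:
  assumes "U \<in> \<A>" "D \<in> \<A>" "U \<subseteq> D"
  shows "\<exists>M\<in>\<A>. U \<subseteq> M \<and> M \<subseteq> D \<and> measure m (M - U) = measure m (D - U) / 2 \<and> measure m (D - M) = measure m (D - U) / 2"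
proof -
  have mm: "measure_metric m X Z = measure m (Z - X)" if "X \<subseteq> Z" for X Z
  proof -
    have "sym_diff X Z = Z - X" using that by auto
    then show ?thesis by (simp add: measure_metric_def)
  qed
  obtain M where M: "M \<in> \<A>" "U \<subseteq> M" "M \<subseteq> D" "measure_metric m U M = measure_metric m U D / 2"
    "measure_metric m M D = measure_metric m U D / 2"
    using mm.midpoint[OF assms] by blast
  then show ?thesis using assms(3) by (intro bexI[of _ M]) (auto simp: mm)
qed

text \<open>The number of steps is a power of two because midpoints are what compatibility of
  \<open>measure_metric m\<close> offers.\<close>

definition chain :: "'t set \<Rightarrow> 't set \<Rightarrow> nat \<Rightarrow> (nat \<Rightarrow> 't set) \<Rightarrow> bool" where
  "chain U D k V \<longleftrightarrow> V 0 = U \<and> V (2^k) = D \<and> (\<forall>j\<le>2^k. V j \<in> \<A> \<and> U \<subseteq> V j \<and> V j \<subseteq> D) \<and>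
    (\<forall>j<2^k. V j \<subseteq> V (Suc j) \<and> measure m (V (Suc j) - V j) = measure m (D - U) / 2^k)"

lemma chain_exists:
  assumes U: "U \<in> \<A>" "D \<in> \<A>" "U \<subseteq> D"
  shows "\<exists>V. chain U D k V"
proof (induction k)
  case 0
  show ?case unfolding chain_def using U by (intro exI[of _ "\<lambda>j. if j = 0 then U else D"]) auto
next
  case (Suc k)
  then obtain V where V: "V 0 = U" "V (2^k) = D" "\<And>j. j \<le> 2^k \<Longrightarrow> V j \<in> \<A> \<and> U \<subseteq> V j \<and> V j \<subseteq> D"
    "\<And>j. j < 2^k \<Longrightarrow> V j \<subseteq> V (Suc j) \<and> measure m (V (Suc j) - V j) = measure m (D - U) / 2^k"
    unfolding chain_def by blast
  have "\<exists>M. j < 2^k \<longrightarrow> M \<in> \<A> \<and> V j \<subseteq> M \<and> M \<subseteq> V (Suc j) \<and> measure m (M - V j) = measure m (D - U) / 2^Suc k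
      \<and> measure m (V (Suc j) - M) = measure m (D - U) / 2^Suc k" for j
  proof (cases "j < 2^k")
    case True
    then have *: "V j \<in> \<A>" "V (Suc j) \<in> \<A>" "V j \<subseteq> V (Suc j)" using V(3)[of j] V(3)[of "Suc j"] V(4)[OF True] by auto
    from m_midpoint[OF *] obtain M where "M\<in>\<A>" "V j \<subseteq> M" "M \<subseteq> V (Suc j)"
      "measure m (M - V j) = measure m (V (Suc j) - V j) / 2" "measure m (V (Suc j) - M) = measure m (V (Suc j) - V j) / 2" by blast
    then show ?thesis using V(4)[OF True] by (intro exI[of _ M]) simp
  qed simp
  then obtain M where M: "\<And>j. j < 2^k \<Longrightarrow> M j \<in> \<A> \<and> V j \<subseteq> M j \<and> M j \<subseteq> V (Suc j) \<and> measure m (M j - V j) = measure m (D - U) / 2^Suc k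
      \<and> measure m (V (Suc j) - M j) = measure m (D - U) / 2^Suc k" by metis
  \<comment> \<open>Old members at even positions, midpoints at odd ones.\<close>
  define V' where "V' i = (if even i then V (i div 2) else M (i div 2))" for i
  have ends: "V' 0 = U" "V' (2 ^ Suc k) = D" using V by (auto simp: V'_def)
  have mem: "V' j \<in> \<A> \<and> U \<subseteq> V' j \<and> V' j \<subseteq> D" if "j \<le> 2 ^ Suc k" for j
  proof (cases "even j")
    case True
    then show ?thesis using V(3)[of "j div 2"] that by (auto simp: V'_def)
  next
    case False
    then have "j div 2 < 2^k" using that by (auto elim!: oddE)
    then show ?thesis using M[of "j div 2"] V(3)[of "j div 2"] V(3)[of "Suc (j div 2)"] False by (auto simp: V'_def)
  qed
  have step: "V' j \<subseteq> V' (Suc j) \<and> measure m (V' (Suc j) - V' j) = measure m (D - U) / 2 ^ Suc k" if "j < 2 ^ Suc k" for j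
  proof -
    have "j div 2 < 2^k" using that by auto
    from M[OF this] show ?thesis by (cases "even j") (simp_all add: V'_def)
  qed
  have "chain U D (Suc k) V'"
    unfolding chain_def using ends mem step by blast
  then show ?case by blast
qed

lemma chain_cell:
  assumes "chain U D k V" "t \<in> D - U"
  shows "\<exists>j<2^k. t \<in> V (Suc j) - V j"
proof -
  have ex: "t \<in> V (2^k)" "t \<notin> V 0" using assms unfolding chain_def by auto
  define i where "i = (LEAST i. t \<in> V i)"
  have i: "t \<in> V i" "i \<le> 2^k" unfolding i_def using ex(1) by (auto intro: LeastI Least_le)
  then obtain j where j: "i = Suc j" using ex(2) by (cases i) auto
  have "t \<notin> V j" using not_less_Least[of j "\<lambda>i. t \<in> V i"] j by (auto simp: i_def)
  then show ?thesis using i j by (intro exI[of _ j]) auto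
qed

text \<open>A cell has intensity \<open>c / 2^k\<close>, so it holds two points with probability at
  most \<open>(c / 2^k)^2\<close>. All \<open>2^k\<close> cells together contribute
  \<open>c^2 / 2^k\<close>, which tends to \<open>0\<close>.\<close>

lemma chain_separates:
  assumes U: "U \<in> \<A>" "D \<in> \<A>" "U \<subseteq> D" and V: "\<And>k. chain U D k (V k)" and e: "e > 0"
  shows "AE \<omega> in P. \<forall>k0. \<exists>k\<ge>k0. \<forall>j<2^k. \<not> 2 \<le> point_count \<Xi> ((V k (Suc j) - V k j) \<times> {x. e \<le> \<bar>x\<bar>}) \<omega>"
proof (rule AE_of_small_exceptions)
  fix \<delta> :: real assume \<delta>: "\<delta> > 0"
  define c where "c = measure m (D - U) * measure \<nu> {x. e \<le> \<bar>x\<bar>}"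
  define E where "E k j = (V k (Suc j) - V k j) \<times> {x. e \<le> \<bar>x\<bar>}" for k j
  have VA: "V k j \<in> \<A>" "V k (Suc j) \<in> \<A>" if "j < 2^k" for k j using V[of k] that unfolding chain_def by auto
  have E: "E k j \<in> sets (m \<Otimes>\<^sub>M \<nu>)" "emeasure (m \<Otimes>\<^sub>M \<nu>) (E k j) < \<infinity>" "measure (m \<Otimes>\<^sub>M \<nu>) (E k j) = c / 2^k"
    if "j < 2^k" for k j
  proof -
    have s: "V k (Suc j) - V k j \<in> sets m" using VA[OF that] by auto
    show "E k j \<in> sets (m \<Otimes>\<^sub>M \<nu>)" unfolding E_def using s by auto
    have em: "emeasure (m \<Otimes>\<^sub>M \<nu>) (E k j) = emeasure m (V k (Suc j) - V k j) * emeasure \<nu> {x. e \<le> \<bar>x\<bar>}"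
      unfolding E_def using s by (intro emeasure_times_\<nu>) auto
    have "emeasure m (V k (Suc j) - V k j) \<le> emeasure m (V k (Suc j))" using VA[OF that] by (intro emeasure_mono) auto
    also have "\<dots> < \<infinity>" using m_finite VA[OF that] by blast
    finally have f: "emeasure m (V k (Suc j) - V k j) < \<infinity>" .
    show "emeasure (m \<Otimes>\<^sub>M \<nu>) (E k j) < \<infinity>" unfolding em using f \<nu>_large[OF e] by (auto simp: ennreal_mult_less_top)
    have "measure m (V k (Suc j) - V k j) = measure m (D - U) / 2^k" using V[of k] that unfolding chain_def by auto
    then show "measure (m \<Otimes>\<^sub>M \<nu>) (E k j) = c / 2^k" unfolding measure_def em c_def by (simp add: enn2real_mult measure_def)
  qed
  define B where "B k = (\<Union>j<2^k. {\<omega>\<in>space P. 2 \<le> point_count \<Xi> (E k j) \<omega>})" for k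
  have Bs: "B k \<in> sets P" for k
    unfolding B_def using E(1)[of _ k] by (intro sets.finite_UN) auto
  have Bp: "prob (B k) \<le> c\<^sup>2 / 2^k" for k
  proof -
    have "prob (B k) \<le> (\<Sum>j<2^k. prob {\<omega>\<in>space P. 2 \<le> point_count \<Xi> (E k j) \<omega>})"
      unfolding B_def using E(1)[of _ k] by (intro finite_measure_subadditive_finite) auto
    also have "\<dots> \<le> (\<Sum>j<(2::nat)^k. (c / 2^k)\<^sup>2)"
      using prob_two_points[OF E(1,2)] E(3) by (intro sum_mono) auto
    also have "\<dots> = c\<^sup>2 / 2^k" by (simp add: power2_eq_square field_simps)
    finally show ?thesis .
  qed
  have "(\<lambda>k. c\<^sup>2 * (1/2)^k) \<longlonglongrightarrow> c\<^sup>2 * 0" by (intro tendsto_intros LIMSEQ_power_zero) simp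
  then have "\<forall>\<^sub>F k in sequentially. c\<^sup>2 * (1/2)^k < \<delta>" using \<delta> by (intro order_tendstoD(2)) auto
  then obtain K where K: "\<And>k. k \<ge> K \<Longrightarrow> c\<^sup>2 * (1/2)^k < \<delta>" by (auto simp: eventually_sequentially)
  have "prob (B (n + K)) \<le> \<delta>" for n
    using Bp[of "n + K"] K[of "n + K"] by (simp add: power_one_over)
  then obtain Z where Z: "Z \<in> sets P" "prob Z \<le> \<delta>" "\<And>\<omega> m. \<omega> \<in> space P - Z \<Longrightarrow> \<exists>n\<ge>m. \<omega> \<notin> B (n + K)"
    using liminf_bound[of "\<lambda>n. B (n + K)" \<delta>] Bs by metis
  have "\<exists>k\<ge>k0. \<forall>j<2^k. \<not> 2 \<le> point_count \<Xi> ((V k (Suc j) - V k j) \<times> {x. e \<le> \<bar>x\<bar>}) \<omega>"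
    if w: "\<omega> \<in> space P - Z" for \<omega> k0
  proof -
    obtain n where n: "n \<ge> k0" "\<omega> \<notin> B (n + K)" using Z(3)[OF w] by blast
    then show ?thesis using w unfolding B_def E_def by (intro exI[of _ "n + K"]) auto
  qed
  then show "\<exists>B\<in>sets P. prob B \<le> \<delta> \<and> (\<forall>\<omega>\<in>space P - B. \<forall>k0. \<exists>k\<ge>k0. \<forall>j<2^k.
      \<not> 2 \<le> point_count \<Xi> ((V k (Suc j) - V k j) \<times> {x. e \<le> \<bar>x\<bar>}) \<omega>)"
    using Z(1,2) by (intro bexI[of _ Z]) auto
qed

text \<open>Over the cell of \<open>t\<close> the truncated process changes by the jump at
  \<open>t\<close> minus a compensator of order 2^-k. The level \<open>e\<close> is chosen before
  \<open>k\<close>, since \<open>compens e\<close> may grow as \<open>e\<close> decreases.\<close>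

lemma jump_detection:
  assumes U: "U \<in> \<A>" "D \<in> \<A>" "U \<subseteq> D"
    and f: "f \<in> borel_measurable m" "integrable m (\<lambda>t. (f t * indicator D t)\<^sup>2)" "\<And>t. t \<in> D - U \<Longrightarrow> \<bar>f t\<bar> \<le> K"
  shows "AE \<omega> in P. \<forall>(t, x)\<in>\<Xi> \<omega>. t \<in> D - U \<longrightarrow> x \<noteq> 0 \<longrightarrow> (\<forall>\<eta>>0. \<exists>V\<in>\<A>. \<exists>V'\<in>\<A>.
    U \<subseteq> V \<and> V \<subseteq> D \<and> U \<subseteq> V' \<and> V' \<subseteq> D \<and>
    \<bar>f t * x\<bar> - \<eta> \<le> \<bar>jump_integral m \<nu> \<Xi> f V \<omega> - jump_integral m \<nu> \<Xi> f V' \<omega>\<bar>)"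
proof -
  obtain V where V: "\<And>k. chain U D k (V k)" using chain_exists[OF U] by metis
  have Dm: "D \<in> sets m" "emeasure m D < \<infinity>" using U m_finite by auto
  have "AE \<omega> in P. \<forall>k0. \<exists>k\<ge>k0. \<forall>j<2^k. \<not> 2 \<le> point_count \<Xi> ((V k (Suc j) - V k j) \<times> {x. 1 / real (Suc i) \<le> \<bar>x\<bar>}) \<omega>" for i
    by (rule chain_separates[OF U V]) simp
  then have "AE \<omega> in P. \<forall>i. \<forall>k0. \<exists>k\<ge>k0. \<forall>j<2^k. \<not> 2 \<le> point_count \<Xi> ((V k (Suc j) - V k j) \<times> {x. 1 / real (Suc i) \<le> \<bar>x\<bar>}) \<omega>"
    unfolding AE_all_countable ..
  then show ?thesis using jump_integral_uniform[OF Dm f(1,2)]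
  proof eventually_elim
    case (elim \<omega>)
    have sep: "\<exists>k\<ge>k0. \<forall>j<2^k. \<not> 2 \<le> point_count \<Xi> ((V k (Suc j) - V k j) \<times> {x. 1 / real (Suc i) \<le> \<bar>x\<bar>}) \<omega>" for i k0
      using elim(1) by blast
    have fin: "fin_pts D \<omega>" using elim(2) by blast
    have unif: "\<exists>r>0. \<forall>A\<in>\<A>. A \<subseteq> D \<longrightarrow> (\<forall>\<epsilon>. 0 < \<epsilon> \<and> \<epsilon> \<le> r \<longrightarrow> \<bar>Yeps f \<epsilon> A \<omega> - jump_integral m \<nu> \<Xi> f A \<omega>\<bar> \<le> \<eta>)"
      if "\<eta> > 0" for \<eta> using elim(2) that by blast
    have "\<exists>V\<in>\<A>. \<exists>V'\<in>\<A>. U \<subseteq> V \<and> V \<subseteq> D \<and> U \<subseteq> V' \<and> V' \<subseteq> D \<and>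
        \<bar>f t * x\<bar> - \<eta> \<le> \<bar>jump_integral m \<nu> \<Xi> f V \<omega> - jump_integral m \<nu> \<Xi> f V' \<omega>\<bar>"
      if tx: "(t, x) \<in> \<Xi> \<omega>" "t \<in> D - U" "x \<noteq> 0" and \<eta>: "\<eta> > 0" for t x \<eta>
    proof -
      \<comment> \<open>\<open>\<eta> / 4\<close> is allotted to each of the two truncation errors
        and to the compensator.\<close>
      obtain r where r: "r > 0" "\<And>A \<epsilon>. A \<in> \<A> \<Longrightarrow> A \<subseteq> D \<Longrightarrow> 0 < \<epsilon> \<Longrightarrow> \<epsilon> \<le> r \<Longrightarrow> \<bar>Yeps f \<epsilon> A \<omega> - jump_integral m \<nu> \<Xi> f A \<omega>\<bar> \<le> \<eta> / 4"
        using unif[of "\<eta> / 4"] \<eta> by auto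
      have "0 < min r \<bar>x\<bar>" using r tx by simp
      then obtain i where i: "inverse (real (Suc i)) < min r \<bar>x\<bar>" using reals_Archimedean by blast
      define e where "e = 1 / real (Suc i)"
      have e: "e > 0" "e \<le> r" "e \<le> \<bar>x\<bar>" using i by (auto simp: e_def inverse_eq_divide)
      \<comment> \<open>A bound for the compensator over all of \<open>D - U\<close>; a cell
        receives the fraction \<open>1 / 2^k\<close> of it.\<close>
      define M where "M = K * measure m (D - U) * \<bar>compens e\<bar>"
      have "(\<lambda>k. M * (1/2)^k) \<longlonglongrightarrow> M * 0" by (intro tendsto_intros LIMSEQ_power_zero) simp
      then have "\<forall>\<^sub>F k in sequentially. M * (1/2)^k < \<eta> / 4" using \<eta> by (intro order_tendstoD(2)) auto
      then obtain k0 where k0: "\<And>k. k \<ge> k0 \<Longrightarrow> M * (1/2)^k < \<eta> / 4" by (auto simp: eventually_sequentially)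
      obtain k where k: "k \<ge> k0" "\<And>j. j < 2^k \<Longrightarrow> \<not> 2 \<le> point_count \<Xi> ((V k (Suc j) - V k j) \<times> {x. e \<le> \<bar>x\<bar>}) \<omega>"
        using sep[of k0 i] unfolding e_def by blast
      obtain j where j: "j < 2^k" "t \<in> V k (Suc j) - V k j" using chain_cell[OF V tx(2)] by blast
      define W1 where "W1 = V k (Suc j)"
      define W0 where "W0 = V k j"
      have W: "W1 \<in> \<A>" "W0 \<in> \<A>" "U \<subseteq> W1" "W1 \<subseteq> D" "U \<subseteq> W0" "W0 \<subseteq> D" "W0 \<subseteq> W1"
        "measure m (W1 - W0) = measure m (D - U) / 2^k" "t \<in> W1" "t \<notin> W0"
        using V[of k] j unfolding chain_def W1_def W0_def by auto
      have finF: "finite (pts D e \<omega>)" using fin e unfolding fin_pts_def by auto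
      \<comment> \<open>The cell holds at most one point of size at least \<open>e\<close>, and
        \<open>(t, x)\<close> is such a point because \<open>e \<le> |x|\<close>.\<close>
      have single: "\<Xi> \<omega> \<inter> (W1 - W0) \<times> {x. e \<le> \<bar>x\<bar>} = {(t, x)}"
      proof -
        let ?F = "\<Xi> \<omega> \<inter> (W1 - W0) \<times> {x. e \<le> \<bar>x\<bar>}"
        have sub: "?F \<subseteq> pts D e \<omega>" using W by (auto simp: pts_def)
        then have finF': "finite ?F" using finF finite_subset by blast
        have "\<not> 2 \<le> (of_nat (card ?F) :: ennreal)"
          using k(2)[OF j(1)] point_count_finite[OF finF'] unfolding W1_def W0_def by simp
        then have "\<not> 2 \<le> card ?F" by (metis of_nat_le_iff of_nat_numeral)
        moreover have mem: "(t, x) \<in> ?F" using tx W e by auto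
        ultimately have "card ?F = 1" using finF' card_gt_0_iff[of ?F] by (metis One_nat_def Suc_1 Suc_leI empty_iff le_neq_implies_less)
        then show ?thesis using mem by (metis card_1_singletonE singletonD)
      qed
      have js: "jump_sum \<Xi> f e W1 \<omega> - jump_sum \<Xi> f e W0 \<omega> = f t * x"
      proof -
        have "jump_sum \<Xi> f e W1 \<omega> - jump_sum \<Xi> f e W0 \<omega> = (\<Sum>(t, x)\<in>pts D e \<omega>. indicator W1 t * f t * x) - (\<Sum>(t, x)\<in>pts D e \<omega>. indicator W0 t * f t * x)"
          using jump_sum_pts[OF fin e(1) refl W(4)] jump_sum_pts[OF fin e(1) refl W(6)] by simp
        also have "\<dots> = (\<Sum>p\<in>pts D e \<omega>. if p = (t, x) then f t * x else 0)"
          unfolding sum_subtractf[symmetric]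
        proof (rule sum.cong[OF refl])
          fix p assume p: "p \<in> pts D e \<omega>"
          obtain t' x' where p': "p = (t', x')" by (cases p)
          have "t' \<in> W1 - W0 \<longleftrightarrow> p = (t, x)" using p single unfolding p' by (auto simp: pts_def)
          then show "(case p of (t, x) \<Rightarrow> indicator W1 t * f t * x) - (case p of (t, x) \<Rightarrow> indicator W0 t * f t * x) = (if p = (t, x) then f t * x else 0)"
            using W(7,9,10) unfolding p' by (auto simp: indicator_def)
        qed
        also have "\<dots> = f t * x"
          using finF tx e by (subst sum.delta) (auto simp: pts_def)
        finally show ?thesis .
      qed
      have int: "\<bar>(LINT t:W1|m. f t) - (LINT t:W0|m. f t)\<bar> \<le> K * (measure m (D - U) / 2^k)"
      proof -
        note fD = square_integrable_on_imp_integrable_on[OF Dm f(1,2)]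
        have iW: "integrable m (\<lambda>t. indicator W t * f t)" if "W \<in> sets m" "W \<subseteq> D" for W
        proof -
          have "integrable m (\<lambda>t. indicator W t * (f t * indicator D t))"
            using integrable_real_mult_indicator[OF that(1) fD] by (simp add: mult.commute)
          moreover have "(\<lambda>t. indicator W t * (f t * indicator D t)) = (\<lambda>t. indicator W t * f t)"
            using that(2) by (intro ext) (auto simp: indicator_def)
          ultimately show ?thesis by simp
        qed
        have i1: "integrable m (\<lambda>t. indicator W1 t * f t)" and i0: "integrable m (\<lambda>t. indicator W0 t * f t)"
          using iW W by auto
        have "(LINT t:W1|m. f t) - (LINT t:W0|m. f t) = (\<integral>t. indicator W1 t * f t - indicator W0 t * f t \<partial>m)"
          unfolding set_lebesgue_integral_def using i1 i0 by simp
        also have "\<bar>\<dots>\<bar> \<le> (\<integral>t. \<bar>indicator W1 t * f t - indicator W0 t * f t\<bar> \<partial>m)" by (rule integral_abs_bound)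
        also have "\<dots> \<le> (\<integral>t. K * indicator (W1 - W0) t \<partial>m)"
        proof (rule integral_mono)
          show "integrable m (\<lambda>t. \<bar>indicator W1 t * f t - indicator W0 t * f t\<bar>)" using i1 i0 by auto
          have "emeasure m (W1 - W0) \<le> emeasure m D" using W Dm by (intro emeasure_mono) auto
          then have "emeasure m (W1 - W0) < \<infinity>" using Dm(2) by (rule le_less_trans)
          then show "integrable m (\<lambda>t. K * indicator (W1 - W0) t)"
            using W by (intro integrable_mult_right integrable_real_indicator) auto
          show "\<bar>indicator W1 t * f t - indicator W0 t * f t\<bar> \<le> K * indicator (W1 - W0) t" for t
            using f(3)[of t] W by (auto simp: indicator_def)
        qed
        also have "\<dots> = K * measure m (W1 - W0)" using W by (simp add: Int_absorb2 sets.sets_into_space)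
        finally show ?thesis unfolding W(8) .
      qed
      have "\<bar>((LINT t:W1|m. f t) - (LINT t:W0|m. f t)) * compens e\<bar> \<le> K * (measure m (D - U) / 2^k) * \<bar>compens e\<bar>"
        unfolding abs_mult by (intro mult_right_mono int) simp
      also have "\<dots> = M * (1/2)^k" unfolding M_def by (simp add: power_one_over)
      also have "\<dots> < \<eta> / 4" by (rule k0[OF k(1)])
      finally have c: "\<bar>((LINT t:W1|m. f t) - (LINT t:W0|m. f t)) * compens e\<bar> < \<eta> / 4" .
      have "Yeps f e W1 \<omega> - Yeps f e W0 \<omega> = f t * x - ((LINT t:W1|m. f t) - (LINT t:W0|m. f t)) * compens e"
        unfolding Yeps_def js[symmetric] by (simp add: algebra_simps)
      then have "\<bar>f t * x\<bar> - \<eta> \<le> \<bar>jump_integral m \<nu> \<Xi> f W1 \<omega> - jump_integral m \<nu> \<Xi> f W0 \<omega>\<bar>"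
        using r(2)[OF W(1,4) e(1,2)] r(2)[OF W(2,6) e(1,2)] c by linarith
      then show ?thesis using W by blast
    qed
    then show ?case by auto
  qed
qed

end

section \<open>Upper bound for the exponent\<close>

context metric_indexing
begin

definition hoelder_at :: "('t set \<Rightarrow> real) \<Rightarrow> 't set \<Rightarrow> real \<Rightarrow> bool" where
  "hoelder_at y A \<gamma> \<longleftrightarrow> (\<exists>C. \<exists>\<rho>1>0. \<forall>\<rho>. 0 < \<rho> \<and> \<rho> < \<rho>1 \<longrightarrow>
    (\<forall>A'\<in>index_ball \<A> d A \<rho>. \<bar>y A - y A'\<bar> \<le> C * \<rho> powr \<gamma>))"

lemma hoelder_at_iff:
  "Limsup (at_right 0) (\<lambda>\<rho>. SUP A'\<in>index_ball \<A> d A \<rho>. ennreal (\<bar>y A - y A'\<bar> * \<rho> powr (- \<gamma>))) < \<infinity>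
    \<longleftrightarrow> hoelder_at y A \<gamma>" (is "Limsup _ ?F < \<infinity> \<longleftrightarrow> _")
proof
  assume "Limsup (at_right 0) ?F < \<infinity>"
  then obtain c where c: "Limsup (at_right 0) ?F < c" "c < \<infinity>" using dense by blast
  then have "\<forall>\<^sub>F \<rho> in at_right 0. ?F \<rho> < c" by (intro Limsup_lessD)
  then obtain \<rho>1 :: real where \<rho>1: "\<rho>1 > 0" "\<And>\<rho>. 0 < \<rho> \<Longrightarrow> \<rho> < \<rho>1 \<Longrightarrow> ?F \<rho> < c"
    unfolding eventually_at_right_field by auto
  define C where "C = enn2real c"
  have C: "c = ennreal C" "C \<ge> 0" using c(2) by (auto simp: C_def less_top)
  have "\<bar>y A - y A'\<bar> \<le> C * \<rho> powr \<gamma>" if \<rho>: "0 < \<rho>" "\<rho> < \<rho>1" and A': "A' \<in> index_ball \<A> d A \<rho>" for \<rho> A'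
  proof -
    have "ennreal (\<bar>y A - y A'\<bar> * \<rho> powr (- \<gamma>)) \<le> ?F \<rho>" by (rule SUP_upper[OF A'])
    also have "\<dots> \<le> ennreal C" using \<rho>1(2)[OF \<rho>] C by simp
    finally have "\<bar>y A - y A'\<bar> * \<rho> powr (- \<gamma>) \<le> C" using C by (simp add: ennreal_le_iff)
    then show ?thesis using \<rho> by (simp add: powr_minus field_simps)
  qed
  then show "hoelder_at y A \<gamma>" unfolding hoelder_at_def using \<rho>1(1) by blast
next
  assume "hoelder_at y A \<gamma>"
  then obtain C \<rho>1 where C: "\<rho>1 > 0" "\<And>\<rho> A'. 0 < \<rho> \<Longrightarrow> \<rho> < \<rho>1 \<Longrightarrow> A' \<in> index_ball \<A> d A \<rho> \<Longrightarrow> \<bar>y A - y A'\<bar> \<le> C * \<rho> powr \<gamma>"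
    unfolding hoelder_at_def by blast
  have "?F \<rho> \<le> ennreal C" if \<rho>: "0 < \<rho>" "\<rho> < \<rho>1" for \<rho>
  proof (rule SUP_least)
    fix A' assume "A' \<in> index_ball \<A> d A \<rho>"
    from C(2)[OF \<rho> this] have "\<bar>y A - y A'\<bar> * \<rho> powr (- \<gamma>) \<le> C" using \<rho> by (simp add: powr_minus field_simps)
    then show "ennreal (\<bar>y A - y A'\<bar> * \<rho> powr (- \<gamma>)) \<le> ennreal C" by (rule ennreal_leI)
  qed
  then have "Limsup (at_right 0) ?F \<le> ennreal C"
    using C(1) by (intro Limsup_bounded) (auto simp: eventually_at_right_field)
  then show "Limsup (at_right 0) ?F < \<infinity>" by (rule le_less_trans) simp
qed

text \<open>For radii below \<open>1\<close> a larger exponent is the stronger condition; this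
  allows a passage to rational exponents.\<close>

lemma hoelder_at_mono:
  assumes "hoelder_at y A \<gamma>" "\<gamma>' \<le> \<gamma>"
  shows "hoelder_at y A \<gamma>'"
proof -
  obtain C \<rho>1 where C: "\<rho>1 > 0" "\<And>\<rho> A'. 0 < \<rho> \<Longrightarrow> \<rho> < \<rho>1 \<Longrightarrow> A' \<in> index_ball \<A> d A \<rho> \<Longrightarrow> \<bar>y A - y A'\<bar> \<le> C * \<rho> powr \<gamma>"
    using assms(1) unfolding hoelder_at_def by blast
  have "\<bar>y A - y A'\<bar> \<le> \<bar>C\<bar> * \<rho> powr \<gamma>'" if "0 < \<rho>" "\<rho> < min \<rho>1 1" "A' \<in> index_ball \<A> d A \<rho>" for \<rho> A'
  proof -
    have "C * \<rho> powr \<gamma> \<le> \<bar>C\<bar> * \<rho> powr \<gamma>'" using that assms(2) by (intro mult_mono powr_mono') auto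
    then show ?thesis using C(2)[of \<rho> A'] that by simp
  qed
  then show ?thesis unfolding hoelder_at_def using C(1) by (intro exI[of _ "\<bar>C\<bar>"] exI[of _ "min \<rho>1 1"]) auto
qed

lemma holder_exponent_alt: "holder_exponent \<A> d y A = Sup {ennreal \<gamma> | \<gamma>. \<gamma> \<ge> 0 \<and> hoelder_at y A \<gamma>}"
  unfolding holder_exponent_def hoelder_at_iff ..

end

section \<open>Moments of the jump measure and the choice of an order near the critical one\<close>

context levy
begin

text \<open>Jumps larger than \<open>1\<close> are controlled by \<open>x\<^sup>2\<close> because
  \<open>b \<le> 2\<close>.\<close>

lemma powr_moment_integrable:
  assumes "0 < b" "b \<le> 2" "(\<integral>\<^sup>+x\<in>{x. \<bar>x\<bar> \<le> 1}. ennreal (\<bar>x\<bar> powr b) \<partial>\<nu>) < \<infinity>"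
  shows "integrable \<nu> (\<lambda>x. \<bar>x\<bar> powr b)"
proof (rule integrableI_bounded)
  have "(\<integral>\<^sup>+x. ennreal (norm (\<bar>x\<bar> powr b)) \<partial>\<nu>) \<le>
      (\<integral>\<^sup>+x. ennreal (\<bar>x\<bar> powr b) * indicator {x. \<bar>x\<bar> \<le> 1} x + ennreal (x\<^sup>2) \<partial>\<nu>)"
  proof (rule nn_integral_mono)
    fix x :: real
    have "\<bar>x\<bar> powr b \<le> x\<^sup>2" if "1 < \<bar>x\<bar>"
    proof -
      have "\<bar>x\<bar> powr b \<le> \<bar>x\<bar> powr 2" using that assms(2) by (intro powr_mono) auto
      then show ?thesis using that by (simp add: powr_numeral)
    qed
    then show "ennreal (norm (\<bar>x\<bar> powr b)) \<le> ennreal (\<bar>x\<bar> powr b) * indicator {x. \<bar>x\<bar> \<le> 1} x + ennreal (x\<^sup>2)"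
      by (cases "\<bar>x\<bar> \<le> 1") (auto simp: ennreal_leI)
  qed
  also have "\<dots> = (\<integral>\<^sup>+x\<in>{x. \<bar>x\<bar> \<le> 1}. ennreal (\<bar>x\<bar> powr b) \<partial>\<nu>) + (\<integral>\<^sup>+x. ennreal (x\<^sup>2) \<partial>\<nu>)"
    by (intro nn_integral_add) measurable
  also have "\<dots> < \<infinity>" using assms(3) \<nu>_sq by simp
  finally show "(\<integral>\<^sup>+x. ennreal (norm (\<bar>x\<bar> powr b)) \<partial>\<nu>) < \<infinity>" .
qed measurable

lemma small_moment_mono:
  assumes "0 \<le> \<delta>" "\<delta> \<le> b" "(\<integral>\<^sup>+x\<in>{x. \<bar>x\<bar> \<le> 1}. ennreal (\<bar>x\<bar> powr \<delta>) \<partial>\<nu>) < \<infinity>"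
  shows "(\<integral>\<^sup>+x\<in>{x. \<bar>x\<bar> \<le> 1}. ennreal (\<bar>x\<bar> powr b) \<partial>\<nu>) < \<infinity>"
proof -
  have "(\<integral>\<^sup>+x\<in>{x. \<bar>x\<bar> \<le> 1}. ennreal (\<bar>x\<bar> powr b) \<partial>\<nu>) \<le> (\<integral>\<^sup>+x\<in>{x. \<bar>x\<bar> \<le> 1}. ennreal (\<bar>x\<bar> powr \<delta>) \<partial>\<nu>)"
    using assms(1,2) by (intro nn_integral_mono) (auto simp: indicator_def intro!: ennreal_leI powr_mono')
  then show ?thesis using assms(3) by (rule le_less_trans)
qed

lemma summable_iff: "small_jumps_summable \<nu> \<longleftrightarrow> (\<integral>\<^sup>+x\<in>{x. \<bar>x\<bar> \<le> 1}. ennreal (\<bar>x\<bar> powr 1) \<partial>\<nu>) < \<infinity>"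
  unfolding small_jumps_summable_def by simp

lemma blumenthal_getoor_nonneg: "0 \<le> blumenthal_getoor \<nu>"
  and blumenthal_getoor_le: "0 < b \<Longrightarrow> (\<integral>\<^sup>+x\<in>{x. \<bar>x\<bar> \<le> 1}. ennreal (\<bar>x\<bar> powr b) \<partial>\<nu>) < \<infinity> \<Longrightarrow> blumenthal_getoor \<nu> \<le> b"
  and blumenthal_getoor_less: "blumenthal_getoor \<nu> < b \<Longrightarrow> (\<integral>\<^sup>+x\<in>{x. \<bar>x\<bar> \<le> 1}. ennreal (\<bar>x\<bar> powr b) \<partial>\<nu>) < \<infinity>"
  and second_moment_small: "(\<integral>\<^sup>+x\<in>{x. \<bar>x\<bar> \<le> 1}. ennreal (\<bar>x\<bar> powr 2) \<partial>\<nu>) < \<infinity>"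
proof -
  let ?S = "{\<delta>. \<delta> > 0 \<and> (\<integral>\<^sup>+x\<in>{x. \<bar>x\<bar> \<le> 1}. ennreal (\<bar>x\<bar> powr \<delta>) \<partial>\<nu>) < \<infinity>}"
  have "(\<integral>\<^sup>+x\<in>{x. \<bar>x\<bar> \<le> 1}. ennreal (\<bar>x\<bar> powr 2) \<partial>\<nu>) \<le> (\<integral>\<^sup>+x. ennreal (x\<^sup>2) \<partial>\<nu>)"
    by (intro nn_integral_mono) (auto simp: indicator_def powr_numeral)
  then show sm: "(\<integral>\<^sup>+x\<in>{x. \<bar>x\<bar> \<le> 1}. ennreal (\<bar>x\<bar> powr 2) \<partial>\<nu>) < \<infinity>" using \<nu>_sq by (rule le_less_trans)
  have ne: "2 \<in> ?S" by (rule CollectI, rule conjI[OF _ sm], simp)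
  then have ne': "?S \<noteq> {}" by (metis empty_iff)
  show "0 \<le> blumenthal_getoor \<nu>" unfolding blumenthal_getoor_def
    by (rule cInf_greatest[OF ne']) simp
  show "0 < b \<Longrightarrow> (\<integral>\<^sup>+x\<in>{x. \<bar>x\<bar> \<le> 1}. ennreal (\<bar>x\<bar> powr b) \<partial>\<nu>) < \<infinity> \<Longrightarrow> blumenthal_getoor \<nu> \<le> b"
    unfolding blumenthal_getoor_def by (intro cInf_lower) (auto intro: bdd_belowI[of _ 0])
  assume lt: "blumenthal_getoor \<nu> < b"
  have "\<exists>\<delta>\<in>?S. \<delta> < b" by (rule cInf_lessD[OF ne' lt[unfolded blumenthal_getoor_def]])
  then obtain \<delta> where "\<delta> \<in> ?S" "\<delta> < b" by blast
  then show "(\<integral>\<^sup>+x\<in>{x. \<bar>x\<bar> \<le> 1}. ennreal (\<bar>x\<bar> powr b) \<partial>\<nu>) < \<infinity>"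
    using small_moment_mono[of \<delta> b] by auto
qed

text \<open>\<open>c\<close> is an order, \<open>1\<close> or \<open>2\<close>, whose moment is
  known to be finite. If \<open>\<beta> = c\<close>, then \<open>b = c\<close> works; otherwise the
  strict inequalities persist slightly to the right of \<open>\<beta>\<close>. The alternative
  \<open>\<gamma> < \<alpha>\<close> covers \<open>\<beta> = q' = 0\<close>: there the product form
  fails at \<open>\<beta>\<close> and yet holds for every \<open>b > 0\<close>.\<close>

lemma choose_moment:
  assumes \<gamma>: "\<gamma> * blumenthal_getoor \<nu> < q" "\<gamma> < \<alpha> \<or> (\<gamma> - \<alpha>) * blumenthal_getoor \<nu> < q'" and q': "q' \<ge> 0"
  shows "\<exists>b>0. integrable \<nu> (\<lambda>x. \<bar>x\<bar> powr b) \<and> (small_jumps_summable \<nu> \<longrightarrow> b \<le> 1) \<and>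
    (\<not> small_jumps_summable \<nu> \<longrightarrow> 1 \<le> b \<and> b \<le> 2) \<and> \<gamma> * b < q \<and> (\<gamma> - \<alpha>) * b < q'"
proof -
  define \<beta> where "\<beta> = blumenthal_getoor \<nu>"
  define c :: real where "c = (if small_jumps_summable \<nu> then 1 else 2)"
  have c: "0 < c" "c \<le> 2" "(\<integral>\<^sup>+x\<in>{x. \<bar>x\<bar> \<le> 1}. ennreal (\<bar>x\<bar> powr c) \<partial>\<nu>) < \<infinity>"
    unfolding c_def using second_moment_small summable_iff by auto
  have \<beta>: "0 \<le> \<beta>" "\<beta> \<le> c" unfolding \<beta>_def using blumenthal_getoor_nonneg blumenthal_getoor_le[OF c(1,3)] by auto
  have neg: "(\<gamma> - \<alpha>) * b < q'" if "\<gamma> < \<alpha>" "b > 0" for b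
  proof -
    have "(\<gamma> - \<alpha>) * b < 0" using that by (simp add: mult_neg_pos)
    then show ?thesis using q' by simp
  qed
  show ?thesis
  proof (cases "\<beta> = c")
    case True
    have "integrable \<nu> (\<lambda>x. \<bar>x\<bar> powr c)" by (rule powr_moment_integrable[OF c])
    moreover have "\<gamma> * c < q" "(\<gamma> - \<alpha>) * c < q'" using \<gamma> True neg[of c] c(1) unfolding \<beta>_def[symmetric] by auto
    ultimately show ?thesis using c(1) by (intro exI[of _ c]) (auto simp: c_def)
  next
    case False
    then have lt: "\<beta> < c" using \<beta> by simp
    have "\<forall>\<^sub>F b in at_right \<beta>. \<gamma> * b < q"
      using \<gamma>(1) unfolding \<beta>_def[symmetric] by (intro order_tendstoD(2)[of _ "\<gamma> * \<beta>"] tendsto_intros) auto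
    moreover have "\<forall>\<^sub>F b in at_right \<beta>. \<gamma> < \<alpha> \<or> (\<gamma> - \<alpha>) * b < q'"
    proof (cases "\<gamma> < \<alpha>")
      case False
      then have "(\<gamma> - \<alpha>) * \<beta> < q'" using \<gamma>(2) unfolding \<beta>_def by simp
      then have "\<forall>\<^sub>F b in at_right \<beta>. (\<gamma> - \<alpha>) * b < q'"
        by (intro order_tendstoD(2)[of _ "(\<gamma> - \<alpha>) * \<beta>"] tendsto_intros) auto
      then show ?thesis by eventually_elim simp
    qed simp
    moreover have "\<forall>\<^sub>F b in at_right \<beta>. \<beta> < b \<and> b < c"
      using lt by (auto simp: eventually_at_right_field)
    ultimately have "\<forall>\<^sub>F b in at_right \<beta>. \<gamma> * b < q \<and> (\<gamma> < \<alpha> \<or> (\<gamma> - \<alpha>) * b < q') \<and> \<beta> < b \<and> b < c"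
      by eventually_elim simp
    then obtain b where b: "\<gamma> * b < q" "\<gamma> < \<alpha> \<or> (\<gamma> - \<alpha>) * b < q'" "\<beta> < b" "b < c"
      using eventually_happens[of _ "at_right \<beta>"] by auto
    have b0: "0 < b" using b(3) \<beta>(1) by simp
    have fin: "(\<integral>\<^sup>+x\<in>{x. \<bar>x\<bar> \<le> 1}. ennreal (\<bar>x\<bar> powr b) \<partial>\<nu>) < \<infinity>"
      using blumenthal_getoor_less b(3) unfolding \<beta>_def by simp
    have "integrable \<nu> (\<lambda>x. \<bar>x\<bar> powr b)" using b0 b(4) c(2) fin by (intro powr_moment_integrable) auto
    moreover have "1 \<le> b" if "\<not> small_jumps_summable \<nu>"
      using small_moment_mono[of b 1] b0 fin that summable_iff by force
    moreover have "(\<gamma> - \<alpha>) * b < q'" using b(2) neg[OF _ b0] by blast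
    ultimately show ?thesis using b0 b c(2) by (intro exI[of _ b]) (auto simp: c_def split: if_splits)
  qed
qed

end

text \<open>With \<open>0/0 = 0\<close> the hypothesis excludes \<open>q = \<beta> = 0\<close>,
  where the strict product form would fail.\<close>

lemma quot_lower_less:
  assumes "ennreal \<gamma> < quot_lower q \<beta>" "\<gamma> \<ge> 0" "q \<ge> 0" "\<beta> \<ge> 0"
  shows "\<gamma> * \<beta> < q"
proof (cases "\<beta> = 0")
  case True
  then have "q \<noteq> 0" using assms by (auto simp: quot_lower_def)
  then show ?thesis using assms True by simp
next
  case False
  then have "\<gamma> < q / \<beta>" using assms by (simp add: quot_lower_def divide_ennreal ennreal_less_iff)
  then show ?thesis using False assms by (simp add: field_simps)
qed

text \<open>For \<open>q = \<beta> = 0\<close> the hypothesis only says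
  \<open>\<gamma> < \<alpha>\<close>, hence the disjunction.\<close>

lemma quot_lower_add_less:
  assumes "ennreal \<gamma> < quot_lower q \<beta> + ennreal \<alpha>" "\<gamma> \<ge> 0" "q \<ge> 0" "\<beta> \<ge> 0" "\<alpha> \<ge> 0"
  shows "\<gamma> < \<alpha> \<or> (\<gamma> - \<alpha>) * \<beta> < q"
proof (cases "\<beta> = 0")
  case True
  show ?thesis
  proof (cases "q = 0")
    case q: True
    then have "ennreal \<gamma> < ennreal \<alpha>" using assms(1) by (simp add: quot_lower_def)
    then show ?thesis using assms by (simp add: ennreal_less_iff)
  qed (use True assms in simp)
next
  case False
  then have "ennreal \<gamma> < ennreal (q / \<beta> + \<alpha>)" using assms by (simp add: quot_lower_def divide_ennreal)
  then have "\<gamma> < q / \<beta> + \<alpha>" using ennreal_less_iff[OF assms(2)] by blast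
  then show ?thesis using False assms by (simp add: field_simps)
qed

section \<open>Failure of the Hoelder property, and passage to the exponent\<close>

context levy_m
begin

text \<open>
  Points of \<open>D - A\<close> are detected along a chain from \<open>A \<inter> D\<close> to \<open>D\<close>, points of \<open>A - D\<close> along one
  from \<open>A \<inter> D\<close> to \<open>A\<close>; all members of both chains are within \<open>2 d(A, D)\<close> of \<open>A\<close>.
\<close>

lemma jump_near:
  assumes A: "A \<in> \<A>" and f: "f \<in> borel_measurable m" "\<And>D. D \<in> \<A> \<Longrightarrow> integrable m (\<lambda>t. (f t * indicator D t)\<^sup>2)"
    and bound: "\<And>s. s \<in> victiny \<A> d A \<rho>0 \<Longrightarrow> \<bar>f s\<bar> \<le> K"
  shows "AE \<omega> in P. \<forall>\<rho>\<le>\<rho>0. \<forall>(t, x)\<in>\<Xi> \<omega>. t \<in> victiny \<A> d A \<rho> \<longrightarrow> x \<noteq> 0 \<longrightarrow> (\<forall>\<eta>>0. \<exists>V\<in>index_ball \<A> d A (2 * \<rho>).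
    \<bar>f t * x\<bar> - \<eta> \<le> 2 * \<bar>jump_integral m \<nu> \<Xi> f A \<omega> - jump_integral m \<nu> \<Xi> f V \<omega>\<bar>)"
proof -
  \<comment> \<open>Victinies are unions over the skeleton, so countably many \<open>D\<close>
    suffice and their null sets can be united.\<close>
  define X where "X = {D\<in>skeleton. d A D < \<rho>0}"
  have X: "countable X" unfolding X_def using countable_skeleton by (rule countable_subset[rotated]) auto
  let ?Q = "\<lambda>U D \<omega>. \<forall>(t, x)\<in>\<Xi> \<omega>. t \<in> D - U \<longrightarrow> x \<noteq> 0 \<longrightarrow> (\<forall>\<eta>>0. \<exists>V\<in>\<A>. \<exists>V'\<in>\<A>.
    U \<subseteq> V \<and> V \<subseteq> D \<and> U \<subseteq> V' \<and> V' \<subseteq> D \<and>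
    \<bar>f t * x\<bar> - \<eta> \<le> \<bar>jump_integral m \<nu> \<Xi> f V \<omega> - jump_integral m \<nu> \<Xi> f V' \<omega>\<bar>)"
  have "AE \<omega> in P. ?Q (A \<inter> D) D \<omega> \<and> ?Q (A \<inter> D) A \<omega>" if D: "D \<in> X" for D
  proof -
    have DA: "D \<in> \<A>" "d A D < \<rho>0" using D skeleton_subset by (auto simp: X_def)
    have sub: "sym_diff A D \<subseteq> victiny \<A> d A \<rho>0" unfolding victiny_def index_ball_def using DA by blast
    have "AE \<omega> in P. ?Q (A \<inter> D) D \<omega>"
      by (rule jump_detection[OF Int_mem[OF A DA(1)] DA(1) _ f(1) f(2)[OF DA(1)] bound]) (use sub in auto)
    moreover have "AE \<omega> in P. ?Q (A \<inter> D) A \<omega>"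
      by (rule jump_detection[OF Int_mem[OF A DA(1)] A _ f(1) f(2)[OF A] bound]) (use sub in auto)
    ultimately show ?thesis by eventually_elim blast
  qed
  then have "AE \<omega> in P. \<forall>D\<in>X. ?Q (A \<inter> D) D \<omega> \<and> ?Q (A \<inter> D) A \<omega>"
    using X by (subst AE_ball_countable) auto
  then show ?thesis
  proof eventually_elim
    case (elim \<omega>)
    let ?Y = "\<lambda>V. jump_integral m \<nu> \<Xi> f V \<omega>"
    have "\<exists>V\<in>index_ball \<A> d A (2 * \<rho>). \<bar>f t * x\<bar> - \<eta> \<le> 2 * \<bar>?Y A - ?Y V\<bar>"
      if \<rho>: "\<rho> \<le> \<rho>0" and tx: "(t, x) \<in> \<Xi> \<omega>" "t \<in> victiny \<A> d A \<rho>" "x \<noteq> 0" and \<eta>: "\<eta> > 0" for \<rho> t x \<eta>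
    proof -
      obtain D where D: "D \<in> skeleton" "d A D < \<rho>" "t \<in> sym_diff A D" using tx(2) unfolding victiny_eq[OF A] by blast
      then have DX: "D \<in> X" using \<rho> by (simp add: X_def)
      have DA: "D \<in> \<A>" using D skeleton_subset by blast
      have Q: "?Q (A \<inter> D) D \<omega>" "?Q (A \<inter> D) A \<omega>"
        using conjunct1[OF bspec[OF elim DX]] conjunct2[OF bspec[OF elim DX]] .
      have "\<exists>D'. (D' = D \<or> D' = A) \<and> (\<exists>V\<in>\<A>. \<exists>V'\<in>\<A>. A \<inter> D \<subseteq> V \<and> V \<subseteq> D' \<and> A \<inter> D \<subseteq> V' \<and> V' \<subseteq> D' \<and>
        \<bar>f t * x\<bar> - \<eta> \<le> \<bar>?Y V - ?Y V'\<bar>)"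
      proof (cases "t \<in> D")
        case True
        then have t: "t \<in> D - A \<inter> D" using D(3) by auto
        show ?thesis
          using bspec[OF Q(1) tx(1), unfolded prod.case, rule_format, OF t tx(3) \<eta>] by (intro exI[of _ D] conjI disjI1 refl)
      next
        case False
        then have t: "t \<in> A - A \<inter> D" using D(3) by auto
        show ?thesis
          using bspec[OF Q(2) tx(1), unfolded prod.case, rule_format, OF t tx(3) \<eta>] by (intro exI[of _ A] conjI disjI2 refl)
      qed
      then obtain D' V V' where D': "D' = D \<or> D' = A" "V \<subseteq> D'" "V' \<subseteq> D'"
        and V1: "V \<in> \<A>" "V' \<in> \<A>" "A \<inter> D \<subseteq> V" "A \<inter> D \<subseteq> V'" "\<bar>f t * x\<bar> - \<eta> \<le> \<bar>?Y V - ?Y V'\<bar>" by auto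
      have V: "V \<in> \<A>" "V' \<in> \<A>" "A \<inter> D \<subseteq> V" "V \<subseteq> D \<or> V \<subseteq> A" "A \<inter> D \<subseteq> V'" "V' \<subseteq> D \<or> V' \<subseteq> A"
        "\<bar>f t * x\<bar> - \<eta> \<le> \<bar>?Y V - ?Y V'\<bar>"
        using D' V1 by auto
      have ball: "V \<in> index_ball \<A> d A (2 * \<rho>)" "V' \<in> index_ball \<A> d A (2 * \<rho>)"
        unfolding index_ball_def using between[OF A DA V(1,3,4)] between[OF A DA V(2,5,6)] V(1,2) D(2) by auto
      \<comment> \<open>Detection yields two sets, whereas the ball compares with \<open>A\<close>:
        one of them accounts for at least half of the difference, whence the factor
        \<open>2\<close>.\<close>
      have "\<bar>?Y V - ?Y V'\<bar> \<le> \<bar>?Y A - ?Y V\<bar> + \<bar>?Y A - ?Y V'\<bar>" by linarith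
      then have "\<bar>f t * x\<bar> - \<eta> \<le> 2 * \<bar>?Y A - ?Y V\<bar> \<or> \<bar>f t * x\<bar> - \<eta> \<le> 2 * \<bar>?Y A - ?Y V'\<bar>" using V(7) by argo
      then show ?thesis using ball by blast
    qed
    then show ?case by auto
  qed
qed

text \<open>Largeness compares \<open>|f t|\<close> with the divergence, which may be far below
  \<open>\<rho>\<close>. A radius \<open>\<rho>'\<close> just above the divergence is a scale at
  which \<open>t\<close> is still visible and \<open>|f t|\<close> still beats
  \<open>\<rho>' powr \<alpha>\<close>.\<close>

lemma large_set_scale:
  assumes t: "t \<in> victiny \<A> d A \<rho>" "t \<in> large_set T \<A> d f \<alpha> A" and A: "A \<in> \<A>" and \<alpha>: "\<alpha> \<ge> 0"
  shows "\<exists>\<rho>'. 0 < \<rho>' \<and> \<rho>' < \<rho> \<and> t \<in> victiny \<A> d A \<rho>' \<and> \<rho>' powr \<alpha> < \<bar>f t\<bar>"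
proof -
  have pos: "\<rho>' > 0" if "t \<in> victiny \<A> d A \<rho>'" for \<rho>'
    using that d_props(2)[OF A] unfolding victiny_def index_ball_def by fastforce
  obtain \<rho>1 where \<rho>1: "\<rho>1 < \<rho>" "t \<in> victiny \<A> d A \<rho>1" using victiny_shrink[OF t(1)] by blast
  have \<rho>1p: "\<rho>1 > 0" using pos[OF \<rho>1(2)] .
  have big: "ennpow (divergence \<A> d t A) \<alpha> < ennreal \<bar>f t\<bar>" using t(2) by (simp add: large_set_def)
  show ?thesis
  proof (cases "\<alpha> = 0")
    case True
    then have "ennreal 1 < ennreal \<bar>f t\<bar>" using big by (simp add: ennpow_def)
    then have "1 < \<bar>f t\<bar>" by (metis ennreal_less_iff zero_le_one)
    then show ?thesis using \<rho>1 \<rho>1p True by (intro exI[of _ \<rho>1]) auto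
  next
    case False
    then have \<alpha>p: "\<alpha> > 0" using \<alpha> by simp
    have dle: "divergence \<A> d t A \<le> ennreal \<rho>1" by (rule divergence_le[OF \<rho>1p \<rho>1(2)])
    then have dfin: "divergence \<A> d t A \<noteq> \<infinity>" by (auto simp: top_unique)
    define \<theta> where "\<theta> = enn2real (divergence \<A> d t A)"
    have \<theta>: "divergence \<A> d t A = ennreal \<theta>" "\<theta> \<ge> 0" using dfin by (auto simp: \<theta>_def less_top)
    have \<theta>\<rho>: "\<theta> < \<rho>" using dle \<rho>1(1) \<rho>1p unfolding \<theta>(1) by (simp add: ennreal_le_iff)
    have "ennreal (\<theta> powr \<alpha>) < ennreal \<bar>f t\<bar>" using big False dfin by (simp add: ennpow_def \<theta>_def)
    then have lt: "\<theta> powr \<alpha> < \<bar>f t\<bar>" by (simp add: ennreal_less_iff)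
    \<comment> \<open>The radius whose power \<open>\<alpha>\<close> equals \<open>|f t|\<close>; a
      radius of a victiny containing \<open>t\<close> serves as soon as it is below
      \<open>min z \<rho>\<close>.\<close>
    define z where "z = \<bar>f t\<bar> powr (1 / \<alpha>)"
    have fp: "\<bar>f t\<bar> > 0" using lt powr_ge_zero[of \<theta> \<alpha>] by linarith
    have z\<alpha>: "z powr \<alpha> = \<bar>f t\<bar>" unfolding z_def using \<alpha>p fp by (simp add: powr_powr)
    have \<theta>z: "\<theta> < z"
    proof (rule ccontr)
      assume "\<not> \<theta> < z"
      then have "z powr \<alpha> \<le> \<theta> powr \<alpha>" using \<alpha>p by (intro powr_mono2) (auto simp: z_def)
      then show False using lt z\<alpha> by simp
    qed
    have "divergence \<A> d t A < ennreal (min z \<rho>)" unfolding \<theta>(1) using \<theta>z \<theta>\<rho> \<theta>(2) by (intro ennreal_lessI) auto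
    then obtain \<rho>' where \<rho>': "\<rho>' > 0" "ennreal \<rho>' < ennreal (min z \<rho>)" "t \<in> victiny \<A> d A \<rho>'"
      unfolding divergence_less_iff by blast
    have m: "\<rho>' < min z \<rho>" using \<rho>'(1,2) by (simp add: ennreal_less_iff)
    then have "\<rho>' powr \<alpha> < z powr \<alpha>" using \<rho>'(1) \<alpha>p by (intro powr_less_mono2) auto
    then show ?thesis using \<rho>' m z\<alpha> by (intro exI[of _ \<rho>']) auto
  qed
qed

text \<open>A point of \<open>G n\<close> gives
  \<open>|f t * x| \<ge> \<rho>' powr \<alpha> * r n\<close> at a scale
  \<open>\<rho>' < \<rho> n\<close>, while the Hoelder property forces \<open>|f t * x|\<close>
  below a multiple of \<open>\<rho>' powr \<gamma>\<close>. As
  \<open>r n = \<rho> n powr (q1 / \<delta>)\<close> with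
  \<open>q1 / \<delta> < \<gamma> - \<alpha>\<close>, the two clash for small radii.\<close>

lemma hoelder_upper:
  assumes A: "A \<in> \<A>" and f: "f \<in> borel_measurable m" "\<And>D. D \<in> \<A> \<Longrightarrow> integrable m (\<lambda>t. (f t * indicator D t)\<^sup>2)"
    and \<rho>0: "\<rho>0 > 0" "\<And>s. s \<in> victiny \<A> d A \<rho>0 \<Longrightarrow> \<bar>f s\<bar> \<le> K"
    and region: "(\<alpha>, q) \<in> upper_region T \<A> d m f A"
    and \<beta>: "blumenthal_getoor \<nu> > 0" and \<gamma>: "q < (\<gamma> - \<alpha>) * blumenthal_getoor \<nu>"
  shows "AE \<omega> in P. \<not> hoelder_at (\<lambda>A'. jump_integral m \<nu> \<Xi> f A' \<omega>) A \<gamma>"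
proof -
  define L where "L = large_set T \<A> d f \<alpha> A"
  define V where "V = victiny \<A> d A"
  have Lm[measurable]: "L \<in> sets m" unfolding L_def using A f(1) by simp
  have Vm[measurable]: "V r \<in> sets m" for r unfolding V_def using A by simp
  have \<alpha>q: "\<alpha> \<ge> 0" "q \<ge> 0" and lim: "Liminf (at_right 0) (\<lambda>\<rho>. emeasure m (V \<rho> \<inter> L) / ennreal (\<rho> powr q)) > 0"
    using region unfolding upper_region_def L_def V_def by auto
  define g where "g = \<gamma> - \<alpha>"
  have g: "g > 0"
  proof -
    have "0 < g * blumenthal_getoor \<nu>" using \<gamma> \<alpha>q(2) by (simp add: g_def)
    then show ?thesis using \<beta> by (simp add: zero_less_mult_iff)
  qed
  have "q / g < blumenthal_getoor \<nu>" using \<gamma> g by (simp add: g_def field_simps)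
  then obtain \<delta> where \<delta>: "q / g < \<delta>" "\<delta> < blumenthal_getoor \<nu>" using dense by blast
  have \<delta>0: "\<delta> > 0" using \<delta>(1) g \<alpha>q(2) by (meson divide_nonneg_pos le_less_trans)
  have "q < g * \<delta>" using \<delta>(1) g by (simp add: field_simps)
  \<comment> \<open>\<open>q\<close> may be \<open>0\<close>, but the radius
    \<open>r powr (\<delta> / q1)\<close> needs a positive exponent;
    \<open>q1 < g * \<delta>\<close> leaves the margin for the contradiction.\<close>
  then obtain q1 where q1: "q < q1" "q1 < g * \<delta>" using dense by blast
  have q10: "q1 > 0" using q1 \<alpha>q by simp
  obtain c where c: "c > 0" "\<forall>\<^sub>F \<rho> in at_right 0. ennreal c < emeasure m (V \<rho> \<inter> L) / ennreal (\<rho> powr q)"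
  proof -
    obtain c' where c': "0 < c'" "c' < Liminf (at_right 0) (\<lambda>\<rho>. emeasure m (V \<rho> \<inter> L) / ennreal (\<rho> powr q))"
      using dense[OF lim] by blast
    have "c' < \<infinity>" using less_le_trans[OF c'(2) top_greatest] by simp
    then have e: "c' = ennreal (enn2real c')" "enn2real c' > 0" using c'(1) by (auto simp: less_top enn2real_positive_iff)
    show ?thesis using that[OF e(2)] less_LiminfD[OF c'(2)] e(1) by simp
  qed
  then obtain \<rho>1 :: real where \<rho>1: "\<rho>1 > 0" "\<And>\<rho>. 0 < \<rho> \<Longrightarrow> \<rho> < \<rho>1 \<Longrightarrow> ennreal c < emeasure m (V \<rho> \<inter> L) / ennreal (\<rho> powr q)"
    unfolding eventually_at_right_field by auto
  have mL: "ennreal (c * \<rho> powr q1) \<le> emeasure m (V \<rho> \<inter> L)" if "0 < \<rho>" "\<rho> < min \<rho>1 1" for \<rho>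
  proof -
    have "ennreal (c * \<rho> powr q1) \<le> ennreal (c * \<rho> powr q)"
      using that c q1 by (intro ennreal_leI mult_left_mono powr_mono') auto
    also have "\<dots> = ennreal c * ennreal (\<rho> powr q)" using c by (simp add: ennreal_mult)
    also have "\<dots> \<le> emeasure m (V \<rho> \<inter> L) / ennreal (\<rho> powr q) * ennreal (\<rho> powr q)"
      using \<rho>1(2)[of \<rho>] that by (intro mult_right_mono) auto
    also have "\<dots> = emeasure m (V \<rho> \<inter> L)"
      using that by (cases "emeasure m (V \<rho> \<inter> L)") (auto simp: divide_ennreal ennreal_mult[symmetric] ennreal_top_divide ennreal_top_mult)
    finally show ?thesis .
  qed
  \<comment> \<open>The tail bound is available only along certain jump sizes. These are picked
    first, and the radii of the victinies are derived from them.\<close>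
  have "\<exists>r>0. r powr (\<delta> / q1) < min (min \<rho>1 1) (1 / real (Suc n)) \<and> real n / c < r powr \<delta> * measure \<nu> {x. r \<le> \<bar>x\<bar>}" for n
  proof -
    define s where "s = min (min \<rho>1 1) (1 / real (Suc n))"
    have s: "s > 0" using \<rho>1 by (simp add: s_def)
    obtain r where r: "0 < r" "r < s powr (q1 / \<delta>)" "real n / c < r powr \<delta> * measure \<nu> {x. r \<le> \<bar>x\<bar>}"
      using blumenthal_getoor_tail[OF \<delta>0 \<delta>(2), of "s powr (q1 / \<delta>)"] s by auto
    have "r powr (\<delta> / q1) < (s powr (q1 / \<delta>)) powr (\<delta> / q1)" using r \<delta>0 q10 by (intro powr_less_mono2) auto
    also have "\<dots> = s" using s \<delta>0 q10 by (simp add: powr_powr)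
    finally show ?thesis using r unfolding s_def by blast
  qed
  then obtain r where r: "\<And>n. r n > 0" "\<And>n. r n powr (\<delta> / q1) < min (min \<rho>1 1) (1 / real (Suc n))"
    "\<And>n. real n / c < r n powr \<delta> * measure \<nu> {x. r n \<le> \<bar>x\<bar>}" by metis
  define \<rho> where "\<rho> n = r n powr (\<delta> / q1)" for n
  have \<rho>: "\<rho> n > 0" "\<rho> n < \<rho>1" "\<rho> n < 1" "\<rho> n < 1 / real (Suc n)" for n
    using r(1)[of n] r(2)[of n] unfolding \<rho>_def by auto
  have r\<rho>: "r n = \<rho> n powr (q1 / \<delta>)" for n unfolding \<rho>_def using r(1)[of n] \<delta>0 q10 by (simp add: powr_powr)
  define G where "G n = (V (\<rho> n) \<inter> L) \<times> {x. r n \<le> \<bar>x\<bar>}" for n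
  have Gm: "G n \<in> sets (m \<Otimes>\<^sub>M \<nu>)" for n unfolding G_def by (intro pair_measureI) auto
  \<comment> \<open>Intensity at least \<open>n\<close> makes the void probabilities at most
    \<open>exp (- n)\<close>, which is summable; for this the tail was asked to exceed
    \<open>n / c\<close>.\<close>
  have Gn: "ennreal (real n) \<le> emeasure (m \<Otimes>\<^sub>M \<nu>) (G n)" for n
  proof -
    have "\<rho> n powr q1 = r n powr \<delta>" unfolding \<rho>_def using q10 by (simp add: powr_powr)
    then have "real n \<le> c * \<rho> n powr q1 * measure \<nu> {x. r n \<le> \<bar>x\<bar>}" using r(3)[of n] c by (simp add: field_simps)
    then have "ennreal (real n) \<le> ennreal (c * \<rho> n powr q1) * ennreal (measure \<nu> {x. r n \<le> \<bar>x\<bar>})"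
      using c by (simp add: ennreal_mult[symmetric] ennreal_leI)
    also have "\<dots> \<le> emeasure m (V (\<rho> n) \<inter> L) * emeasure \<nu> {x. r n \<le> \<bar>x\<bar>}"
      using mL[of "\<rho> n"] \<rho>[of n] \<nu>_large[OF r(1)[of n]] by (intro mult_mono) (auto simp: emeasure_eq_ennreal_measure less_top)
    also have "\<dots> = emeasure (m \<Otimes>\<^sub>M \<nu>) (G n)" unfolding G_def by (intro emeasure_times_\<nu>[symmetric]) auto
    finally show ?thesis .
  qed
  have "AE \<omega> in P. eventually (\<lambda>n. \<omega> \<in> space P - {\<omega>\<in>space P. point_count \<Xi> (G n) \<omega> = 0}) sequentially"
  proof (rule borel_cantelli_AE1)
    show "{\<omega>\<in>space P. point_count \<Xi> (G n) \<omega> = 0} \<in> sets P" for n using Gm by measurable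
    show "emeasure P {\<omega>\<in>space P. point_count \<Xi> (G n) \<omega> = 0} < \<infinity>" for n by (simp add: emeasure_eq_measure)
    have "exp (- real n) = exp (-1) ^ n" for n by (simp add: exp_of_nat_mult[symmetric])
    then have "summable (\<lambda>n. exp (- real n))" by (simp add: summable_geometric)
    then show "summable (\<lambda>n. prob {\<omega>\<in>space P. point_count \<Xi> (G n) \<omega> = 0})"
      by (rule summable_comparison_test'[where N=0]) (use prob_no_points[OF Gm Gn] in auto)
  qed
  moreover have "AE \<omega> in P. \<forall>\<rho>\<le>\<rho>0. \<forall>(t, x)\<in>\<Xi> \<omega>. t \<in> V \<rho> \<longrightarrow> x \<noteq> 0 \<longrightarrow> (\<forall>\<eta>>0. \<exists>V\<in>index_ball \<A> d A (2 * \<rho>).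
    \<bar>f t * x\<bar> - \<eta> \<le> 2 * \<bar>jump_integral m \<nu> \<Xi> f A \<omega> - jump_integral m \<nu> \<Xi> f V \<omega>\<bar>)"
    unfolding V_def by (rule jump_near[OF A f \<rho>0(2)])
  ultimately show ?thesis
  proof eventually_elim
    case (elim \<omega>)
    let ?Y = "\<lambda>V. jump_integral m \<nu> \<Xi> f V \<omega>"
    obtain N0 where N0: "\<And>n. n \<ge> N0 \<Longrightarrow> \<exists>p. p \<in> \<Xi> \<omega> \<inter> G n"
    proof -
      from elim(1) obtain N0 where N0: "\<And>n. n \<ge> N0 \<Longrightarrow> point_count \<Xi> (G n) \<omega> \<noteq> 0" unfolding eventually_sequentially by blast
      have "\<exists>p. p \<in> \<Xi> \<omega> \<inter> G n" if "n \<ge> N0" for n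
      proof (rule ccontr)
        assume "\<nexists>p. p \<in> \<Xi> \<omega> \<inter> G n"
        then have "\<Xi> \<omega> \<inter> G n = {}" by blast
        then show False using N0[OF that] by (simp add: point_count_def)
      qed
      then show ?thesis by (rule that)
    qed
    have near: "\<exists>V\<in>index_ball \<A> d A (2 * \<rho>'). \<bar>f t * x\<bar> - \<eta> \<le> 2 * \<bar>?Y A - ?Y V\<bar>"
      if "\<rho>' \<le> \<rho>0" "(t, x) \<in> \<Xi> \<omega>" "t \<in> V \<rho>'" "x \<noteq> 0" "\<eta> > 0" for \<rho>' t x \<eta>
      using elim(2)[rule_format, OF that(1,2), unfolded prod.case, rule_format, OF that(3,4,5)] .
    show ?case
    proof
      assume "hoelder_at ?Y A \<gamma>"
      then obtain C \<rho>2 where C: "\<rho>2 > 0" "\<And>\<rho> A'. 0 < \<rho> \<Longrightarrow> \<rho> < \<rho>2 \<Longrightarrow> A' \<in> index_ball \<A> d A \<rho> \<Longrightarrow> \<bar>?Y A - ?Y A'\<bar> \<le> C * \<rho> powr \<gamma>"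
        unfolding hoelder_at_def by blast
      define \<kappa> where "\<kappa> = g - q1 / \<delta>"
      have \<kappa>: "\<kappa> > 0" using q1(2) \<delta>0 by (simp add: \<kappa>_def field_simps)
      \<comment> \<open>\<open>4\<close> is \<open>2\<close> from \<open>jump_near\<close> times
        \<open>2\<close> for giving up half of the jump as \<open>\<eta>\<close>;
        \<open>2 powr \<gamma>\<close> stems from the ball of radius
        \<open>2 * \<rho>'\<close>.\<close>
      define M where "M = 4 * \<bar>C\<bar> * 2 powr \<gamma>"
      \<comment> \<open>The last entry brings \<open>M * \<rho> n powr \<kappa>\<close> down to
        \<open>M / (M + 1) < 1\<close>; the others keep the radii within reach of
        \<open>jump_near\<close> and of the Hoelder estimate.\<close>
      define s where "s = min (min \<rho>0 (\<rho>2 / 2)) ((1 / (M + 1)) powr (1 / \<kappa>))"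
      have M: "M \<ge> 0" by (simp add: M_def)
      have s: "s > 0" using \<rho>0 C(1) M by (simp add: s_def)
      obtain N1 where N1: "inverse (real (Suc N1)) < s" using reals_Archimedean[OF s] by blast
      define n where "n = max N0 N1"
      have \<rho>s: "\<rho> n < s"
      proof -
        have "1 / real (Suc n) \<le> 1 / real (Suc N1)" by (simp add: n_def field_simps)
        then show ?thesis using \<rho>(4)[of n] N1 by (simp add: inverse_eq_divide)
      qed
      obtain t x where tx: "(t, x) \<in> \<Xi> \<omega>" "t \<in> V (\<rho> n)" "t \<in> L" "r n \<le> \<bar>x\<bar>"
        using N0[of n] unfolding n_def G_def by auto
      have x: "x \<noteq> 0" using tx(4) r(1)[of n] by auto
      obtain \<rho>' where \<rho>': "0 < \<rho>'" "\<rho>' < \<rho> n" "t \<in> V \<rho>'" "\<rho>' powr \<alpha> < \<bar>f t\<bar>"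
        using large_set_scale[OF _ _ A \<alpha>q(1), of t "\<rho> n" f] tx(2,3) unfolding V_def L_def by blast
      have ft: "\<bar>f t\<bar> > 0" using \<rho>'(4) powr_ge_zero[of \<rho>' \<alpha>] by linarith
      then have p: "\<bar>f t * x\<bar> > 0" using x by auto
      have le0: "\<rho>' \<le> \<rho>0" "2 * \<rho>' < \<rho>2" using \<rho>'(2) \<rho>s unfolding s_def by auto
      have "\<bar>f t * x\<bar> / 2 > 0" using p by simp
      from near[OF le0(1) tx(1) \<rho>'(3) x this] obtain W where W: "W \<in> index_ball \<A> d A (2 * \<rho>')"
        "\<bar>f t * x\<bar> - \<bar>f t * x\<bar> / 2 \<le> 2 * \<bar>?Y A - ?Y W\<bar>" by blast
      have "\<bar>f t * x\<bar> \<le> 4 * \<bar>?Y A - ?Y W\<bar>" using W(2) by simp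
      also have "\<dots> \<le> 4 * (\<bar>C\<bar> * (2 * \<rho>') powr \<gamma>)"
      proof -
        have "\<bar>?Y A - ?Y W\<bar> \<le> C * (2 * \<rho>') powr \<gamma>" using C(2)[OF _ le0(2) W(1)] \<rho>'(1) by simp
        also have "\<dots> \<le> \<bar>C\<bar> * (2 * \<rho>') powr \<gamma>" by (intro mult_right_mono) auto
        finally show ?thesis by simp
      qed
      also have "\<dots> = M * \<rho>' powr \<gamma>" using \<rho>'(1) by (simp add: M_def powr_mult)
      finally have ub: "\<bar>f t * x\<bar> \<le> M * \<rho>' powr \<gamma>" .
      have "\<rho>' powr \<alpha> * r n \<le> \<bar>f t * x\<bar>" unfolding abs_mult using \<rho>'(4) tx(4) r(1)[of n] by (intro mult_mono) auto
      with ub have "\<rho>' powr \<alpha> * r n \<le> \<rho>' powr \<alpha> * (M * \<rho>' powr g)"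
        unfolding g_def using \<rho>'(1) by (simp add: powr_diff field_simps)
      then have "r n \<le> M * \<rho>' powr g" using \<rho>'(1) by simp
      \<comment> \<open>After division by \<open>\<rho>' powr \<alpha>\<close> the unknown scale
        survives only in the power \<open>g > 0\<close>, so it may be enlarged to
        \<open>\<rho> n\<close>.\<close>
      also have "\<dots> \<le> M * \<rho> n powr g" using \<rho>' g M by (intro mult_left_mono powr_mono2) auto
      also have "\<rho> n powr g = \<rho> n powr (q1 / \<delta>) * \<rho> n powr \<kappa>" unfolding \<kappa>_def by (simp add: powr_add[symmetric])
      finally have "\<rho> n powr (q1 / \<delta>) * 1 \<le> \<rho> n powr (q1 / \<delta>) * (M * \<rho> n powr \<kappa>)" unfolding r\<rho> by (simp add: mult_ac)
      then have "1 \<le> M * \<rho> n powr \<kappa>" using \<rho>(1)[of n] by (subst (asm) mult_le_cancel_left_pos) auto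
      also have "\<dots> \<le> M * ((1 / (M + 1)) powr (1 / \<kappa>)) powr \<kappa>"
        using \<rho>s \<rho>(1)[of n] \<kappa> M by (intro mult_left_mono powr_mono2) (auto simp: s_def)
      also have "\<dots> = M / (M + 1)" using M \<kappa> by (simp add: powr_powr)
      also have "\<dots> < 1" using M by simp
      finally show False by simp
    qed
  qed
qed

text \<open>
  The regions are uncountable, but the Hoelder property at \<open>\<gamma>\<close> does not mention them, so it
  suffices to exclude null sets for rational \<open>\<gamma>\<close>.
\<close>

lemma hoelder_exponent_bounds:
  assumes A: "A \<in> \<A>" and f: "f \<in> borel_measurable m" "\<And>D. D \<in> \<A> \<Longrightarrow> integrable m (\<lambda>t. (f t * indicator D t)\<^sup>2)"
    and \<rho>0: "\<rho>0 > 0" "\<And>s. s \<in> victiny \<A> d A \<rho>0 \<Longrightarrow> \<bar>f s\<bar> \<le> K"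
  shows "AE \<omega> in P.
    (SUP (\<alpha>, q, q')\<in>lower_region T \<A> d m f A.
        min (quot_lower q (blumenthal_getoor \<nu>)) (quot_lower q' (blumenthal_getoor \<nu>) + ennreal \<alpha>))
      \<le> holder_exponent \<A> d (\<lambda>A'. jump_integral m \<nu> \<Xi> f A' \<omega>) A \<and>
    holder_exponent \<A> d (\<lambda>A'. jump_integral m \<nu> \<Xi> f A' \<omega>) A
      \<le> (INF (\<alpha>, q)\<in>upper_region T \<A> d m f A. quot_upper q (blumenthal_getoor \<nu>) + ennreal \<alpha>)"
proof -
  define \<beta> where "\<beta> = blumenthal_getoor \<nu>"
  have \<beta>0: "\<beta> \<ge> 0" unfolding \<beta>_def by (rule blumenthal_getoor_nonneg)
  define LQ where "LQ = {\<gamma>\<in>\<rat>. \<gamma> \<ge> 0 \<and> (\<exists>\<alpha> q q'. (\<alpha>, q, q') \<in> lower_region T \<A> d m f A \<and>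
    \<gamma> * \<beta> < q \<and> (\<gamma> < \<alpha> \<or> (\<gamma> - \<alpha>) * \<beta> < q'))}"
  define UQ where "UQ = {\<gamma>\<in>\<rat>. \<exists>\<alpha> q. (\<alpha>, q) \<in> upper_region T \<A> d m f A \<and> \<beta> > 0 \<and> q < (\<gamma> - \<alpha>) * \<beta>}"
  have cnt: "countable LQ" "countable UQ"
    unfolding LQ_def UQ_def using countable_rat by (auto intro: countable_subset[rotated])
  have "AE \<omega> in P. hoelder_at (\<lambda>A'. jump_integral m \<nu> \<Xi> f A' \<omega>) A \<gamma>" if \<gamma>: "\<gamma> \<in> LQ" for \<gamma>
  proof -
    obtain \<alpha> q q' where reg: "(\<alpha>, q, q') \<in> lower_region T \<A> d m f A" and *: "\<gamma> \<ge> 0" "\<gamma> * \<beta> < q" "\<gamma> < \<alpha> \<or> (\<gamma> - \<alpha>) * \<beta> < q'"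
      using \<gamma> unfolding LQ_def by blast
    have "q' \<ge> 0" using reg unfolding lower_region_def by auto
    then obtain b where b: "0 < b" "integrable \<nu> (\<lambda>x. \<bar>x\<bar> powr b)" "small_jumps_summable \<nu> \<longrightarrow> b \<le> 1"
      "\<not> small_jumps_summable \<nu> \<longrightarrow> 1 \<le> b \<and> b \<le> 2" "\<gamma> * b < q" "(\<gamma> - \<alpha>) * b < q'"
      using choose_moment[of \<gamma> q \<alpha> q'] * unfolding \<beta>_def by blast
    show ?thesis unfolding hoelder_at_def
      by (rule hoelder_lower[OF A f(1) f(2)[OF A] \<rho>0 reg b(1,2) b(3)[rule_format] b(4)[rule_format] b(5,6) *(1)])
  qed
  then have 1: "AE \<omega> in P. \<forall>\<gamma>\<in>LQ. hoelder_at (\<lambda>A'. jump_integral m \<nu> \<Xi> f A' \<omega>) A \<gamma>"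
    using cnt(1) by (subst AE_ball_countable) auto
  have "AE \<omega> in P. \<not> hoelder_at (\<lambda>A'. jump_integral m \<nu> \<Xi> f A' \<omega>) A \<gamma>" if "\<gamma> \<in> UQ" for \<gamma>
    using that hoelder_upper[OF A f \<rho>0] unfolding UQ_def \<beta>_def by blast
  then have 2: "AE \<omega> in P. \<forall>\<gamma>\<in>UQ. \<not> hoelder_at (\<lambda>A'. jump_integral m \<nu> \<Xi> f A' \<omega>) A \<gamma>"
    using cnt(2) by (subst AE_ball_countable) auto
  show ?thesis using 1 2 unfolding \<beta>_def[symmetric]
  proof eventually_elim
    case (elim \<omega>)
    let ?Y = "\<lambda>V. jump_integral m \<nu> \<Xi> f V \<omega>"
    let ?H = "holder_exponent \<A> d ?Y A"
    have low: "min (quot_lower q \<beta>) (quot_lower q' \<beta> + ennreal \<alpha>) \<le> ?H"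
      if reg: "(\<alpha>, q, q') \<in> lower_region T \<A> d m f A" for \<alpha> q q'
    \<comment> \<open>A value \<open>v\<close> strictly below the bound leaves room for a rational
      \<open>\<gamma>\<close> in between, and that \<open>\<gamma>\<close> lies in
      \<open>LQ\<close>.\<close>
    proof (rule dense_le)
      fix v assume v: "v < min (quot_lower q \<beta>) (quot_lower q' \<beta> + ennreal \<alpha>)"
      then obtain e where e: "v < e" "e < min (quot_lower q \<beta>) (quot_lower q' \<beta> + ennreal \<alpha>)" using dense by blast
      have fin: "v < \<infinity>" "e < \<infinity>" using e by (auto simp: less_top intro: less_le_trans)
      define x where "x = enn2real v"
      define z where "z = enn2real e"
      have xz: "v = ennreal x" "e = ennreal z" "0 \<le> x" using fin by (auto simp: x_def z_def less_top)
      have "x < z" using e(1) unfolding xz using xz(3) by (simp add: ennreal_less_iff)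
      then obtain \<gamma> where \<gamma>: "\<gamma> \<in> \<rat>" "x < \<gamma>" "\<gamma> < z" using Rats_dense_in_real by blast
      have \<gamma>0: "\<gamma> \<ge> 0" using \<gamma>(2) xz(3) by simp
      have "ennreal \<gamma> < e" unfolding xz using \<gamma> \<gamma>0 by (intro ennreal_lessI) auto
      then have lt: "ennreal \<gamma> < quot_lower q \<beta>" "ennreal \<gamma> < quot_lower q' \<beta> + ennreal \<alpha>" using e(2) by auto
      have nn: "\<alpha> \<ge> 0" "q \<ge> 0" "q' \<ge> 0" using reg unfolding lower_region_def by auto
      have "\<gamma> \<in> LQ" unfolding LQ_def
        using \<gamma>(1) \<gamma>0 reg quot_lower_less[OF lt(1) \<gamma>0 nn(2) \<beta>0] quot_lower_add_less[OF lt(2) \<gamma>0 nn(3) \<beta>0 nn(1)] by blast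
      then have "hoelder_at ?Y A \<gamma>" using elim(1) by blast
      then have "ennreal \<gamma> \<le> ?H" unfolding holder_exponent_alt using \<gamma>0 by (intro Sup_upper) blast
      moreover have "v \<le> ennreal \<gamma>" unfolding xz using \<gamma>(2) by (intro ennreal_leI) simp
      ultimately show "v \<le> ?H" by simp
    qed
    have up: "?H \<le> quot_upper q \<beta> + ennreal \<alpha>" if reg: "(\<alpha>, q) \<in> upper_region T \<A> d m f A" for \<alpha> q
    proof (cases "\<beta> = 0")
      case False
      have nn: "\<alpha> \<ge> 0" "q \<ge> 0" using reg unfolding upper_region_def by auto
      have quot: "quot_upper q \<beta> + ennreal \<alpha> = ennreal (q / \<beta> + \<alpha>)"
        using False nn \<beta>0 by (simp add: quot_upper_def divide_ennreal)
      show ?thesis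
      proof (rule ccontr)
        assume "\<not> ?thesis"
        then have "ennreal (q / \<beta> + \<alpha>) < Sup {ennreal \<gamma> | \<gamma>. \<gamma> \<ge> 0 \<and> hoelder_at ?Y A \<gamma>}"
          unfolding quot holder_exponent_alt by simp
        then obtain \<gamma>0 where g0: "\<gamma>0 \<ge> 0" "hoelder_at ?Y A \<gamma>0" "ennreal (q / \<beta> + \<alpha>) < ennreal \<gamma>0"
          unfolding less_Sup_iff by blast
        have "0 \<le> q / \<beta> + \<alpha>" using nn \<beta>0 by simp
        then have "q / \<beta> + \<alpha> < \<gamma>0" using g0(3) ennreal_less_iff by blast
        then obtain \<gamma> where \<gamma>: "\<gamma> \<in> \<rat>" "q / \<beta> + \<alpha> < \<gamma>" "\<gamma> < \<gamma>0" using Rats_dense_in_real by blast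
        have "q < (\<gamma> - \<alpha>) * \<beta>" using \<gamma>(2) False \<beta>0 by (simp add: field_simps)
        then have "\<gamma> \<in> UQ" unfolding UQ_def using \<gamma>(1) reg False \<beta>0 by auto
        moreover have "hoelder_at ?Y A \<gamma>" using hoelder_at_mono[OF g0(2)] \<gamma>(3) by simp
        ultimately show False using elim(2) by blast
      qed
    qed (simp add: quot_upper_def)
    show ?case using low up by (auto intro!: SUP_least INF_greatest)
  qed
qed

end

section \<open>Reduction to the jump integral, with a separate case for the absence of jumps\<close>

theorem theorem4p3:
  fixes T :: "'t set" and \<A> :: "'t set set" and An :: "nat \<Rightarrow> 't set set"
    and d :: "'t set \<Rightarrow> 't set \<Rightarrow> real" and m :: "'t measure"
    and P :: "'w measure" and \<sigma> :: real and \<nu> :: "real measure"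
    and B :: "'t set \<Rightarrow> 'w \<Rightarrow> real" and \<Xi> :: "'w \<Rightarrow> ('t \<times> real) set"
    and f :: "'t \<Rightarrow> real" and A :: "'t set"
  assumes "indexing_collection T \<A> An"
    and "finite_dimensional \<A> An"
    and "compatible_metric T \<A> An d"
    and "space m = T" and "sets m = sigma_sets T \<A>"
    and "\<forall>A\<in>\<A>. emeasure m A < \<infinity>"
    and "compatible_metric T \<A> An (measure_metric m)"
    and "prob_space P" and "complete_measure P"
    and "\<sigma> \<ge> 0"
    and "sets \<nu> = sets borel" and "emeasure \<nu> {0} = 0"
    and "(\<integral>\<^sup>+x. ennreal (x\<^sup>2) \<partial>\<nu>) < \<infinity>"
    and "set_indexed_brownian P \<A> m B"
    and "poisson_random_set P (m \<Otimes>\<^sub>M \<nu>) \<Xi>"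
    and "indep_noises P \<A> (m \<Otimes>\<^sub>M \<nu>) B \<Xi>"
    and "locally_levy_integrable \<A> m \<sigma> \<nu> f"
    and "A \<in> \<A>"
    and "\<sigma>\<^sup>2 = 0"
    and "\<exists>\<rho>0>0. bdd_above ((\<lambda>s. \<bar>f s\<bar>) ` victiny \<A> d A \<rho>0)"
  shows "AE \<omega> in P.
    (SUP (\<alpha>, q, q')\<in>lower_region T \<A> d m f A.
        min (quot_lower q (blumenthal_getoor \<nu>))
            (quot_lower q' (blumenthal_getoor \<nu>) + ennreal \<alpha>))
      \<le> holder_exponent \<A> d (\<lambda>A'. levy_integral P \<A> m B \<Xi> \<sigma> \<nu> f A' \<omega>) A \<and>
    holder_exponent \<A> d (\<lambda>A'. levy_integral P \<A> m B \<Xi> \<sigma> \<nu> f A' \<omega>) A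
      \<le> (INF (\<alpha>, q)\<in>upper_region T \<A> d m f A.
            quot_upper q (blumenthal_getoor \<nu>) + ennreal \<alpha>)"
proof -
  interpret prob_space P by (rule assms(8))
  interpret levy_m T \<A> An d m P \<nu> \<Xi>
    by unfold_locales (use assms in auto)
  \<comment> \<open>The factor \<open>\<sigma> = 0\<close> removes the Wiener integral, whichever
    version the choice operator picks.\<close>
  have \<sigma>0: "levy_integral P \<A> m B \<Xi> \<sigma> \<nu> f A' \<omega> = jump_integral m \<nu> \<Xi> f A' \<omega>" for A' \<omega>
    using \<open>\<sigma>\<^sup>2 = 0\<close> by (simp add: levy_integral_def)
  have fm: "f \<in> borel_measurable m" using assms(17) by (simp add: locally_levy_integrable_def)
  show ?thesis
  \<comment> \<open>If the second moment of \<open>\<nu>\<close> vanishes, local integrability says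
    nothing about the integral of \<open>f^2\<close>, which it multiplies by \<open>0\<close>. In
    that case there are no jumps and \<open>\<beta> = 0\<close>; the exponent is infinite, and so is
    every \<open>quot_upper\<close>.\<close>
  proof (cases "(\<integral>\<^sup>+x. ennreal (x\<^sup>2) \<partial>\<nu>) = 0")
    case False
    have "integrable m (\<lambda>t. (f t * indicator D t)\<^sup>2)" if D: "D \<in> \<A>" for D
    proof (rule integrableI_bounded)
      show "(\<lambda>t. (f t * indicator D t)\<^sup>2) \<in> borel_measurable m" using fm D by measurable
      have "(ennreal (\<sigma>\<^sup>2) + (\<integral>\<^sup>+x. ennreal (x\<^sup>2) \<partial>\<nu>)) * (\<integral>\<^sup>+s\<in>D. ennreal ((f s)\<^sup>2) \<partial>m) < \<infinity>"
        using assms(17) D unfolding locally_levy_integrable_def by (auto simp: less_top)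
      then have "(\<integral>\<^sup>+s\<in>D. ennreal ((f s)\<^sup>2) \<partial>m) < \<infinity>" using False by (auto simp: ennreal_mult_less_top)
      moreover have "(\<integral>\<^sup>+s\<in>D. ennreal ((f s)\<^sup>2) \<partial>m) = (\<integral>\<^sup>+t. ennreal (norm ((f t * indicator D t)\<^sup>2)) \<partial>m)"
        by (intro nn_integral_cong) (auto simp: indicator_def)
      ultimately show "(\<integral>\<^sup>+t. ennreal (norm ((f t * indicator D t)\<^sup>2)) \<partial>m) < \<infinity>" by simp
    qed
    moreover obtain \<rho>0 K where "\<rho>0 > 0" "\<And>s. s \<in> victiny \<A> d A \<rho>0 \<Longrightarrow> \<bar>f s\<bar> \<le> K"
      using assms(20) unfolding bdd_above_def by auto
    ultimately show ?thesis unfolding \<sigma>0 using hoelder_exponent_bounds[OF assms(18) fm] by blast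
  next
    case True
    have small0: "(\<integral>\<^sup>+x\<in>{x. \<bar>x\<bar> \<le> 1}. ennreal (\<bar>x\<bar> powr b) \<partial>\<nu>) = 0" if "b > 0" for b
    proof -
      have "AE x in \<nu>. ennreal (x\<^sup>2) = 0" using True by (subst (asm) nn_integral_0_iff_AE) auto
      then have "AE x in \<nu>. ennreal (\<bar>x\<bar> powr b) * indicator {x. \<bar>x\<bar> \<le> 1} x = 0" by eventually_elim auto
      then show ?thesis by (subst nn_integral_0_iff_AE) auto
    qed
    have \<beta>0: "blumenthal_getoor \<nu> = 0"
    proof -
      have "blumenthal_getoor \<nu> \<le> b" if "b > 0" for b using blumenthal_getoor_le[OF that] small0[OF that] by simp
      then show ?thesis using blumenthal_getoor_nonneg by (meson dense_ge order_antisym)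
    qed
    have summ: "small_jumps_summable \<nu>" unfolding summable_iff using small0[of 1] by simp
    have "AE x in \<nu>. x = 0"
    proof -
      have "AE x in \<nu>. ennreal (x\<^sup>2) = 0" using True by (subst (asm) nn_integral_0_iff_AE) auto
      then show ?thesis by eventually_elim auto
    qed
    then have "emeasure \<nu> {x. x \<noteq> 0} = 0" using AE_iff_measurable[of "{x. x \<noteq> 0}" \<nu> "\<lambda>x. x = 0"] by (simp add: space_\<nu> sets_\<nu>)
    then have z0: "emeasure (m \<Otimes>\<^sub>M \<nu>) (T \<times> {x. x \<noteq> 0}) = 0" by (subst emeasure_times_\<nu>) auto
    have "AE \<omega> in P. \<Xi> \<omega> \<inter> T \<times> {x. x \<noteq> 0} = {}"
    proof -
      have s: "T \<times> {x. x \<noteq> 0} \<in> sets (m \<Otimes>\<^sub>M \<nu>)" by (intro pair_measureI) (auto simp: sets_\<nu>)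
      \<comment> \<open>Campbell's formula turns zero intensity into the almost sure absence of
        points.\<close>
      have "(\<integral>\<^sup>+\<omega>. (\<integral>\<^sup>+p. indicator (T \<times> {x. x \<noteq> 0}) p \<partial>count_space (\<Xi> \<omega>)) \<partial>P) = 0"
        using Campbell[of "indicator (T \<times> {x. x \<noteq> 0})"] s z0 by simp
      then have "AE \<omega> in P. (\<integral>\<^sup>+p. indicator (T \<times> {x. x \<noteq> 0}) p \<partial>count_space (\<Xi> \<omega>)) = (0::ennreal)"
        using Campbell[of "indicator (T \<times> {x. x \<noteq> 0})"] s by (subst (asm) nn_integral_0_iff_AE) auto
      then show ?thesis
        by eventually_elim (auto simp: nn_integral_0_iff_AE AE_count_space indicator_eq_0_iff)
    qed
    then have "AE \<omega> in P. \<forall>A'. jump_integral m \<nu> \<Xi> f A' \<omega> = 0"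
      using AE_space
    proof eventually_elim
      case (elim \<omega>)
      have "jump_sum \<Xi> f \<epsilon> A' \<omega> = 0" if "\<epsilon> > 0" for \<epsilon> A'
      proof -
        have "{(t, J) \<in> \<Xi> \<omega>. t \<in> A' \<and> \<epsilon> \<le> \<bar>J\<bar>} = {}"
          using elim points_space[of \<omega>] that space_m by (auto simp: space_pair_measure)
        then show ?thesis unfolding jump_sum_def by (simp only: sum.empty)
      qed
      then have "((\<lambda>\<epsilon>. jump_sum \<Xi> f \<epsilon> A' \<omega>) \<longlongrightarrow> 0) (at_right 0)" for A'
        by (intro tendsto_eventually) (auto simp: eventually_at_right_field intro!: exI[of _ 1])
      then show ?case unfolding jump_integral_def using summ by (auto intro!: tendsto_Lim)
    qed
    then show ?thesis
    proof eventually_elim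
      case (elim \<omega>)
      have H: "hoelder_at (\<lambda>A'. jump_integral m \<nu> \<Xi> f A' \<omega>) A \<gamma>" for \<gamma>
        unfolding hoelder_at_def using elim by (intro exI[of _ 0] exI[of _ 1]) auto
      have "holder_exponent \<A> d (\<lambda>A'. jump_integral m \<nu> \<Xi> f A' \<omega>) A = \<infinity>"
      proof (rule ccontr)
        let ?H = "holder_exponent \<A> d (\<lambda>A'. jump_integral m \<nu> \<Xi> f A' \<omega>) A"
        assume "?H \<noteq> \<infinity>"
        define h where "h = enn2real ?H"
        have h: "?H = ennreal h" "h \<ge> 0" using \<open>?H \<noteq> \<infinity>\<close> by (auto simp: h_def less_top)
        \<comment> \<open>Every exponent is admissible for a vanishing process, so
          \<open>h + 1\<close> refutes a finite supremum \<open>h\<close>.\<close>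
        have "ennreal (h + 1) \<in> {ennreal \<gamma> | \<gamma>. \<gamma> \<ge> 0 \<and> hoelder_at (\<lambda>A'. jump_integral m \<nu> \<Xi> f A' \<omega>) A \<gamma>}"
          using H h(2) by (intro CollectI exI[of _ "h + 1"]) simp
        then have "ennreal (h + 1) \<le> ?H" unfolding holder_exponent_alt by (rule Sup_upper)
        then show False unfolding h(1) using h(2) by (simp add: ennreal_le_iff del: ennreal_plus)
      qed
      then show ?case unfolding \<sigma>0 \<beta>0 by (auto simp: quot_upper_def intro!: INF_greatest)
    qed
  qed
qed

end
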